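(* Let $u(t_n)$ and $u^n$ be the solutions of the parabolic equation $u'(t)-\Delta u(t)=f(t)$, $0<t<T$, $u(0)=u^0$ (with homogeneous Dirichlet boundary conditions), and of the WSBDF2 method with the same initial value $u^0$, respectively. Then the time-discrete solution $u^n$ is convergent in the $L^2$ norm: $$\|u(t_n)-u^n\|\le C\Bigl(\tau_{\max}^2\max_{0<t\le t_1}\|\partial_{tt}u\|+t_n\,\tau_{\max}^2\max_{0<t\le T}\|\partial_{ttt}u\|\Bigr)\qquad\text{for } n\ge1,$$ where $C>0$ is a constant independent of $u$, $n$ and the time grid.
   Context: Let $\theta\in[1/2,1]$. Let $(\cdot,\cdot)$ and $\|\cdot\|$ be the inner product and norm of $L^2(\Omega)$, where $\Omega$ is a domain for which there is a constant $C_\Omega>0$ with $\|\phi\|\le C_\Omega\|\nabla\phi\|$ for all $\phi\in H_0^1(\Omega)$. Let $0=t_0<t_1<\cdots<t_N=T$ be a nonuniform time grid with steps $\tau_k=t_k-t_{k-1}$ ($1\le k\le N$), ratios $r_k=\tau_k/\tau_{k-1}$ ($2\le k\le N$), and $\tau_{\max}=\max_{1\le k\le N}\tau_k$; time indices $n$ run up to $N$. Write $\nabla_\tau v^n=v^n-v^{n-1}$. The WSBDF2 (weighted and shifted BDF2) discrete convolution kernels are $b_0^{(1)}=1/\tau_1$ and, for $n\ge2$, $$b_0^{(n)}=\frac{1+2\theta r_n}{\tau_n(1+r_n)},\qquad b_1^{(n)}=\frac{(1-2\theta)r_n^2}{\tau_n(1+r_n)},\qquad b_j^{(n)}=0\ \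 (2\le j\le n-1),$$ and the WSBDF2 operator is $D_2v^n=\sum_{k=1}^n b_{n-k}^{(n)}\nabla_\tau v^k$, $n\ge1$ (so $D_2v^1=\nabla_\tau v^1/\tau_1$). Given $u^0$ and $f^n=f(t_n)$, the WSBDF2 method defines $u^n$ recursively by $$D_2u^n-\theta\Delta u^n-(1-\theta)\Delta u^{n-1}=\theta f^n+(1-\theta)f^{n-1},\qquad n\ge1,$$ understood weakly, tested against all $\phi\in H_0^1(\Omega)$ with $u^n\in H_0^1(\Omega)$. The exact solution $u$ is taken smooth enough in time for the right-hand side of the estimate to make sense. *)

theory Defs
  imports "HOL-Analysis.Analysis"
begin

section \<open>The space L2 on a subset of Euclidean space\<close>

text \<open>Elements of L2 are represented by functions, not by classes modulo null sets. The integral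
  of a non-integrable function is 0 in the library, so \<open>L2_norm\<close> is meaningful only on \<open>L2_space\<close>;
  membership is part of every definition below that uses it.\<close>

definition L2_space :: "'a::euclidean_space set \<Rightarrow> ('a \<Rightarrow> 'b::euclidean_space) set" where
  "L2_space \<Omega> = {v \<in> borel_measurable (lebesgue_on \<Omega>).
     integrable (lebesgue_on \<Omega>) (\<lambda>x. (norm (v x))\<^sup>2)}"

definition L2_inner ::
  "'a::euclidean_space set \<Rightarrow> ('a \<Rightarrow> 'b::euclidean_space) \<Rightarrow> ('a \<Rightarrow> 'b) \<Rightarrow> real" where
  "L2_inner \<Omega> v w = (LINT x|lebesgue_on \<Omega>. v x \<bullet> w x)"

definition L2_norm :: "'a::euclidean_space set \<Rightarrow> ('a \<Rightarrow> 'b::euclidean_space) \<Rightarrow> real" where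
  "L2_norm \<Omega> v = sqrt (L2_inner \<Omega> v v)"

section \<open>Test functions, weak gradients and the Sobolev space\<close>

primrec C_k :: "nat \<Rightarrow> ('a::euclidean_space \<Rightarrow> real) \<Rightarrow> bool" where
  "C_k 0 \<phi> \<longleftrightarrow> continuous_on UNIV \<phi>"
| "C_k (Suc k) \<phi> \<longleftrightarrow> (\<forall>x. \<phi> differentiable (at x)) \<and>
     (\<forall>i\<in>Basis. C_k k (\<lambda>x. frechet_derivative \<phi> (at x) i))"

text \<open>Test functions are defined on the whole space and vanish off a compact subset of \<open>\<Omega>\<close>.\<close>

definition test_function :: "'a::euclidean_space set \<Rightarrow> ('a \<Rightarrow> real) \<Rightarrow> bool" where
  "test_function \<Omega> \<phi> \<longleftrightarrow> (\<forall>k. C_k k \<phi>) \<and>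
     compact (closure {x. \<phi> x \<noteq> 0}) \<and> closure {x. \<phi> x \<noteq> 0} \<subseteq> \<Omega>"

definition classical_grad :: "('a::euclidean_space \<Rightarrow> real) \<Rightarrow> 'a \<Rightarrow> 'a" where
  "classical_grad \<phi> x = (\<Sum>i\<in>Basis. frechet_derivative \<phi> (at x) i *\<^sub>R i)"

definition has_weak_grad ::
  "'a::euclidean_space set \<Rightarrow> ('a \<Rightarrow> real) \<Rightarrow> ('a \<Rightarrow> 'a) \<Rightarrow> bool" where
  "has_weak_grad \<Omega> v g \<longleftrightarrow> v \<in> L2_space \<Omega> \<and> g \<in> L2_space \<Omega> \<and>
     (\<forall>\<phi>. test_function \<Omega> \<phi> \<longrightarrow> (\<forall>i\<in>Basis.
        L2_inner \<Omega> v (\<lambda>x. frechet_derivative \<phi> (at x) i) = - L2_inner \<Omega> (\<lambda>x. g x \<bullet> i) \<phi>))"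

text \<open>\<open>H01 \<Omega>\<close> is the closure of the test functions in the norm of H1.\<close>

definition has_H01_grad ::
  "'a::euclidean_space set \<Rightarrow> ('a \<Rightarrow> real) \<Rightarrow> ('a \<Rightarrow> 'a) \<Rightarrow> bool" where
  "has_H01_grad \<Omega> v g \<longleftrightarrow> has_weak_grad \<Omega> v g \<and>
     (\<exists>\<phi> :: nat \<Rightarrow> 'a \<Rightarrow> real. (\<forall>k. test_function \<Omega> (\<phi> k)) \<and>
        (\<lambda>k. L2_norm \<Omega> (\<lambda>x. \<phi> k x - v x)) \<longlonglongrightarrow> 0 \<and>
        (\<lambda>k. L2_norm \<Omega> (\<lambda>x. classical_grad (\<phi> k) x - g x)) \<longlonglongrightarrow> 0)"

definition H01 :: "'a::euclidean_space set \<Rightarrow> ('a \<Rightarrow> real) set" where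
  "H01 \<Omega> = {v. \<exists>g. has_H01_grad \<Omega> v g}"

text \<open>The gradient is determined only almost everywhere, hence the choice of a representative.\<close>

definition grad :: "'a::euclidean_space set \<Rightarrow> ('a \<Rightarrow> real) \<Rightarrow> 'a \<Rightarrow> 'a" where
  "grad \<Omega> v = (SOME g. has_H01_grad \<Omega> v g)"

section \<open>Continuity and differentiability in time with values in L2\<close>

definition L2_continuous_on ::
  "'a::euclidean_space set \<Rightarrow> real set \<Rightarrow> (real \<Rightarrow> 'a \<Rightarrow> real) \<Rightarrow> bool" where
  "L2_continuous_on \<Omega> S v \<longleftrightarrow> (\<forall>s\<in>S. v s \<in> L2_space \<Omega> \<and>
     ((\<lambda>q. L2_norm \<Omega> (\<lambda>x. v q x - v s x)) \<longlongrightarrow> 0) (at s within S))"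

definition has_L2_derivative_on ::
  "'a::euclidean_space set \<Rightarrow> real set \<Rightarrow> (real \<Rightarrow> 'a \<Rightarrow> real) \<Rightarrow> (real \<Rightarrow> 'a \<Rightarrow> real) \<Rightarrow> bool" where
  "has_L2_derivative_on \<Omega> S v v' \<longleftrightarrow> (\<forall>s\<in>S. v s \<in> L2_space \<Omega> \<and> v' s \<in> L2_space \<Omega> \<and>
     ((\<lambda>q. L2_norm \<Omega> (\<lambda>x. (v q x - v s x) / (q - s) - v' s x)) \<longlongrightarrow> 0) (at s within S))"

section \<open>The parabolic problem\<close>

text \<open>\<open>u1\<close> is the time derivative of \<open>u\<close>. The homogeneous Dirichlet condition is \<open>u s \<in> H01 \<Omega>\<close>.
  The equation is imposed on the open time interval only; continuity of \<open>f\<close> up to the end points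
  links the values \<open>f 0\<close> and \<open>f T\<close>, which the scheme uses, to the solution.\<close>

definition parabolic_solution ::
  "'a::euclidean_space set \<Rightarrow> real \<Rightarrow> (real \<Rightarrow> 'a \<Rightarrow> real) \<Rightarrow> ('a \<Rightarrow> real) \<Rightarrow>
     (real \<Rightarrow> 'a \<Rightarrow> real) \<Rightarrow> (real \<Rightarrow> 'a \<Rightarrow> real) \<Rightarrow> bool" where
  "parabolic_solution \<Omega> T f u0 u u1 \<longleftrightarrow>
     L2_continuous_on \<Omega> {0..T} f \<and>
     L2_continuous_on \<Omega> {0..T} u \<and>
     has_L2_derivative_on \<Omega> {0<..T} u u1 \<and>
     (\<forall>s\<in>{0..T}. u s \<in> H01 \<Omega>) \<and>
     (AE x in lebesgue_on \<Omega>. u 0 x = u0 x) \<and>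
     (\<forall>s\<in>{0<..<T}. \<forall>\<phi>\<in>H01 \<Omega>.
        L2_inner \<Omega> (u1 s) \<phi> + L2_inner \<Omega> (grad \<Omega> (u s)) (grad \<Omega> \<phi>) = L2_inner \<Omega> (f s) \<phi>)"

section \<open>The WSBDF2 method\<close>

definition time_grid :: "nat \<Rightarrow> real \<Rightarrow> (nat \<Rightarrow> real) \<Rightarrow> bool" where
  "time_grid N T t \<longleftrightarrow> N \<ge> 1 \<and> t 0 = 0 \<and> t N = T \<and> (\<forall>k\<in>{1..N}. t (k - 1) < t k)"

definition step :: "(nat \<Rightarrow> real) \<Rightarrow> nat \<Rightarrow> real" where
  "step t k = t k - t (k - 1)"

definition step_ratio :: "(nat \<Rightarrow> real) \<Rightarrow> nat \<Rightarrow> real" where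
  "step_ratio t k = step t k / step t (k - 1)"

definition max_step :: "nat \<Rightarrow> (nat \<Rightarrow> real) \<Rightarrow> real" where
  "max_step N t = Max (step t ` {1..N})"

text \<open>\<open>wsbdf2_kernel \<theta> t n j\<close> is the kernel with upper index \<open>n \<ge> 1\<close> and lower index \<open>j\<close>.\<close>

definition wsbdf2_kernel :: "real \<Rightarrow> (nat \<Rightarrow> real) \<Rightarrow> nat \<Rightarrow> nat \<Rightarrow> real" where
  "wsbdf2_kernel \<theta> t n j =
     (if n = 1 then (if j = 0 then 1 / step t 1 else 0)
      else if j = 0 then (1 + 2 * \<theta> * step_ratio t n) / (step t n * (1 + step_ratio t n))
      else if j = 1 then (1 - 2 * \<theta>) * (step_ratio t n)\<^sup>2 / (step t n * (1 + step_ratio t n))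
      else 0)"

definition wsbdf2_op ::
  "real \<Rightarrow> (nat \<Rightarrow> real) \<Rightarrow> (nat \<Rightarrow> 'a \<Rightarrow> real) \<Rightarrow> nat \<Rightarrow> 'a \<Rightarrow> real" where
  "wsbdf2_op \<theta> t v n x = (\<Sum>k=1..n. wsbdf2_kernel \<theta> t n (n - k) * (v k x - v (k - 1) x))"

definition wsbdf2_solution ::
  "'a::euclidean_space set \<Rightarrow> real \<Rightarrow> nat \<Rightarrow> (nat \<Rightarrow> real) \<Rightarrow> (real \<Rightarrow> 'a \<Rightarrow> real) \<Rightarrow>
     ('a \<Rightarrow> real) \<Rightarrow> (nat \<Rightarrow> 'a \<Rightarrow> real) \<Rightarrow> bool" where
  "wsbdf2_solution \<Omega> \<theta> N t f u0 U \<longleftrightarrow>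
     U 0 \<in> L2_space \<Omega> \<and>
     (AE x in lebesgue_on \<Omega>. U 0 x = u0 x) \<and>
     (\<forall>n\<in>{1..N}. U n \<in> H01 \<Omega> \<and>
        (\<forall>\<phi>\<in>H01 \<Omega>.
           L2_inner \<Omega> (wsbdf2_op \<theta> t U n) \<phi>
             + \<theta> * L2_inner \<Omega> (grad \<Omega> (U n)) (grad \<Omega> \<phi>)
             + (1 - \<theta>) * L2_inner \<Omega> (grad \<Omega> (U (n - 1))) (grad \<Omega> \<phi>)
           = L2_inner \<Omega> (\<lambda>x. \<theta> * f (t n) x + (1 - \<theta>) * f (t (n - 1)) x) \<phi>))"

end

theory Submission
  imports Defs
begin

text \<open>
  Why the estimate holds on every grid. Write \<open>\<delta>\<^sub>n\<close> for the difference quotient of the error \<open>e\<close> over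
  the \<open>n\<close>-th step, \<open>A = - \<Delta>\<close>, and \<open>c\<^sub>n = (2 \<theta> - 1) \<tau>\<^sub>n / (\<tau>\<^sub>n + \<tau>\<^sub>n\<^sub>-\<^sub>1)\<close>, with \<open>c\<^sub>1 = 0\<close>. Then the
  scheme reads
  \<open>(1 + c\<^sub>n) \<delta>\<^sub>n - c\<^sub>n \<delta>\<^sub>n\<^sub>-\<^sub>1 + A (\<theta> e\<^sub>n + (1 - \<theta>) e\<^sub>n\<^sub>-\<^sub>1) = R\<^sub>n\<close>.
  By linearity of this recursion, \<open>\<delta>\<^sub>n = d\<^sub>n - A z\<^sub>n\<close>, where \<open>d\<close> and \<open>z\<close> solve
  \<open>(1 + c\<^sub>n) d\<^sub>n = c\<^sub>n d\<^sub>n\<^sub>-\<^sub>1 + R\<^sub>n\<close> and \<open>(1 + c\<^sub>n) z\<^sub>n = c\<^sub>n z\<^sub>n\<^sub>-\<^sub>1 + \<theta> e\<^sub>n + (1 - \<theta>) e\<^sub>n\<^sub>-\<^sub>1\<close>.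
  When \<open>A\<close> is a number \<open>\<lambda> \<ge> 0\<close>, the map from \<open>(e\<^sub>n\<^sub>-\<^sub>1, z\<^sub>n\<^sub>-\<^sub>1)\<close> to \<open>(e\<^sub>n, z\<^sub>n)\<close> does not increase the
  maximum of the two moduli, up to the forcing \<open>\<tau>\<^sub>n \<bar>d\<^sub>n\<bar>\<close>. The weights enter this argument only through
  \<open>0 \<le> c\<^sub>n \<le> 2 \<theta> - 1 \<le> 1\<close>, which holds for all step ratios. It gives
  \<open>\<bar>e\<^sub>n\<bar> \<le> \<Sum>\<^sub>k \<tau>\<^sub>k \<bar>d\<^sub>k\<bar>\<close> (\<open>wsbdf2_mode_stability\<close>), a bound that does not involve \<open>\<lambda>\<close>.

  The maximum norm is not a quadratic form, so the passage to \<open>L2\<close> goes through modes. The scheme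
  tested only against the span of \<open>e\<^sub>1, \<dots>, e\<^sub>N\<close> is a finite-dimensional system for these same
  functions, and there the \<open>L2\<close> product and the Dirichlet form are simultaneously diagonal
  (\<open>simultaneous_diagonalization\<close>). The scalar bound in each mode, Parseval's identity for \<open>e\<^sub>n\<close>,
  Bessel's inequality for the residual and Minkowski's inequality give \<open>wsbdf2_L2_stability\<close>. The
  recursion for \<open>d\<close> has the factor \<open>c\<^sub>n / (1 + c\<^sub>n) \<le> 1/2\<close>. Hence the residual of the first step, which is
  only of first order, enters \<open>d\<^sub>k\<close> with the factor \<open>2\<^sup>1\<^sup>-\<^sup>k\<close> and contributes \<open>\<tau>\<^sub>m\<^sub>a\<^sub>x\<^sup>2 max \<parallel>\<partial>\<^sub>t\<^sub>t u\<parallel>\<close> to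
  the final sum, without a factor \<open>t\<^sub>n\<close>.

  Consistency is a statement about the real functions \<open>s \<mapsto> (u s, \<phi>)\<close>: the scheme differentiates at
  \<open>t\<^sub>n\<^sub>-\<^sub>1 + \<theta> \<tau>\<^sub>n\<close> the parabola through three grid points, and a Taylor expansion at \<open>t\<^sub>n\<close> bounds the
  residual (\<open>wsbdf2_consistency\<close>). The residual also needs the equation at the end points of the time
  interval; there it follows by continuity, because the gradients stay bounded
  and converge weakly (\<open>dirichlet_tendsto\<close>).
\<close>

section \<open>Orthogonal diagonalization of symmetric matrices\<close>

text \<open>A matrix is a function of pairs of indices, so that the set of orthogonal matrices lives in a
  product of real lines, where Tychonoff's theorem applies. Rows and columns are both required to be
  orthonormal; this spares the proof that one property implies the other.\<close>

definition real_orthogonal_on :: "'i set \<Rightarrow> ('i \<times> 'i \<Rightarrow> real) \<Rightarrow> bool" where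
  "real_orthogonal_on I Q \<longleftrightarrow>
     (\<forall>i\<in>I. \<forall>j\<in>I. (\<Sum>k\<in>I. Q (i, k) * Q (j, k)) = of_bool (i = j)) \<and>
     (\<forall>i\<in>I. \<forall>j\<in>I. (\<Sum>k\<in>I. Q (k, i) * Q (k, j)) = of_bool (i = j))"

lemma sum_of_bool_mult_left:
  fixes f :: "'i \<Rightarrow> real"
  assumes "finite I" "a \<in> I"
  shows "(\<Sum>b\<in>I. of_bool (a = b) * f b) = f a"
  using assms by (simp add: of_bool_def if_distrib[of "\<lambda>x. x * _"] cong: if_cong)

lemma orthogonal_expansion:
  assumes "finite I" "real_orthogonal_on I Q" "k \<in> I"
  shows "y k = (\<Sum>j\<in>I. Q (j, k) * (\<Sum>m\<in>I. Q (j, m) * y m))"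
proof -
  have "y k = (\<Sum>m\<in>I. of_bool (k = m) * y m)"
    by (simp add: sum_of_bool_mult_left assms)
  also have "\<dots> = (\<Sum>m\<in>I. (\<Sum>j\<in>I. Q (j, k) * Q (j, m)) * y m)"
    using assms by (intro sum.cong refl) (simp add: real_orthogonal_on_def)
  also have "\<dots> = (\<Sum>m\<in>I. \<Sum>j\<in>I. Q (j, k) * (Q (j, m) * y m))"
    by (simp add: sum_distrib_right mult.assoc)
  also have "\<dots> = (\<Sum>j\<in>I. Q (j, k) * (\<Sum>m\<in>I. Q (j, m) * y m))"
    by (subst sum.swap) (simp add: sum_distrib_left)
  finally show ?thesis .
qed

text \<open>The entry \<open>(i, j)\<close> of \<open>Q M Q\<^sup>T\<close>.\<close>

definition conjugate_entry ::
  "'i set \<Rightarrow> ('i \<Rightarrow> 'i \<Rightarrow> real) \<Rightarrow> ('i \<times> 'i \<Rightarrow> real) \<Rightarrow> 'i \<Rightarrow> 'i \<Rightarrow> real" where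
  "conjugate_entry I M Q i j = (\<Sum>k\<in>I. \<Sum>l\<in>I. M k l * Q (i, k) * Q (j, l))"

text \<open>A Jacobi rotation in the plane of the coordinates \<open>p\<close> and \<open>q\<close>.\<close>

definition rotate_rows ::
  "'i \<Rightarrow> 'i \<Rightarrow> real \<Rightarrow> real \<Rightarrow> ('i \<times> 'i \<Rightarrow> real) \<Rightarrow> 'i \<times> 'i \<Rightarrow> real" where
  "rotate_rows p q c s Q = (\<lambda>(i, k).
     if i = p then c * Q (p, k) + s * Q (q, k)
     else if i = q then c * Q (q, k) - s * Q (p, k)
     else Q (i, k))"

text \<open>A rotation changes two rows only, so sums over all rows before and after it differ by these two
  terms.\<close>

lemma sum_eq_if_pair_exchanged:
  fixes F F' :: "'i \<Rightarrow> real"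
  assumes "finite I" "p \<in> I" "q \<in> I" "p \<noteq> q"
    and "\<And>i. i \<in> I \<Longrightarrow> i \<noteq> p \<Longrightarrow> i \<noteq> q \<Longrightarrow> F' i = F i"
  shows "sum F' I - sum F I = (F' p + F' q) - (F p + F q)"
proof -
  have I: "I = insert p (insert q (I - {p, q}))" using assms by auto
  have "sum F' I = F' p + F' q + sum F' (I - {p, q})" for F' :: "'i \<Rightarrow> real"
    by (subst I) (use assms in simp)
  moreover have "sum F' (I - {p, q}) = sum F (I - {p, q})"
    using assms(5) by (intro sum.cong) auto
  ultimately show ?thesis by simp
qed

lemma rotate_rows_orthogonal:
  assumes fin: "finite I" and pq: "p \<in> I" "q \<in> I" "p \<noteq> q"
    and cs: "c\<^sup>2 + s\<^sup>2 = (1::real)" and Q: "real_orthogonal_on I Q"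
  shows "real_orthogonal_on I (rotate_rows p q c s Q)"
proof -
  let ?R = "rotate_rows p q c s Q"
  have row: "(\<Sum>k\<in>I. Q (i, k) * Q (j, k)) = of_bool (i = j)" if "i \<in> I" "j \<in> I" for i j
    using Q that by (auto simp: real_orthogonal_on_def)
  have col: "(\<Sum>k\<in>I. Q (k, i) * Q (k, j)) = of_bool (i = j)" if "i \<in> I" "j \<in> I" for i j
    using Q that by (auto simp: real_orthogonal_on_def)
  have lin: "(\<Sum>k\<in>I. (a * Q (i, k) + b * Q (j, k)) * (a' * Q (i', k) + b' * Q (j', k)))
      = a * a' * of_bool (i = i') + a * b' * of_bool (i = j')
        + b * a' * of_bool (j = i') + b * b' * of_bool (j = j')"
    if "i \<in> I" "j \<in> I" "i' \<in> I" "j' \<in> I" for a b a' b' :: real and i j i' j'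
  proof -
    have "(\<Sum>k\<in>I. (a * Q (i, k) + b * Q (j, k)) * (a' * Q (i', k) + b' * Q (j', k)))
      = a * a' * (\<Sum>k\<in>I. Q (i, k) * Q (i', k)) + a * b' * (\<Sum>k\<in>I. Q (i, k) * Q (j', k))
        + b * a' * (\<Sum>k\<in>I. Q (j, k) * Q (i', k)) + b * b' * (\<Sum>k\<in>I. Q (j, k) * Q (j', k))"
      by (simp add: sum_distrib_left sum.distrib[symmetric] algebra_simps)
    then show ?thesis using that by (simp add: row)
  qed
  \<comment> \<open>Every row of the rotated matrix is a combination \<open>a i Q\<^sub>i + b i Q\<^sub>m\<close>, where \<open>m = partner i\<close>.\<close>
  define a where "a i = (if i = p \<or> i = q then c else 1)" for i
  define b where "b i = (if i = p then s else if i = q then - s else 0)" for i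
  define partner where "partner i = (if i = p then q else if i = q then p else i)" for i
  have R: "?R (i, k) = a i * Q (i, k) + b i * Q (partner i, k)" for i k
    using pq by (auto simp: a_def b_def partner_def rotate_rows_def)
  have partner_in: "partner i \<in> I" if "i \<in> I" for i using that pq by (simp add: partner_def)
  have "(\<Sum>k\<in>I. ?R (i, k) * ?R (j, k)) = of_bool (i = j)" if "i \<in> I" "j \<in> I" for i j
    unfolding R lin[OF that(1) partner_in[OF that(1)] that(2) partner_in[OF that(2)]]
    using pq cs by (auto simp: a_def b_def partner_def power2_eq_square)
  moreover have "(\<Sum>k\<in>I. ?R (k, i) * ?R (k, j)) = of_bool (i = j)" if "i \<in> I" "j \<in> I" for i j
  proof -
    have "(\<Sum>k\<in>I. ?R (k, i) * ?R (k, j)) - (\<Sum>k\<in>I. Q (k, i) * Q (k, j))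
        = (?R (p, i) * ?R (p, j) + ?R (q, i) * ?R (q, j)) - (Q (p, i) * Q (p, j) + Q (q, i) * Q (q, j))"
      by (rule sum_eq_if_pair_exchanged[OF fin pq]) (auto simp: rotate_rows_def)
    also have "\<dots> = (c\<^sup>2 + s\<^sup>2 - 1) * (Q (p, i) * Q (p, j) + Q (q, i) * Q (q, j))"
      using pq by (simp add: rotate_rows_def algebra_simps power2_eq_square)
    finally show ?thesis using cs col that by simp
  qed
  ultimately show ?thesis by (simp add: real_orthogonal_on_def)
qed

text \<open>The bound on all entries, also on those with indices outside of \<open>I\<close>, places the set in a
  compact box.\<close>

lemma compact_real_orthogonal:
  fixes I :: "'i set"
  assumes "finite I"
  shows "compact {Q. real_orthogonal_on I Q \<and> (\<forall>i. \<bar>Q i\<bar> \<le> 1)}"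
proof -
  have box: "compact (PiE UNIV (\<lambda>_::'i \<times> 'i. {-1..1::real}))"
    using compactin_PiE[of "\<lambda>_. euclideanreal" UNIV "\<lambda>_::'i \<times> 'i. {-1..1::real}"]
    by (simp add: euclidean_product_topology)
  have "closed {Q::'i \<times> 'i \<Rightarrow> real. real_orthogonal_on I Q}"
    unfolding real_orthogonal_on_def
    unfolding Ball_def
    by (intro closed_Collect_conj closed_Collect_all closed_Collect_imp closed_Collect_eq
        open_Collect_const continuous_on_sum continuous_on_mult continuous_on_const
        continuous_on_product_coordinates)
  from compact_Int_closed[OF box this] show ?thesis
    by (rule back_subst[of compact]) (auto simp: PiE_def Pi_def abs_le_iff minus_le_iff)
qed

lemma real_orthogonal_entry_le_1:
  assumes "finite I" "real_orthogonal_on I Q" "i \<in> I" "k \<in> I"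
  shows "\<bar>Q (i, k)\<bar> \<le> 1"
proof -
  have "(Q (i, k))\<^sup>2 \<le> (\<Sum>k\<in>I. (Q (i, k))\<^sup>2)"
    using assms by (intro member_le_sum) auto
  also have "\<dots> = 1" using assms by (auto simp: real_orthogonal_on_def power2_eq_square)
  finally show ?thesis by (simp add: abs_square_le_1)
qed

text \<open>The symmetric 2 by 2 matrix with diagonal \<open>a, b\<close> and off-diagonal entry \<open>h\<close> becomes diagonal under
  the rotation by half of the polar angle of \<open>(a - b, 2 h)\<close>. Trace and Frobenius norm are invariant, so
  the squares on the diagonal gain exactly \<open>2 h\<^sup>2\<close>.\<close>

lemma rotation_increases_diagonal:
  fixes a b h :: real
  assumes "h \<noteq> 0"
  obtains c s where "c\<^sup>2 + s\<^sup>2 = 1"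
    "(c\<^sup>2 * a + 2 * c * s * h + s\<^sup>2 * b)\<^sup>2 + (c\<^sup>2 * b - 2 * c * s * h + s\<^sup>2 * a)\<^sup>2 > a\<^sup>2 + b\<^sup>2"
proof -
  define r where "r = sqrt ((2 * h)\<^sup>2 + (a - b)\<^sup>2)"
  have r2: "r\<^sup>2 = (2 * h)\<^sup>2 + (a - b)\<^sup>2" by (simp add: r_def)
  have r0: "r > 0" using assms by (simp add: r_def add_pos_nonneg)
  have "((a - b) / r)\<^sup>2 + (2 * h / r)\<^sup>2 = 1"
    using r2 r0 by (simp add: power_divide add_divide_distrib[symmetric]) (metis order_less_irrefl power_eq_0_iff)
  then obtain \<alpha> where al: "(a - b) / r = cos \<alpha>" "2 * h / r = sin \<alpha>"
    using sincos_total_2pi by metis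
  define c s where "c = cos (\<alpha>/2)" and "s = sin (\<alpha>/2)"
  have cs: "c\<^sup>2 + s\<^sup>2 = 1" by (simp add: c_def s_def)
  have c2: "cos \<alpha> = c\<^sup>2 - s\<^sup>2" and s2: "sin \<alpha> = 2 * s * c"
    using cos_double[of "\<alpha>/2"] sin_double[of "\<alpha>/2"] by (simp_all add: c_def s_def)
  have off: "(c\<^sup>2 - s\<^sup>2) * (2 * h) = (2 * s * c) * (a - b)"
    using al r0 unfolding c2[symmetric] s2[symmetric] by (metis mult.commute times_divide_eq_right)
  define A where "A = c\<^sup>2 * a + 2 * c * s * h + s\<^sup>2 * b"
  define B where "B = c\<^sup>2 * b - 2 * c * s * h + s\<^sup>2 * a"
  have "A + B = (c\<^sup>2 + s\<^sup>2) * (a + b)" by (simp add: A_def B_def algebra_simps)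
  then have AB: "A + B = a + b" by (simp add: cs)
  have "(A - B)\<^sup>2 + ((c\<^sup>2 - s\<^sup>2) * (2 * h) - (2 * s * c) * (a - b))\<^sup>2
      = (c\<^sup>2 + s\<^sup>2)\<^sup>2 * ((a - b)\<^sup>2 + (2 * h)\<^sup>2)"
    by (simp add: A_def B_def algebra_simps power2_eq_square)
  then have "(A - B)\<^sup>2 = (a - b)\<^sup>2 + (2 * h)\<^sup>2" by (simp add: cs off)
  then have "(A - B)\<^sup>2 > (a - b)\<^sup>2" using assms by simp
  moreover have "2 * (A\<^sup>2 + B\<^sup>2) = (A + B)\<^sup>2 + (A - B)\<^sup>2" "2 * (a\<^sup>2 + b\<^sup>2) = (a + b)\<^sup>2 + (a - b)\<^sup>2"
    by (simp_all add: power2_eq_square algebra_simps)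
  ultimately have "A\<^sup>2 + B\<^sup>2 > a\<^sup>2 + b\<^sup>2" using AB by simp
  then show thesis using that[OF cs] unfolding A_def B_def by blast
qed

text \<open>An orthogonal \<open>Q\<close> that maximizes the sum of the squares of the diagonal entries of \<open>Q M Q\<^sup>T\<close>
  exists by compactness. If an off-diagonal entry were nonzero, a Jacobi rotation would increase
  that sum.\<close>

lemma symmetric_matrix_diagonalizable:
  fixes M :: "'i \<Rightarrow> 'i \<Rightarrow> real"
  assumes fin: "finite I" and sym: "\<And>k l. k \<in> I \<Longrightarrow> l \<in> I \<Longrightarrow> M k l = M l k"
  obtains Q lam where "real_orthogonal_on I Q"
    "\<And>i k. i \<in> I \<Longrightarrow> k \<in> I \<Longrightarrow> (\<Sum>l\<in>I. M k l * Q (i, l)) = lam i * Q (i, k)"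
proof -
  let ?O = "{Q. real_orthogonal_on I Q \<and> (\<forall>i. \<bar>Q i\<bar> \<le> 1)}"
  let ?A = "conjugate_entry I M"
  let ?g = "\<lambda>Q. \<Sum>i\<in>I. (?A Q i i)\<^sup>2"
  have "(\<lambda>(i, k). of_bool (i = k)) \<in> ?O"
    using fin by (auto simp: real_orthogonal_on_def of_bool_conj[symmetric] simp del: of_bool_eq(1,2))
  then have "?O \<noteq> {}" by blast
  moreover have "continuous_on ?O ?g"
    unfolding conjugate_entry_def
    by (intro continuous_intros continuous_on_subset[OF continuous_on_product_coordinates]) auto
  ultimately obtain Q where Q: "Q \<in> ?O" and max: "\<And>Q'. Q' \<in> ?O \<Longrightarrow> ?g Q' \<le> ?g Q"
    using continuous_attains_sup[OF compact_real_orthogonal[OF fin], of ?g] by blast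
  have orth: "real_orthogonal_on I Q" using Q by simp
  have A_sym: "?A Q i j = ?A Q j i" for i j
    unfolding conjugate_entry_def
    by (subst sum.swap) (intro sum.cong refl, simp add: sym mult_ac)
  have off_diag: "?A Q p q = 0" if pq: "p \<in> I" "q \<in> I" "p \<noteq> q" for p q
  proof (rule ccontr)
    assume "?A Q p q \<noteq> 0"
    then obtain c s where cs: "c\<^sup>2 + s\<^sup>2 = 1" and larger:
      "(c\<^sup>2 * ?A Q p p + 2 * c * s * ?A Q p q + s\<^sup>2 * ?A Q q q)\<^sup>2
        + (c\<^sup>2 * ?A Q q q - 2 * c * s * ?A Q p q + s\<^sup>2 * ?A Q p p)\<^sup>2 > (?A Q p p)\<^sup>2 + (?A Q q q)\<^sup>2"
      using rotation_increases_diagonal by blast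
    let ?R = "rotate_rows p q c s Q"
    \<comment> \<open>Entries with an index outside of \<open>I\<close> are set to zero to stay in the compact box.\<close>
    let ?R' = "\<lambda>(i, k). if i \<in> I \<and> k \<in> I then ?R (i, k) else 0"
    have R: "real_orthogonal_on I ?R" by (intro rotate_rows_orthogonal fin pq cs orth)
    then have R': "real_orthogonal_on I ?R'" by (simp add: real_orthogonal_on_def)
    have "?R' \<in> ?O" using R' real_orthogonal_entry_le_1[OF fin R] by auto
    then have le: "?g ?R' \<le> ?g Q" by (rule max)
    have lin: "conjugate_entry I M P i i
       = a\<^sup>2 * ?A Q p p + a * b * (?A Q p q + ?A Q q p) + b\<^sup>2 * ?A Q q q"
      if "\<And>k. k \<in> I \<Longrightarrow> P (i, k) = a * Q (p, k) + b * Q (q, k)" for P i a b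
    proof -
      have "conjugate_entry I M P i i
        = (\<Sum>k\<in>I. \<Sum>l\<in>I. a\<^sup>2 * (M k l * Q (p, k) * Q (p, l)) + a * b * (M k l * Q (p, k) * Q (q, l))
            + a * b * (M k l * Q (q, k) * Q (p, l)) + b\<^sup>2 * (M k l * Q (q, k) * Q (q, l)))"
        unfolding conjugate_entry_def
        by (intro sum.cong refl) (simp add: that power2_eq_square algebra_simps)
      then show ?thesis
        by (simp add: conjugate_entry_def sum.distrib sum_distrib_left[symmetric] distrib_left)
    qed
    have Rp: "?A ?R' p p = c\<^sup>2 * ?A Q p p + 2 * c * s * ?A Q p q + s\<^sup>2 * ?A Q q q"
      by (subst lin[of _ _ c s]) (use pq in \<open>auto simp: rotate_rows_def A_sym[of q p]\<close>)
    have Rq: "?A ?R' q q = c\<^sup>2 * ?A Q q q - 2 * c * s * ?A Q p q + s\<^sup>2 * ?A Q p p"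
      by (subst lin[of _ _ "-s" c]) (use pq in \<open>auto simp: rotate_rows_def A_sym[of q p]\<close>)
    have "?A ?R' i i = ?A Q i i" if "i \<in> I" "i \<noteq> p" "i \<noteq> q" for i
      unfolding conjugate_entry_def using that
      by (intro sum.cong refl) (auto simp: rotate_rows_def)
    then have "?g ?R' - ?g Q = ((?A ?R' p p)\<^sup>2 + (?A ?R' q q)\<^sup>2) - ((?A Q p p)\<^sup>2 + (?A Q q q)\<^sup>2)"
      by (intro sum_eq_if_pair_exchanged[OF fin pq]) auto
    with le larger show False by (simp add: Rp Rq)
  qed
  have "(\<Sum>l\<in>I. M k l * Q (i, l)) = ?A Q i i * Q (i, k)" if ik: "i \<in> I" "k \<in> I" for i k
  proof -
    let ?y = "\<lambda>k. \<Sum>l\<in>I. M k l * Q (i, l)"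
    have A: "(\<Sum>m\<in>I. Q (j, m) * ?y m) = ?A Q j i" for j
      by (simp add: conjugate_entry_def sum_distrib_left mult_ac)
    have "?y k = (\<Sum>j\<in>I. Q (j, k) * (\<Sum>m\<in>I. Q (j, m) * ?y m))"
      by (rule orthogonal_expansion[OF fin orth ik(2)])
    also have "\<dots> = (\<Sum>j\<in>I. if j = i then Q (j, k) * ?A Q j i else 0)"
      unfolding A using ik off_diag by (intro sum.cong refl) auto
    also have "\<dots> = ?A Q i i * Q (i, k)" using fin ik by simp
    finally show ?thesis .
  qed
  with orth show thesis using that[of Q "\<lambda>i. ?A Q i i"] by blast
qed

text \<open>Two positive semidefinite forms, given by their matrices \<open>G\<close> and \<open>K\<close> with respect to
  vectors that may be linearly dependent. First \<open>G\<close> is diagonalized; its eigenvectors with positive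
  eigenvalue, rescaled, are \<open>G\<close>-orthonormal, and those with eigenvalue zero are annihilated by \<open>K\<close> as
  well and can be dropped. An orthogonal change of the remaining basis diagonalizes \<open>K\<close> and keeps it
  \<open>G\<close>-orthonormal. The rows of \<open>T\<close> are the coefficients of the modes, and the last property is
  Parseval's identity.\<close>

lemma simultaneous_diagonalization:
  fixes G K :: "'i \<Rightarrow> 'i \<Rightarrow> real"
  assumes fin: "finite S"
    and G_sym: "\<And>k l. k \<in> S \<Longrightarrow> l \<in> S \<Longrightarrow> G k l = G l k"
    and K_sym: "\<And>k l. k \<in> S \<Longrightarrow> l \<in> S \<Longrightarrow> K k l = K l k"
    and G_pos: "\<And>x. 0 \<le> (\<Sum>k\<in>S. x k * (\<Sum>l\<in>S. G k l * x l))"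
    and ker: "\<And>x k. (\<Sum>k\<in>S. x k * (\<Sum>l\<in>S. G k l * x l)) = 0 \<Longrightarrow> k \<in> S \<Longrightarrow> (\<Sum>l\<in>S. K k l * x l) = 0"
  obtains I :: "'i set" and T lam where "finite I"
    "\<And>i j. i \<in> I \<Longrightarrow> j \<in> I \<Longrightarrow> (\<Sum>k\<in>S. T i k * (\<Sum>l\<in>S. G k l * T j l)) = of_bool (i = j)"
    "\<And>i k. i \<in> I \<Longrightarrow> k \<in> S \<Longrightarrow> (\<Sum>l\<in>S. K k l * T i l) = lam i * (\<Sum>l\<in>S. G k l * T i l)"
    "\<And>k l. k \<in> S \<Longrightarrow> l \<in> S \<Longrightarrow>
       G k l = (\<Sum>i\<in>I. (\<Sum>m\<in>S. G k m * T i m) * (\<Sum>m\<in>S. G l m * T i m))"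
proof -
  obtain Q \<beta> where Q: "real_orthogonal_on S Q"
    and GQ: "\<And>i k. i \<in> S \<Longrightarrow> k \<in> S \<Longrightarrow> (\<Sum>l\<in>S. G k l * Q (i, l)) = \<beta> i * Q (i, k)"
    by (rule symmetric_matrix_diagonalizable[of S G]) (rule fin, rule G_sym, assumption+, rule that)
  have Q_row: "(\<Sum>k\<in>S. Q (i, k) * Q (j, k)) = of_bool (i = j)" if "i \<in> S" "j \<in> S" for i j
    using Q that by (auto simp: real_orthogonal_on_def)
  have form: "(\<Sum>k\<in>S. Q (i, k) * (\<Sum>l\<in>S. G k l * Q (i, l))) = \<beta> i" if "i \<in> S" for i
  proof -
    have "(\<Sum>k\<in>S. Q (i, k) * (\<Sum>l\<in>S. G k l * Q (i, l))) = \<beta> i * (\<Sum>k\<in>S. Q (i, k) * Q (i, k))"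
      using that by (simp add: GQ sum_distrib_left mult_ac)
    then show ?thesis using that by (simp add: Q_row)
  qed
  have \<beta>_nonneg: "\<beta> i \<ge> 0" if "i \<in> S" for i
    using G_pos[of "\<lambda>k. Q (i, k)"] form[OF that] by simp
  \<comment> \<open>The directions of positive \<open>G\<close>-length; the others are null for \<open>K\<close> too.\<close>
  define I where "I = {i \<in> S. \<beta> i > 0}"
  have I: "finite I" "\<And>i. i \<in> I \<Longrightarrow> i \<in> S \<and> \<beta> i > 0" using fin by (auto simp: I_def)
  define P where "P i k = Q (i, k) / sqrt (\<beta> i)" for i k
  have QP: "Q (i, k) = sqrt (\<beta> i) * P i k" if "i \<in> I" for i k
    using I(2)[OF that] by (simp add: P_def)
  define K' where "K' i j = (\<Sum>k\<in>S. P i k * (\<Sum>l\<in>S. K k l * P j l))" for i j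
  have K'_sym: "K' i j = K' j i" for i j
    unfolding K'_def sum_distrib_left
    by (subst sum.swap) (intro sum.cong refl, simp add: K_sym mult_ac)
  obtain R lam where R: "real_orthogonal_on I R"
    and KR: "\<And>i j. i \<in> I \<Longrightarrow> j \<in> I \<Longrightarrow> (\<Sum>b\<in>I. K' j b * R (i, b)) = lam i * R (i, j)"
    by (rule symmetric_matrix_diagonalizable[of I K']) (rule I(1), rule K'_sym, rule that)
  define T where "T i k = (\<Sum>b\<in>I. R (i, b) * P b k)" for i k
  have MT: "(\<Sum>l\<in>S. M k l * T i l) = (\<Sum>b\<in>I. R (i, b) * (\<Sum>l\<in>S. M k l * P b l))"
    for M :: "'i \<Rightarrow> 'i \<Rightarrow> real" and i k
    unfolding T_def sum_distrib_left
    by (subst sum.swap) (simp add: mult_ac)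
  have GP: "(\<Sum>l\<in>S. G k l * P b l) = sqrt (\<beta> b) * Q (b, k)" if "b \<in> I" "k \<in> S" for b k
  proof -
    have "(\<Sum>l\<in>S. G k l * P b l) = (\<Sum>l\<in>S. G k l * Q (b, l)) / sqrt (\<beta> b)"
      by (simp add: P_def sum_divide_distrib)
    also have "\<dots> = sqrt (\<beta> b) * Q (b, k)"
      using I(2)[OF that(1)] that(2) by (simp add: GQ field_simps real_sqrt_mult_self)
    finally show ?thesis .
  qed
  have GT: "(\<Sum>l\<in>S. G k l * T i l) = (\<Sum>b\<in>I. R (i, b) * (sqrt (\<beta> b) * Q (b, k)))" if "k \<in> S" for i k
    unfolding MT using that by (simp add: GP)
  have PGT: "(\<Sum>k\<in>S. P j k * (\<Sum>l\<in>S. G k l * T i l)) = R (i, j)" if "i \<in> I" "j \<in> I" for i j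
  proof -
    have "(\<Sum>k\<in>S. P j k * (\<Sum>l\<in>S. G k l * T i l))
        = (\<Sum>b\<in>I. R (i, b) * sqrt (\<beta> b) * (\<Sum>k\<in>S. P j k * Q (b, k)))"
      by (simp add: GT sum_distrib_left) (subst sum.swap, simp add: mult_ac)
    also have "\<dots> = (\<Sum>b\<in>I. of_bool (j = b) * R (i, b))"
    proof (intro sum.cong refl)
      fix b assume b: "b \<in> I"
      have "(\<Sum>k\<in>S. P j k * Q (b, k)) = (\<Sum>k\<in>S. Q (j, k) * Q (b, k)) / sqrt (\<beta> j)"
        by (simp add: P_def sum_divide_distrib)
      then show "R (i, b) * sqrt (\<beta> b) * (\<Sum>k\<in>S. P j k * Q (b, k)) = of_bool (j = b) * R (i, b)"
        using I(2)[OF b] I(2)[OF that(2)] by (simp add: Q_row)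
    qed
    finally show ?thesis using that I(1) by (simp add: sum_of_bool_mult_left)
  qed
  have orthonormal: "(\<Sum>k\<in>S. T i k * (\<Sum>l\<in>S. G k l * T j l)) = of_bool (i = j)"
    if "i \<in> I" "j \<in> I" for i j
  proof -
    have "(\<Sum>k\<in>S. T i k * (\<Sum>l\<in>S. G k l * T j l))
        = (\<Sum>b\<in>I. R (i, b) * (\<Sum>k\<in>S. P b k * (\<Sum>l\<in>S. G k l * T j l)))"
      unfolding T_def[of i] sum_distrib_right sum_distrib_left[of "R _"]
      by (subst sum.swap) (simp add: mult_ac)
    then show ?thesis using that R by (simp add: PGT real_orthogonal_on_def)
  qed
  moreover have "(\<Sum>l\<in>S. K k l * T i l) = lam i * (\<Sum>l\<in>S. G k l * T i l)" if ik: "i \<in> I" "k \<in> S" for i k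
  proof -
    define y where "y k = (\<Sum>l\<in>S. K k l * T i l) - lam i * (\<Sum>l\<in>S. G k l * T i l)" for k
    have "(\<Sum>k\<in>S. Q (j, k) * y k) = 0" if j: "j \<in> S" for j
    proof (cases "j \<in> I")
      case True
      have "(\<Sum>k\<in>S. P j k * (\<Sum>l\<in>S. K k l * T i l)) = (\<Sum>b\<in>I. K' j b * R (i, b))"
        unfolding MT[of K] K'_def sum_distrib_left[of "P _ _" _ I] sum_distrib_right
        by (subst sum.swap) (simp add: mult_ac)
      also have "\<dots> = lam i * (\<Sum>k\<in>S. P j k * (\<Sum>l\<in>S. G k l * T i l))"
        using KR ik True PGT by simp
      finally have "(\<Sum>k\<in>S. P j k * y k) = 0"
        by (simp add: y_def right_diff_distrib sum_subtractf sum_distrib_left mult_ac)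
      then show ?thesis
        using QP[OF True] by (simp add: mult.assoc flip: sum_distrib_left)
    next
      case False
      then have \<beta>0: "\<beta> j = 0" using \<beta>_nonneg[OF j] j by (simp add: I_def)
      have K0: "(\<Sum>l\<in>S. K k l * Q (j, l)) = 0" if "k \<in> S" for k
        using ker[of "\<lambda>k. Q (j, k)", OF _ that] form[OF j] \<beta>0 by simp
      have transpose: "(\<Sum>k\<in>S. Q (j, k) * (\<Sum>l\<in>S. M k l * T i l)) = (\<Sum>l\<in>S. T i l * (\<Sum>k\<in>S. M l k * Q (j, k)))"
        if "\<And>k l. k \<in> S \<Longrightarrow> l \<in> S \<Longrightarrow> M k l = M l k" for M :: "'i \<Rightarrow> 'i \<Rightarrow> real"
        unfolding sum_distrib_left
        by (subst sum.swap) (intro sum.cong refl, simp add: that mult_ac)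
      have "(\<Sum>k\<in>S. Q (j, k) * (\<Sum>l\<in>S. K k l * T i l)) = 0"
        by (subst transpose) (simp_all add: K_sym K0)
      moreover have "(\<Sum>k\<in>S. Q (j, k) * (\<Sum>l\<in>S. G k l * T i l)) = 0"
        by (subst transpose) (simp_all add: G_sym GQ j \<beta>0)
      ultimately show ?thesis
        by (simp add: y_def right_diff_distrib sum_subtractf sum_distrib_left[symmetric] mult.left_commute[of _ "lam i"])
    qed
    then have "y k = 0" using orthogonal_expansion[OF fin Q ik(2), of y] by simp
    then show ?thesis by (simp add: y_def)
  qed
  moreover have "G k l = (\<Sum>i\<in>I. (\<Sum>m\<in>S. G k m * T i m) * (\<Sum>m\<in>S. G l m * T i m))"
    if kl: "k \<in> S" "l \<in> S" for k l
  proof -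
    have col: "(\<Sum>i\<in>I. R (i, a) * R (i, b)) = of_bool (a = b)" if "a \<in> I" "b \<in> I" for a b
      using R that by (auto simp: real_orthogonal_on_def)
    let ?s = "\<lambda>b k. sqrt (\<beta> b) * Q (b, k)"
    have "(\<Sum>i\<in>I. (\<Sum>m\<in>S. G k m * T i m) * (\<Sum>m\<in>S. G l m * T i m))
        = (\<Sum>i\<in>I. \<Sum>a\<in>I. \<Sum>b\<in>I. R (i, a) * R (i, b) * (?s a k * ?s b l))"
      using kl by (simp add: GT sum_product mult_ac)
    also have "\<dots> = (\<Sum>a\<in>I. \<Sum>b\<in>I. (\<Sum>i\<in>I. R (i, a) * R (i, b)) * (?s a k * ?s b l))"
      unfolding sum_distrib_right
      by (rule trans[OF sum.swap], rule sum.cong[OF refl], rule sum.swap)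
    also have "\<dots> = (\<Sum>a\<in>I. ?s a k * ?s a l)"
      by (intro sum.cong refl) (simp add: col sum_of_bool_mult_left[OF I(1)])
    also have "\<dots> = (\<Sum>a\<in>I. \<beta> a * Q (a, k) * Q (a, l))"
      using I(2) by (intro sum.cong refl) (simp add: mult_ac less_imp_le)
    also have "\<dots> = (\<Sum>a\<in>S. \<beta> a * Q (a, k) * Q (a, l))"
      using fin \<beta>_nonneg by (intro sum.mono_neutral_left) (auto simp: I_def order.order_iff_strict)
    also have "\<dots> = (\<Sum>a\<in>S. Q (a, k) * (\<Sum>m\<in>S. Q (a, m) * G l m))"
      using kl GQ by (intro sum.cong refl) (simp add: mult_ac)
    also have "\<dots> = G l k" by (rule orthogonal_expansion[OF fin Q kl(1), symmetric])
    finally show ?thesis using G_sym kl by simp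
  qed
  ultimately show thesis using that[OF I(1)] by blast
qed

section \<open>Stability of a single mode\<close>

text \<open>The scheme with \<open>A = 0\<close>: the difference quotient \<open>d\<close> produced by the residuals alone.\<close>

primrec averaged_forcing :: "(nat \<Rightarrow> real) \<Rightarrow> (nat \<Rightarrow> real) \<Rightarrow> nat \<Rightarrow> real" where
  "averaged_forcing c R 0 = 0"
| "averaged_forcing c R (Suc n) = (c (Suc n) * averaged_forcing c R n + R (Suc n)) / (1 + c (Suc n))"

text \<open>The state \<open>z\<close> on which \<open>A\<close> acts once the scheme is solved for the current difference quotient.\<close>

primrec averaged_state :: "real \<Rightarrow> (nat \<Rightarrow> real) \<Rightarrow> (nat \<Rightarrow> real) \<Rightarrow> nat \<Rightarrow> real" where
  "averaged_state \<theta> c e 0 = 0"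
| "averaged_state \<theta> c e (Suc n) =
     (c (Suc n) * averaged_state \<theta> c e n + (\<theta> * e (Suc n) + (1 - \<theta>) * e n)) / (1 + c (Suc n))"

text \<open>The maximum principle behind the stability. Here \<open>x = \<tau> \<lambda>\<close>, \<open>(a, b)\<close> is the old pair \<open>(e, z)\<close>, and \<open>d\<close>
  the forcing times the step. Eliminating the implicit term gives, with \<open>D = 1 + c + \<theta> x\<close>, the
  relations \<open>D z = c b + a + \<theta> d\<close> and \<open>D e = (D - x) a - x c b + (1 + c) d\<close>. The coefficients of \<open>a\<close> and \<open>b\<close>
  have moduli summing to at most \<open>D\<close> in both: for \<open>e\<close>, this is \<open>c \<le> 1\<close> if \<open>D \<ge> x\<close>, and follows from
  \<open>c \<le> 2 \<theta> - 1\<close> if \<open>D < x\<close>.\<close>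

lemma wsbdf2_mode_step:
  fixes \<theta> c x a b m d :: real
  assumes \<theta>: "\<theta> \<ge> 0" "\<theta> \<le> 1" and c: "0 \<le> c" "c \<le> 2 * \<theta> - 1" and x: "x \<ge> 0"
    and a: "\<bar>a\<bar> \<le> m" and b: "\<bar>b\<bar> \<le> m"
    and z: "(1 + c) * z = c * b + (\<theta> * e + (1 - \<theta>) * a)"
    and e: "e = a + d - x * z"
  shows "\<bar>z\<bar> \<le> m + \<bar>d\<bar>" "\<bar>e\<bar> \<le> m + \<bar>d\<bar>"
proof -
  define D where "D = 1 + c + \<theta> * x"
  have D: "D > 0" using c x \<theta> by (simp add: D_def add_pos_nonneg)
  have m: "m \<ge> 0" using a by linarith
  have Dz: "D * z = c * b + a + \<theta> * d"
    using z unfolding D_def e by (simp add: algebra_simps)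
  have De: "D * e = (D - x) * a - x * c * b + (1 + c) * d"
  proof -
    have "D * e = D * a + D * d - x * (D * z)" by (simp add: e algebra_simps)
    also have "\<dots> = (D - x) * a - x * c * b + (D - x * \<theta>) * d"
      unfolding Dz by (simp add: algebra_simps)
    finally show ?thesis by (simp add: D_def mult_ac)
  qed
  have "D * \<bar>z\<bar> = \<bar>c * b + a + \<theta> * d\<bar>" using Dz D by (simp add: abs_mult flip: Dz)
  also have "\<dots> \<le> c * \<bar>b\<bar> + \<bar>a\<bar> + \<theta> * \<bar>d\<bar>"
  proof -
    have "\<bar>c * b\<bar> = c * \<bar>b\<bar>" "\<bar>\<theta> * d\<bar> = \<theta> * \<bar>d\<bar>"
      using c \<theta> by (simp_all add: abs_mult)
    then show ?thesis by linarith
  qed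
  also have "\<dots> \<le> c * m + m + 1 * \<bar>d\<bar>"
    using a b c \<theta> by (intro add_mono mult_left_mono mult_right_mono) auto
  also have "\<dots> \<le> D * m + D * \<bar>d\<bar>"
    using m c x \<theta> by (intro add_mono mult_right_mono) (auto simp: D_def algebra_simps)
  finally show "\<bar>z\<bar> \<le> m + \<bar>d\<bar>" using D by (simp flip: distrib_left)
  \<comment> \<open>The amplification factor of \<open>e\<close>: for \<open>\<theta> < 1\<close> and large \<open>x\<close> the coefficient \<open>D - x\<close> of \<open>a\<close> is negative.\<close>
  have Dx: "\<bar>D - x\<bar> + x * c \<le> D"
  proof (cases "D \<ge> x")
    case True
    have "x * c \<le> x * 1" using c \<theta> x by (intro mult_left_mono) auto
    with True show ?thesis by simp
  next
    case False
    have "x * c \<le> x * (2 * \<theta> - 1)" using c x by (intro mult_left_mono) auto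
    with False show ?thesis using c by (simp add: D_def algebra_simps)
  qed
  have "D * \<bar>e\<bar> = \<bar>(D - x) * a - x * c * b + (1 + c) * d\<bar>" using De D by (simp add: abs_mult flip: De)
  also have "\<dots> \<le> \<bar>D - x\<bar> * \<bar>a\<bar> + x * c * \<bar>b\<bar> + (1 + c) * \<bar>d\<bar>"
  proof -
    have "\<bar>x * c * b\<bar> = x * c * \<bar>b\<bar>" "\<bar>(1 + c) * d\<bar> = (1 + c) * \<bar>d\<bar>"
      using x c by (simp_all add: abs_mult)
    then show ?thesis using abs_mult[of "D - x" a] by linarith
  qed
  also have "\<dots> \<le> \<bar>D - x\<bar> * m + x * c * m + D * \<bar>d\<bar>"
    using a b c x \<theta> by (intro add_mono mult_left_mono mult_right_mono) (auto simp: D_def)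
  also have "\<dots> = (\<bar>D - x\<bar> + x * c) * m + D * \<bar>d\<bar>" by (simp add: algebra_simps)
  also have "\<dots> \<le> D * m + D * \<bar>d\<bar>" using Dx m by (intro add_mono mult_right_mono) auto
  finally show "\<bar>e\<bar> \<le> m + \<bar>d\<bar>" using D by (simp flip: distrib_left)
qed

text \<open>The bound is free of \<open>lam\<close>, and it is linear in the moduli of the averaged forcing; both are
  needed to sum it over the modes. The values \<open>e (n - 2)\<close> and \<open>\<tau> (n - 1)\<close> in the equation for \<open>n = 1\<close> are
  multiplied by \<open>c 1 = 0\<close>.\<close>

lemma wsbdf2_mode_stability:
  fixes \<theta> lam :: real and \<tau> c e R :: "nat \<Rightarrow> real"
  assumes \<theta>: "\<theta> \<ge> 0" "\<theta> \<le> 1" and lam: "lam \<ge> 0"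
    and \<tau>: "\<And>n. n \<in> {1..N} \<Longrightarrow> \<tau> n > 0"
    and c: "\<And>n. n \<in> {1..N} \<Longrightarrow> 0 \<le> c n \<and> c n \<le> 2 * \<theta> - 1" and c1: "c 1 = 0"
    and e0: "e 0 = 0"
    and eq: "\<And>n. n \<in> {1..N} \<Longrightarrow>
       (1 + c n) * ((e n - e (n - 1)) / \<tau> n) - c n * ((e (n - 1) - e (n - 2)) / \<tau> (n - 1))
         + lam * (\<theta> * e n + (1 - \<theta>) * e (n - 1)) = R n"
    and n: "n \<le> N"
  shows "\<bar>e n\<bar> \<le> (\<Sum>k=1..n. \<tau> k * \<bar>averaged_forcing c R k\<bar>)"
proof -
  let ?d = "averaged_forcing c R" and ?z = "averaged_state \<theta> c e"
  have split: "(e n - e (n - 1)) / \<tau> n = ?d n - lam * ?z n" if "n \<in> {1..N}" for n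
    using that
  proof (induction n)
    case (Suc n)
    have c': "1 + c (Suc n) > 0" using c[OF Suc.prems] by simp
    have prev: "c (Suc n) * ((e n - e (n - 1)) / \<tau> n) = c (Suc n) * (?d n - lam * ?z n)"
    proof (cases "n = 0")
      case False
      then show ?thesis using Suc by simp
    qed (use c1 in simp)
    have "(1 + c (Suc n)) * ((e (Suc n) - e n) / \<tau> (Suc n))
        = c (Suc n) * (?d n - lam * ?z n) + R (Suc n) - lam * (\<theta> * e (Suc n) + (1 - \<theta>) * e n)"
      using eq[OF Suc.prems] prev by (simp add: numeral_2_eq_2)
    also have "\<dots> = (1 + c (Suc n)) * (?d (Suc n) - lam * ?z (Suc n))"
      using c' by (simp add: right_diff_distrib) (simp add: algebra_simps)
    finally have "(1 + c (Suc n)) * ((e (Suc n) - e n) / \<tau> (Suc n))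
      = (1 + c (Suc n)) * (?d (Suc n) - lam * ?z (Suc n))" .
    then show ?case
      using c' by (subst (asm) mult_cancel_left) (simp del: averaged_forcing.simps averaged_state.simps)
  qed simp
  have "\<bar>?z n\<bar> \<le> (\<Sum>k=1..n. \<tau> k * \<bar>?d k\<bar>) \<and> \<bar>e n\<bar> \<le> (\<Sum>k=1..n. \<tau> k * \<bar>?d k\<bar>)"
    using n
  proof (induction n)
    case 0
    then show ?case using e0 by simp
  next
    case (Suc n)
    have n: "Suc n \<in> {1..N}" using Suc.prems by simp
    let ?m = "\<Sum>k=1..n. \<tau> k * \<bar>?d k\<bar>"
    have t: "\<tau> (Suc n) > 0" using \<tau>[OF n] .
    have z: "(1 + c (Suc n)) * ?z (Suc n) = c (Suc n) * ?z n + (\<theta> * e (Suc n) + (1 - \<theta>) * e n)"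
      using c[OF n] by simp
    have "e (Suc n) - e n = \<tau> (Suc n) * (?d (Suc n) - lam * ?z (Suc n))"
      using split[OF n] t by (simp add: field_simps del: averaged_forcing.simps averaged_state.simps)
    then have e: "e (Suc n) = e n + \<tau> (Suc n) * ?d (Suc n) - (\<tau> (Suc n) * lam) * ?z (Suc n)"
      by (simp add: algebra_simps del: averaged_forcing.simps averaged_state.simps)
    have IH: "\<bar>?z n\<bar> \<le> ?m" "\<bar>e n\<bar> \<le> ?m" using Suc by auto
    have x: "\<tau> (Suc n) * lam \<ge> 0" using t lam by simp
    have c': "0 \<le> c (Suc n)" "c (Suc n) \<le> 2 * \<theta> - 1" using c[OF n] by auto
    show ?case
      using wsbdf2_mode_step[OF \<theta> c' x IH(2) IH(1) z e] t by (simp add: abs_mult del: averaged_forcing.simps averaged_state.simps)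
  qed
  then show ?thesis by blast
qed

lemma L2_set_sum_le:
  "L2_set (\<lambda>i. \<Sum>k\<in>A. f k i) I \<le> (\<Sum>k\<in>A. L2_set (f k) I)"
proof (induction A rule: infinite_finite_induct)
  case (insert k A)
  then show ?case using L2_set_triangle_ineq[of "f k" "\<lambda>i. \<Sum>k\<in>A. f k i" I] by simp
qed (simp_all add: L2_set_0')

text \<open>Because \<open>c / (1 + c) \<le> 1/2\<close>, the first residual is forgotten geometrically and the later ones add up
  to at most twice their common bound. The index \<open>i\<close> runs over the modes.\<close>

lemma L2_set_averaged_forcing_le:
  fixes R :: "nat \<Rightarrow> 'i \<Rightarrow> real"
  assumes c: "\<And>n. n \<in> {1..N} \<Longrightarrow> 0 \<le> c n \<and> c n \<le> 1" and c1: "c 1 = 0"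
    and R1: "L2_set (R 1) I \<le> \<rho>1" and R: "\<And>n. n \<in> {2..N} \<Longrightarrow> L2_set (R n) I \<le> \<rho>"
    and \<rho>: "\<rho> \<ge> 0" and n: "n \<in> {1..N}"
  shows "L2_set (\<lambda>i. averaged_forcing c (\<lambda>k. R k i) n) I \<le> (1/2) ^ (n - 1) * \<rho>1 + 2 * \<rho>"
  using n
proof (induction n)
  case (Suc n)
  let ?d = "\<lambda>n i. averaged_forcing c (\<lambda>k. R k i) n"
  show ?case
  proof (cases "n = 0")
    case True
    then show ?thesis using R1 c1 \<rho> by simp
  next
    case False
    have c': "0 \<le> c (Suc n)" "c (Suc n) \<le> 1" using c[OF Suc.prems] by auto
    have "L2_set (?d (Suc n)) I
        = L2_set (\<lambda>i. c (Suc n) / (1 + c (Suc n)) * ?d n i + 1 / (1 + c (Suc n)) * R (Suc n) i) I"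
      by (simp add: add_divide_distrib)
    also have "\<dots> \<le> c (Suc n) / (1 + c (Suc n)) * L2_set (?d n) I
        + 1 / (1 + c (Suc n)) * L2_set (R (Suc n)) I"
      using c' by (intro order_trans[OF L2_set_triangle_ineq]) (simp add: L2_set_right_distrib del: times_divide_eq_left)
    also have "\<dots> \<le> 1/2 * L2_set (?d n) I + 1 * L2_set (R (Suc n)) I"
      using c' by (intro add_mono mult_right_mono) (auto simp: field_simps)
    also have "\<dots> \<le> 1/2 * ((1/2) ^ (n - 1) * \<rho>1 + 2 * \<rho>) + 1 * \<rho>"
      using Suc False R[of "Suc n"] by (intro add_mono mult_left_mono) auto
    also have "\<dots> = (1/2) ^ n * \<rho>1 + 2 * \<rho>"
      using False by (cases n) (auto simp: algebra_simps)
    finally show ?thesis by simp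
  qed
qed simp

section \<open>The inner product space of square integrable functions\<close>

lemma L2_inner_integrable:
  assumes v: "v \<in> L2_space \<Omega>" and w: "w \<in> L2_space \<Omega>"
  shows "integrable (lebesgue_on \<Omega>) (\<lambda>x. v x \<bullet> w x)"
proof (rule Bochner_Integration.integrable_bound)
  show "integrable (lebesgue_on \<Omega>) (\<lambda>x. (norm (v x))\<^sup>2 + (norm (w x))\<^sup>2)"
    using v w by (simp add: L2_space_def)
  show "(\<lambda>x. v x \<bullet> w x) \<in> borel_measurable (lebesgue_on \<Omega>)"
    using v w by (auto simp: L2_space_def)
  have "\<bar>v x \<bullet> w x\<bar> \<le> (norm (v x))\<^sup>2 + (norm (w x))\<^sup>2" for x
  proof -
    have "\<bar>v x \<bullet> w x\<bar> \<le> norm (v x) * norm (w x)" by (rule Cauchy_Schwarz_ineq2)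
    also have "\<dots> \<le> (norm (v x))\<^sup>2 + (norm (w x))\<^sup>2"
      using sum_squares_bound[of "norm (v x)" "norm (w x)"]
        mult_nonneg_nonneg[OF norm_ge_zero[of "v x"] norm_ge_zero[of "w x"]]
      by linarith
    finally show ?thesis .
  qed
  then show "AE x in lebesgue_on \<Omega>. norm (v x \<bullet> w x) \<le> norm ((norm (v x))\<^sup>2 + (norm (w x))\<^sup>2)"
    by simp
qed

lemma L2_space_add [intro]:
  assumes v: "v \<in> L2_space \<Omega>" and w: "w \<in> L2_space \<Omega>"
  shows "(\<lambda>x. v x + w x) \<in> L2_space \<Omega>"
proof -
  have "integrable (lebesgue_on \<Omega>) (\<lambda>x. (norm (v x))\<^sup>2 + 2 * (v x \<bullet> w x) + (norm (w x))\<^sup>2)"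
    using v w L2_inner_integrable[OF v w] by (simp add: L2_space_def)
  also have "(\<lambda>x. (norm (v x))\<^sup>2 + 2 * (v x \<bullet> w x) + (norm (w x))\<^sup>2) = (\<lambda>x. (norm (v x + w x))\<^sup>2)"
    by (simp add: power2_norm_eq_inner inner_add_left inner_add_right inner_commute add_ac)
  finally show ?thesis using v w by (auto simp: L2_space_def)
qed

lemma L2_space_scaleR [intro]:
  assumes v: "v \<in> L2_space \<Omega>"
  shows "(\<lambda>x. c *\<^sub>R v x) \<in> L2_space \<Omega>"
  using v by (auto simp: L2_space_def power_mult_distrib)

lemma L2_space_mult [intro]:
  fixes v :: "'a::euclidean_space \<Rightarrow> real"
  assumes "v \<in> L2_space \<Omega>"
  shows "(\<lambda>x. c * v x) \<in> L2_space \<Omega>"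
  using L2_space_scaleR[OF assms, of c] by simp

lemma L2_space_diff [intro]:
  assumes v: "v \<in> L2_space \<Omega>" and w: "w \<in> L2_space \<Omega>"
  shows "(\<lambda>x. v x - w x) \<in> L2_space \<Omega>"
  using L2_space_add[OF v L2_space_scaleR[OF w, of "-1"]] by simp

lemma L2_space_zero [simp]: "(\<lambda>x. 0) \<in> L2_space \<Omega>"
  by (simp add: L2_space_def)

lemma L2_space_sum [intro]:
  assumes "\<And>k. k \<in> A \<Longrightarrow> v k \<in> L2_space \<Omega>"
  shows "(\<lambda>x. \<Sum>k\<in>A. v k x) \<in> L2_space \<Omega>"
  using assms by (induction A rule: infinite_finite_induct) auto

lemma L2_space_component [intro]:
  assumes "g \<in> L2_space \<Omega>"
  shows "(\<lambda>x. g x \<bullet> i) \<in> L2_space \<Omega>"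
proof -
  have "(norm (g x \<bullet> i))\<^sup>2 \<le> (norm (g x))\<^sup>2 * (norm i)\<^sup>2" for x
    using power_mono[OF Cauchy_Schwarz_ineq2[of "g x" i], of 2] by (simp add: power_mult_distrib)
  then have "integrable (lebesgue_on \<Omega>) (\<lambda>x. (norm (g x \<bullet> i))\<^sup>2)"
    using assms
    by (intro Bochner_Integration.integrable_bound[where g = "\<lambda>x. (norm (g x \<bullet> i))\<^sup>2"
          and f = "\<lambda>x. (norm (g x))\<^sup>2 * (norm i)\<^sup>2"]) (auto simp: L2_space_def)
  then show ?thesis using assms by (auto simp: L2_space_def)
qed

lemma L2_inner_commute: "L2_inner \<Omega> v w = L2_inner \<Omega> w v"
  by (simp add: L2_inner_def inner_commute)

lemma L2_inner_add_left:
  assumes "v \<in> L2_space \<Omega>" "w \<in> L2_space \<Omega>" "z \<in> L2_space \<Omega>"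
  shows "L2_inner \<Omega> (\<lambda>x. v x + w x) z = L2_inner \<Omega> v z + L2_inner \<Omega> w z"
  using assms by (simp add: L2_inner_def inner_add_left L2_inner_integrable)

lemma L2_inner_add_right:
  assumes "v \<in> L2_space \<Omega>" "w \<in> L2_space \<Omega>" "z \<in> L2_space \<Omega>"
  shows "L2_inner \<Omega> z (\<lambda>x. v x + w x) = L2_inner \<Omega> z v + L2_inner \<Omega> z w"
  using assms by (simp add: L2_inner_def inner_add_right L2_inner_integrable)

lemma L2_inner_scaleR_left:
  "L2_inner \<Omega> (\<lambda>x. c *\<^sub>R v x) z = c * L2_inner \<Omega> v z"
  by (simp add: L2_inner_def)

lemma L2_inner_scaleR_right:
  "L2_inner \<Omega> z (\<lambda>x. c *\<^sub>R v x) = c * L2_inner \<Omega> z v"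
  by (simp add: L2_inner_def)

lemma L2_inner_mult_left:
  fixes v z :: "'a::euclidean_space \<Rightarrow> real"
  shows "L2_inner \<Omega> (\<lambda>x. c * v x) z = c * L2_inner \<Omega> v z"
  using L2_inner_scaleR_left[of \<Omega> c v z] by simp

lemma L2_inner_diff_left:
  assumes "v \<in> L2_space \<Omega>" "w \<in> L2_space \<Omega>" "z \<in> L2_space \<Omega>"
  shows "L2_inner \<Omega> (\<lambda>x. v x - w x) z = L2_inner \<Omega> v z - L2_inner \<Omega> w z"
  using assms by (simp add: L2_inner_def inner_diff_left L2_inner_integrable)

lemma L2_inner_diff_right:
  assumes "v \<in> L2_space \<Omega>" "w \<in> L2_space \<Omega>" "z \<in> L2_space \<Omega>"
  shows "L2_inner \<Omega> z (\<lambda>x. v x - w x) = L2_inner \<Omega> z v - L2_inner \<Omega> z w"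
  using L2_inner_diff_left[OF assms] by (simp add: L2_inner_commute)

lemma L2_inner_zero_left [simp]: "L2_inner \<Omega> (\<lambda>x. 0) z = 0"
  by (simp add: L2_inner_def)

lemma L2_inner_sum_left:
  assumes "\<And>k. k \<in> A \<Longrightarrow> v k \<in> L2_space \<Omega>" "z \<in> L2_space \<Omega>"
  shows "L2_inner \<Omega> (\<lambda>x. \<Sum>k\<in>A. v k x) z = (\<Sum>k\<in>A. L2_inner \<Omega> (v k) z)"
  using assms
proof (induction A rule: infinite_finite_induct)
  case (insert k A)
  then show ?case using L2_inner_add_left[of "v k" \<Omega> "\<lambda>x. \<Sum>k\<in>A. v k x" z] by auto
qed simp_all

lemma L2_inner_sum_mult_left:
  assumes "\<And>k. k \<in> A \<Longrightarrow> v k \<in> L2_space \<Omega>" "w \<in> L2_space \<Omega>"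
  shows "L2_inner \<Omega> (\<lambda>x. \<Sum>k\<in>A. a k * v k x) w = (\<Sum>k\<in>A. a k * L2_inner \<Omega> (v k) w)"
  using assms by (subst L2_inner_sum_left) (auto simp: L2_inner_mult_left)

lemma L2_inner_self_nonneg: "0 \<le> L2_inner \<Omega> v v"
  by (simp add: L2_inner_def)

lemma L2_norm_nonneg [simp]: "0 \<le> L2_norm \<Omega> v"
  by (simp add: L2_norm_def L2_inner_self_nonneg)

lemma L2_norm_power2: "(L2_norm \<Omega> v)\<^sup>2 = L2_inner \<Omega> v v"
  by (simp add: L2_norm_def L2_inner_self_nonneg)

lemma discriminant_nonneg_quadratic:
  fixes a b c :: real
  assumes "\<And>t. 0 \<le> a - 2 * t * b + t\<^sup>2 * c"
  shows "b\<^sup>2 \<le> a * c"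
proof (cases "c = 0")
  case True
  have "b = 0"
  proof (rule ccontr)
    assume "b \<noteq> 0"
    then show False using assms[of "(a + 1) / (2 * b)"] True by simp
  qed
  with True show ?thesis by simp
next
  case False
  have "c > 0"
  proof (rule ccontr)
    assume "\<not> c > 0"
    with False have c: "c < 0" by simp
    define s where "s = (\<bar>a\<bar> + 1) / (- c) + 1"
    have "s \<ge> 1" "s * (-c) \<ge> \<bar>a\<bar> + 1" using c by (auto simp: s_def field_simps)
    then have "s * (s * (-c)) \<ge> 1 * (\<bar>a\<bar> + 1)" by (intro mult_mono) auto
    then have "a + s\<^sup>2 * c < 0" by (simp add: power2_eq_square)
    then show False using assms[of s] assms[of "-s"] by simp
  qed
  have "0 \<le> (a - 2 * (b / c) * b + (b / c)\<^sup>2 * c) * c"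
    using assms[of "b / c"] \<open>c > 0\<close> by simp
  also have "\<dots> = a * c - b\<^sup>2" using \<open>c > 0\<close> by (simp add: field_simps power2_eq_square)
  finally show ?thesis by simp
qed

lemma L2_Cauchy_Schwarz:
  assumes v: "v \<in> L2_space \<Omega>" and w: "w \<in> L2_space \<Omega>"
  shows "\<bar>L2_inner \<Omega> v w\<bar> \<le> L2_norm \<Omega> v * L2_norm \<Omega> w"
proof -
  have "(L2_inner \<Omega> v w)\<^sup>2 \<le> L2_inner \<Omega> v v * L2_inner \<Omega> w w"
  proof (rule discriminant_nonneg_quadratic)
    fix t :: real
    have tw: "(\<lambda>x. t *\<^sub>R w x) \<in> L2_space \<Omega>" using w by blast
    have "0 \<le> L2_inner \<Omega> (\<lambda>x. v x - t *\<^sub>R w x) (\<lambda>x. v x - t *\<^sub>R w x)"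
      by (rule L2_inner_self_nonneg)
    also have "\<dots> = L2_inner \<Omega> v v - 2 * t * L2_inner \<Omega> v w + t\<^sup>2 * L2_inner \<Omega> w w"
      unfolding L2_inner_diff_left[OF v tw L2_space_diff[OF v tw]] L2_inner_diff_right[OF v tw v]
        L2_inner_scaleR_left L2_inner_diff_right[OF v tw w] L2_inner_scaleR_right
      by (simp add: L2_inner_commute[of \<Omega> w v] power2_eq_square algebra_simps)
    finally show "0 \<le> L2_inner \<Omega> v v - 2 * t * L2_inner \<Omega> v w + t\<^sup>2 * L2_inner \<Omega> w w" .
  qed
  also have "\<dots> = (L2_norm \<Omega> v * L2_norm \<Omega> w)\<^sup>2" by (simp add: power_mult_distrib L2_norm_power2)
  finally show ?thesis by (simp add: abs_le_square_iff[symmetric] abs_mult)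
qed

text \<open>Functions stand for their classes modulo null sets; the class of zero consists of the functions
  of norm zero, and these are orthogonal to everything.\<close>

lemma L2_inner_null:
  assumes "v \<in> L2_space \<Omega>" "w \<in> L2_space \<Omega>" "L2_norm \<Omega> v = 0"
  shows "L2_inner \<Omega> v w = 0"
  using L2_Cauchy_Schwarz[OF assms(1,2)] assms(3) by simp

lemma L2_norm_triangle:
  assumes v: "v \<in> L2_space \<Omega>" and w: "w \<in> L2_space \<Omega>"
  shows "L2_norm \<Omega> (\<lambda>x. v x + w x) \<le> L2_norm \<Omega> v + L2_norm \<Omega> w"
proof -
  have "(L2_norm \<Omega> (\<lambda>x. v x + w x))\<^sup>2
      = (L2_norm \<Omega> v)\<^sup>2 + 2 * L2_inner \<Omega> v w + (L2_norm \<Omega> w)\<^sup>2"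
    unfolding L2_norm_power2 L2_inner_add_left[OF v w L2_space_add[OF v w]]
      L2_inner_add_right[OF v w v] L2_inner_add_right[OF v w w]
    by (simp add: L2_inner_commute[of \<Omega> w v])
  also have "\<dots> \<le> (L2_norm \<Omega> v + L2_norm \<Omega> w)\<^sup>2"
    using L2_Cauchy_Schwarz[OF v w] by (simp add: power2_sum)
  finally show ?thesis by (rule power2_le_imp_le) simp
qed

lemma L2_norm_scaleR: "L2_norm \<Omega> (\<lambda>x. c *\<^sub>R v x) = \<bar>c\<bar> * L2_norm \<Omega> v"
proof -
  have "L2_inner \<Omega> (\<lambda>x. c *\<^sub>R v x) (\<lambda>x. c *\<^sub>R v x) = c\<^sup>2 * L2_inner \<Omega> v v"
    by (simp add: L2_inner_def power2_eq_square)
  then show ?thesis by (simp add: L2_norm_def real_sqrt_mult)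
qed

lemma L2_norm_mult:
  fixes v :: "'a::euclidean_space \<Rightarrow> real"
  shows "L2_norm \<Omega> (\<lambda>x. c * v x) = \<bar>c\<bar> * L2_norm \<Omega> v"
  using L2_norm_scaleR[of \<Omega> c v] by simp

lemma L2_norm_minus_commute: "L2_norm \<Omega> (\<lambda>x. v x - w x) = L2_norm \<Omega> (\<lambda>x. w x - v x)"
  using L2_norm_scaleR[of \<Omega> "-1" "\<lambda>x. v x - w x"] by simp

lemma L2_norm_zero [simp]: "L2_norm \<Omega> (\<lambda>x. 0) = 0"
  by (simp add: L2_norm_def)

lemma L2_norm_AE_zero:
  assumes "AE x in lebesgue_on \<Omega>. v x = 0"
  shows "L2_norm \<Omega> v = 0"
proof -
  have "L2_inner \<Omega> v v = 0" unfolding L2_inner_def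
    by (rule integral_eq_zero_AE) (rule eventually_mono[OF assms], simp)
  then show ?thesis by (simp add: L2_norm_def)
qed

section \<open>Test functions and the Dirichlet form\<close>

lemma frechet_derivative_lincomb:
  fixes \<phi> \<psi> :: "'a::euclidean_space \<Rightarrow> real"
  assumes "\<phi> differentiable (at x)" "\<psi> differentiable (at x)"
  shows "frechet_derivative (\<lambda>x. a * \<phi> x + b * \<psi> x) (at x)
       = (\<lambda>h. a * frechet_derivative \<phi> (at x) h + b * frechet_derivative \<psi> (at x) h)"
proof -
  have "((\<lambda>x. a * \<phi> x + b * \<psi> x) has_derivative
      (\<lambda>h. a * frechet_derivative \<phi> (at x) h + b * frechet_derivative \<psi> (at x) h)) (at x)"
    using assms unfolding frechet_derivative_works
    by (intro has_derivative_add has_derivative_mult_right)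
  then show ?thesis by (rule frechet_derivative_at[symmetric])
qed

lemma C_k_lincomb:
  fixes \<phi> \<psi> :: "'a::euclidean_space \<Rightarrow> real"
  assumes "C_k k \<phi>" "C_k k \<psi>"
  shows "C_k k (\<lambda>x. a * \<phi> x + b * \<psi> x)"
  using assms
proof (induction k arbitrary: \<phi> \<psi>)
  case (Suc k)
  then have "\<phi> differentiable (at x)" "\<psi> differentiable (at x)" for x by auto
  with Suc show ?case
    by (auto simp: frechet_derivative_lincomb)
qed (auto intro!: continuous_intros)

lemma compact_closure_subset:
  fixes K :: "'a::euclidean_space set"
  assumes "compact K" "S \<subseteq> K"
  shows "compact (closure S)" "closure S \<subseteq> K"
proof -
  show "closure S \<subseteq> K" by (intro closure_minimal compact_imp_closed assms)
  with assms show "compact (closure S)"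
    by (metis closed_closure compact_Int_closed inf.absorb_iff2)
qed

lemma test_function_lincomb:
  assumes "test_function \<Omega> \<phi>" "test_function \<Omega> \<psi>"
  shows "test_function \<Omega> (\<lambda>x. a * \<phi> x + b * \<psi> x)"
proof -
  let ?K = "closure {x. \<phi> x \<noteq> 0} \<union> closure {x. \<psi> x \<noteq> 0}"
  have K: "compact ?K" "?K \<subseteq> \<Omega>" using assms by (auto simp: test_function_def)
  have "{x. a * \<phi> x + b * \<psi> x \<noteq> 0} \<subseteq> {x. \<phi> x \<noteq> 0} \<union> {x. \<psi> x \<noteq> 0}" by auto
  also have "\<dots> \<subseteq> ?K" by (intro Un_mono closure_subset)
  finally show ?thesis
    using compact_closure_subset[OF K(1)] K(2) assms
    unfolding test_function_def by (blast intro: C_k_lincomb)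
qed

lemma test_function_zero: "test_function \<Omega> (\<lambda>x. 0)"
proof -
  have "C_k k (\<lambda>x::'a. 0::real)" for k
    by (induction k) (auto simp: frechet_derivative_const)
  then show ?thesis by (simp add: test_function_def)
qed

lemma test_function_differentiable: "test_function \<Omega> \<phi> \<Longrightarrow> \<phi> differentiable (at x)"
  unfolding test_function_def by (metis C_k.simps(2))

lemma test_function_partial:
  fixes \<phi> :: "'a::euclidean_space \<Rightarrow> real"
  assumes \<phi>: "test_function \<Omega> \<phi>" and i: "i \<in> Basis"
  shows "test_function \<Omega> (\<lambda>x. frechet_derivative \<phi> (at x) i)"
proof -
  let ?K = "closure {x. \<phi> x \<noteq> 0}"
  have "frechet_derivative \<phi> (at x) i = 0" if "x \<notin> ?K" for x
  proof -
    have "(\<phi> has_derivative (\<lambda>_. 0)) (at x)"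
      by (rule has_derivative_transform_within_open[where s = "- ?K" and f = "\<lambda>_. 0"])
        (use that closure_subset[of "{x. \<phi> x \<noteq> 0}"] in auto)
    then show ?thesis using frechet_derivative_at[of \<phi> "\<lambda>_. 0" x] by metis
  qed
  then have "{x. frechet_derivative \<phi> (at x) i \<noteq> 0} \<subseteq> ?K" by blast
  moreover have "C_k k (\<lambda>x. frechet_derivative \<phi> (at x) i)" for k
    using \<phi> i unfolding test_function_def by (metis C_k.simps(2))
  ultimately show ?thesis
    using compact_closure_subset[of ?K] \<phi> unfolding test_function_def by blast
qed

lemma test_function_L2:
  assumes "open \<Omega>" and \<phi>: "test_function \<Omega> \<phi>"
  shows "\<phi> \<in> L2_space \<Omega>"
proof -
  have cont: "continuous_on UNIV \<phi>"
    using \<phi> unfolding test_function_def by (metis C_k.simps(1))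
  have meas: "\<phi> \<in> borel_measurable lborel"
    using borel_measurable_continuous_onI[OF cont] by simp
  let ?K = "closure {x. \<phi> x \<noteq> 0}"
  have K: "compact ?K" "?K \<subseteq> \<Omega>" using \<phi> by (auto simp: test_function_def)
  have "integrable lborel (\<lambda>x. indicator ?K x *\<^sub>R (\<phi> x)\<^sup>2)"
    by (intro borel_integrable_compact K continuous_intros continuous_on_subset[OF cont]) auto
  also have "(\<lambda>x. indicator ?K x *\<^sub>R (\<phi> x)\<^sup>2) = (\<lambda>x. indicator \<Omega> x *\<^sub>R (\<phi> x)\<^sup>2)"
  proof
    fix x
    have "x \<in> ?K" if "\<phi> x \<noteq> 0" using that closure_subset[of "{x. \<phi> x \<noteq> 0}"] by auto
    then show "indicator ?K x *\<^sub>R (\<phi> x)\<^sup>2 = indicator \<Omega> x *\<^sub>R (\<phi> x)\<^sup>2"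
      using K(2) by (cases "\<phi> x = 0") (auto simp: indicator_def)
  qed
  finally have "integrable lebesgue (\<lambda>x. indicator \<Omega> x *\<^sub>R (\<phi> x)\<^sup>2)"
    using meas \<open>open \<Omega>\<close> by (subst integrable_completion) (auto intro!: borel_measurable_scaleR)
  then have "integrable (lebesgue_on \<Omega>) (\<lambda>x. (\<phi> x)\<^sup>2)"
    using \<open>open \<Omega>\<close> by (subst integrable_restrict_space) auto
  moreover have "\<phi> \<in> borel_measurable (lebesgue_on \<Omega>)"
    using meas by (intro measurable_restrict_space1 measurable_completion)
  ultimately show ?thesis by (simp add: L2_space_def)
qed

lemma L2_space_scaleR_vector:
  fixes v :: "'a::euclidean_space \<Rightarrow> real"
  assumes "v \<in> L2_space \<Omega>"
  shows "(\<lambda>x. v x *\<^sub>R i) \<in> L2_space \<Omega>"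
  using assms by (auto simp: L2_space_def power_mult_distrib)

lemma classical_grad_L2:
  assumes "open \<Omega>" "test_function \<Omega> \<phi>"
  shows "classical_grad \<phi> \<in> L2_space \<Omega>"
  unfolding classical_grad_def[abs_def]
  using assms by (intro L2_space_sum L2_space_scaleR_vector test_function_L2 test_function_partial)

definition laplacian :: "('a::euclidean_space \<Rightarrow> real) \<Rightarrow> 'a \<Rightarrow> real" where
  "laplacian \<phi> x = (\<Sum>i\<in>Basis. frechet_derivative (\<lambda>y. frechet_derivative \<phi> (at y) i) (at x) i)"

lemma laplacian_L2:
  assumes "open \<Omega>" "test_function \<Omega> \<phi>"
  shows "laplacian \<phi> \<in> L2_space \<Omega>"
  unfolding laplacian_def[abs_def]
  using assms by (intro L2_space_sum test_function_L2 test_function_partial)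

text \<open>A partial derivative of a test function is a test function, so the definition of the weak gradient
  applies to it. The product with a gradient is thus controlled by the \<open>L2\<close> norm of \<open>v\<close> alone, which gives
  both the uniqueness of gradients and their weak convergence.\<close>

lemma weak_grad_inner_classical_grad:
  assumes \<Omega>: "open \<Omega>" and g: "has_weak_grad \<Omega> v g" and \<phi>: "test_function \<Omega> \<phi>"
  shows "L2_inner \<Omega> g (classical_grad \<phi>) = - L2_inner \<Omega> v (laplacian \<phi>)"
proof -
  have gL: "g \<in> L2_space \<Omega>" and vL: "v \<in> L2_space \<Omega>" using g by (auto simp: has_weak_grad_def)
  let ?d = "\<lambda>i x. frechet_derivative \<phi> (at x) i"
  have d: "test_function \<Omega> (?d i)" if "i \<in> Basis" for i using test_function_partial[OF \<phi> that] .
  have "L2_inner \<Omega> g (classical_grad \<phi>) = (\<Sum>i\<in>Basis. L2_inner \<Omega> (\<lambda>x. ?d i x *\<^sub>R i) g)"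
    unfolding classical_grad_def[abs_def] L2_inner_commute[of \<Omega> g]
    using \<Omega> d gL by (intro L2_inner_sum_left L2_space_scaleR_vector test_function_L2)
  also have "\<dots> = (\<Sum>i\<in>Basis. L2_inner \<Omega> (\<lambda>x. g x \<bullet> i) (?d i))"
    by (simp add: L2_inner_def inner_commute mult.commute)
  also have "\<dots> = (\<Sum>i\<in>Basis. - L2_inner \<Omega> v (\<lambda>x. frechet_derivative (?d i) (at x) i))"
    using g d by (intro sum.cong refl) (simp add: has_weak_grad_def)
  also have "\<dots> = - (\<Sum>i\<in>Basis. L2_inner \<Omega> (\<lambda>x. frechet_derivative (?d i) (at x) i) v)"
    by (simp add: sum_negf L2_inner_commute)
  also have "(\<Sum>i\<in>Basis. L2_inner \<Omega> (\<lambda>x. frechet_derivative (?d i) (at x) i) v) = L2_inner \<Omega> (laplacian \<phi>) v"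
    unfolding laplacian_def[abs_def]
    by (rule L2_inner_sum_left[symmetric]) (use \<Omega> d vL in \<open>auto intro: test_function_L2 test_function_partial\<close>)
  finally show ?thesis by (simp add: L2_inner_commute)
qed

lemma has_H01_grad_L2:
  assumes "has_H01_grad \<Omega> v g"
  shows "v \<in> L2_space \<Omega>" "g \<in> L2_space \<Omega>" "has_weak_grad \<Omega> v g"
  using assms by (auto simp: has_H01_grad_def has_weak_grad_def)

lemma L2_norm_lincomb_le:
  assumes "v \<in> L2_space \<Omega>" "w \<in> L2_space \<Omega>"
  shows "L2_norm \<Omega> (\<lambda>x. a *\<^sub>R v x + b *\<^sub>R w x) \<le> \<bar>a\<bar> * L2_norm \<Omega> v + \<bar>b\<bar> * L2_norm \<Omega> w"
  using L2_norm_triangle[OF L2_space_scaleR[OF assms(1), of a] L2_space_scaleR[OF assms(2), of b]]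
  by (simp add: L2_norm_scaleR)

lemma L2_norm_lincomb_tendsto_0:
  assumes "\<And>k. V k \<in> L2_space \<Omega>" "\<And>k. W k \<in> L2_space \<Omega>"
    and "(\<lambda>k. L2_norm \<Omega> (V k)) \<longlonglongrightarrow> 0" "(\<lambda>k. L2_norm \<Omega> (W k)) \<longlonglongrightarrow> 0"
  shows "(\<lambda>k. L2_norm \<Omega> (\<lambda>x. a *\<^sub>R V k x + b *\<^sub>R W k x)) \<longlonglongrightarrow> 0"
proof (rule tendsto_sandwich[OF _ _ tendsto_const])
  show "\<forall>\<^sub>F k in sequentially. L2_norm \<Omega> (\<lambda>x. a *\<^sub>R V k x + b *\<^sub>R W k x)
      \<le> \<bar>a\<bar> * L2_norm \<Omega> (V k) + \<bar>b\<bar> * L2_norm \<Omega> (W k)"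
    using assms by (simp add: L2_norm_lincomb_le)
  have "(\<lambda>k. \<bar>a\<bar> * L2_norm \<Omega> (V k) + \<bar>b\<bar> * L2_norm \<Omega> (W k)) \<longlonglongrightarrow> \<bar>a\<bar> * 0 + \<bar>b\<bar> * 0"
    using assms by (intro tendsto_intros)
  then show "(\<lambda>k. \<bar>a\<bar> * L2_norm \<Omega> (V k) + \<bar>b\<bar> * L2_norm \<Omega> (W k)) \<longlonglongrightarrow> 0" by simp
qed auto

lemma classical_grad_lincomb:
  assumes "\<phi> differentiable (at x)" "\<psi> differentiable (at x)"
  shows "classical_grad (\<lambda>x. a * \<phi> x + b * \<psi> x) x
       = a *\<^sub>R classical_grad \<phi> x + b *\<^sub>R classical_grad \<psi> x"
  by (simp add: classical_grad_def frechet_derivative_lincomb[OF assms] scaleR_left_distrib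
      sum.distrib scaleR_sum_right)

lemma has_weak_grad_lincomb:
  assumes \<Omega>: "open \<Omega>" and v: "has_weak_grad \<Omega> v g" and w: "has_weak_grad \<Omega> w h"
  shows "has_weak_grad \<Omega> (\<lambda>x. a * v x + b * w x) (\<lambda>x. a *\<^sub>R g x + b *\<^sub>R h x)"
proof -
  have L: "v \<in> L2_space \<Omega>" "g \<in> L2_space \<Omega>" "w \<in> L2_space \<Omega>" "h \<in> L2_space \<Omega>"
    using v w by (auto simp: has_weak_grad_def)
  have "L2_inner \<Omega> (\<lambda>x. a * v x + b * w x) (\<lambda>x. frechet_derivative \<phi> (at x) i)
      = - L2_inner \<Omega> (\<lambda>x. (a *\<^sub>R g x + b *\<^sub>R h x) \<bullet> i) \<phi>"
    if \<phi>: "test_function \<Omega> \<phi>" and i: "i \<in> Basis" for \<phi> i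
  proof -
    have d: "(\<lambda>x. frechet_derivative \<phi> (at x) i) \<in> L2_space \<Omega>"
      using test_function_L2[OF \<Omega> test_function_partial[OF \<phi> i]] .
    have p: "\<phi> \<in> L2_space \<Omega>" using test_function_L2[OF \<Omega> \<phi>] .
    have "L2_inner \<Omega> (\<lambda>x. a * v x + b * w x) (\<lambda>x. frechet_derivative \<phi> (at x) i)
      = a * L2_inner \<Omega> v (\<lambda>x. frechet_derivative \<phi> (at x) i) + b * L2_inner \<Omega> w (\<lambda>x. frechet_derivative \<phi> (at x) i)"
      using L2_inner_add_left[OF L2_space_mult[OF L(1), of a] L2_space_mult[OF L(3), of b] d]
      by (simp add: L2_inner_mult_left)
    moreover have "L2_inner \<Omega> (\<lambda>x. (a *\<^sub>R g x + b *\<^sub>R h x) \<bullet> i) \<phi>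
      = a * L2_inner \<Omega> (\<lambda>x. g x \<bullet> i) \<phi> + b * L2_inner \<Omega> (\<lambda>x. h x \<bullet> i) \<phi>"
      using L2_inner_add_left[OF L2_space_mult[OF L2_space_component[OF L(2)], of a i]
          L2_space_mult[OF L2_space_component[OF L(4)], of b i] p]
      by (simp add: L2_inner_mult_left inner_add_left)
    ultimately show ?thesis using v w \<phi> i by (simp add: has_weak_grad_def)
  qed
  moreover have "(\<lambda>x. a * v x + b * w x) \<in> L2_space \<Omega>" "(\<lambda>x. a *\<^sub>R g x + b *\<^sub>R h x) \<in> L2_space \<Omega>"
    using L by auto
  ultimately show ?thesis by (auto simp: has_weak_grad_def)
qed

lemma has_H01_grad_lincomb:
  assumes \<Omega>: "open \<Omega>" and v: "has_H01_grad \<Omega> v g" and w: "has_H01_grad \<Omega> w h"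
  shows "has_H01_grad \<Omega> (\<lambda>x. a * v x + b * w x) (\<lambda>x. a *\<^sub>R g x + b *\<^sub>R h x)"
proof -
  note Lv = has_H01_grad_L2[OF v] and Lw = has_H01_grad_L2[OF w]
  obtain \<phi> where \<phi>: "\<And>k. test_function \<Omega> (\<phi> k)"
    "(\<lambda>k. L2_norm \<Omega> (\<lambda>x. \<phi> k x - v x)) \<longlonglongrightarrow> 0"
    "(\<lambda>k. L2_norm \<Omega> (\<lambda>x. classical_grad (\<phi> k) x - g x)) \<longlonglongrightarrow> 0"
    using v by (auto simp: has_H01_grad_def)
  obtain \<psi> where \<psi>: "\<And>k. test_function \<Omega> (\<psi> k)"
    "(\<lambda>k. L2_norm \<Omega> (\<lambda>x. \<psi> k x - w x)) \<longlonglongrightarrow> 0"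
    "(\<lambda>k. L2_norm \<Omega> (\<lambda>x. classical_grad (\<psi> k) x - h x)) \<longlonglongrightarrow> 0"
    using w by (auto simp: has_H01_grad_def)
  have "(\<lambda>k. L2_norm \<Omega> (\<lambda>x. a *\<^sub>R (\<phi> k x - v x) + b *\<^sub>R (\<psi> k x - w x))) \<longlonglongrightarrow> 0"
    using \<phi> \<psi> Lv Lw \<Omega> by (intro L2_norm_lincomb_tendsto_0) (auto intro: test_function_L2)
  moreover have "(\<lambda>k. L2_norm \<Omega> (\<lambda>x. a *\<^sub>R (classical_grad (\<phi> k) x - g x)
      + b *\<^sub>R (classical_grad (\<psi> k) x - h x))) \<longlonglongrightarrow> 0"
    using \<phi> \<psi> Lv Lw \<Omega> by (intro L2_norm_lincomb_tendsto_0) (auto intro: classical_grad_L2)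
  moreover have "classical_grad (\<lambda>x. a * \<phi> k x + b * \<psi> k x) x
      = a *\<^sub>R classical_grad (\<phi> k) x + b *\<^sub>R classical_grad (\<psi> k) x" for k x
    by (intro classical_grad_lincomb test_function_differentiable[OF \<phi>(1)]
        test_function_differentiable[OF \<psi>(1)])
  ultimately have "(\<lambda>k. L2_norm \<Omega> (\<lambda>x. (a * \<phi> k x + b * \<psi> k x) - (a * v x + b * w x))) \<longlonglongrightarrow> 0"
    "(\<lambda>k. L2_norm \<Omega> (\<lambda>x. classical_grad (\<lambda>x. a * \<phi> k x + b * \<psi> k x) x - (a *\<^sub>R g x + b *\<^sub>R h x))) \<longlonglongrightarrow> 0"
    by (simp_all add: algebra_simps)
  moreover have "test_function \<Omega> (\<lambda>x. a * \<phi> k x + b * \<psi> k x)" for k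
    using \<phi>(1) \<psi>(1) by (rule test_function_lincomb)
  moreover have "has_weak_grad \<Omega> (\<lambda>x. a * v x + b * w x) (\<lambda>x. a *\<^sub>R g x + b *\<^sub>R h x)"
    using \<Omega> Lv(3) Lw(3) by (rule has_weak_grad_lincomb)
  ultimately show ?thesis
    unfolding has_H01_grad_def by (intro conjI exI[of _ "\<lambda>k x. a * \<phi> k x + b * \<psi> k x"]) auto
qed

lemma has_H01_grad_approx:
  assumes \<Omega>: "open \<Omega>" and v: "has_H01_grad \<Omega> v g" and "\<epsilon> > 0"
  obtains \<phi> where "test_function \<Omega> \<phi>" "L2_norm \<Omega> (\<lambda>x. g x - classical_grad \<phi> x) < \<epsilon>"
proof -
  obtain \<phi> where \<phi>: "\<And>k. test_function \<Omega> (\<phi> k)"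
    "(\<lambda>k. L2_norm \<Omega> (\<lambda>x. classical_grad (\<phi> k) x - g x)) \<longlonglongrightarrow> 0"
    using v by (auto simp: has_H01_grad_def)
  then obtain k where "L2_norm \<Omega> (\<lambda>x. classical_grad (\<phi> k) x - g x) < \<epsilon>"
    using order_tendstoD(2)[OF \<phi>(2) \<open>\<epsilon> > 0\<close>] by (auto simp: eventually_sequentially)
  then show thesis using that \<phi>(1) by (metis L2_norm_minus_commute)
qed

text \<open>A gradient of zero is orthogonal to all gradients of test functions, but is also their limit.\<close>

lemma has_H01_grad_null:
  assumes \<Omega>: "open \<Omega>" and v: "has_H01_grad \<Omega> v g" and null: "L2_norm \<Omega> v = 0"
  shows "L2_norm \<Omega> g = 0"
proof (rule ccontr)
  assume "L2_norm \<Omega> g \<noteq> 0"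
  then have pos: "L2_norm \<Omega> g > 0" using L2_norm_nonneg[of \<Omega> g] by linarith
  note L = has_H01_grad_L2[OF v]
  obtain \<phi> where \<phi>: "test_function \<Omega> \<phi>" "L2_norm \<Omega> (\<lambda>x. g x - classical_grad \<phi> x) < L2_norm \<Omega> g"
    using has_H01_grad_approx[OF \<Omega> v pos] by blast
  have c: "classical_grad \<phi> \<in> L2_space \<Omega>" using classical_grad_L2[OF \<Omega> \<phi>(1)] .
  have "L2_inner \<Omega> g (classical_grad \<phi>) = 0"
    using weak_grad_inner_classical_grad[OF \<Omega> L(3) \<phi>(1)]
      L2_inner_null[OF L(1) laplacian_L2[OF \<Omega> \<phi>(1)] null] by simp
  then have "(L2_norm \<Omega> g)\<^sup>2 = L2_inner \<Omega> g (\<lambda>x. g x - classical_grad \<phi> x)"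
    using L2_inner_diff_right[OF L(2) c L(2)] by (simp add: L2_norm_power2)
  also have "\<dots> \<le> L2_norm \<Omega> g * L2_norm \<Omega> (\<lambda>x. g x - classical_grad \<phi> x)"
    using L2_Cauchy_Schwarz[OF L(2) L2_space_diff[OF L(2) c]] by simp
  also have "\<dots> < L2_norm \<Omega> g * L2_norm \<Omega> g" using pos \<phi>(2) by simp
  finally show False by (simp add: power2_eq_square)
qed

abbreviation dirichlet ::
  "'a::euclidean_space set \<Rightarrow> ('a \<Rightarrow> real) \<Rightarrow> ('a \<Rightarrow> real) \<Rightarrow> real" where
  "dirichlet \<Omega> v w \<equiv> L2_inner \<Omega> (grad \<Omega> v) (grad \<Omega> w)"

lemma H01_has_grad: "v \<in> H01 \<Omega> \<Longrightarrow> has_H01_grad \<Omega> v (grad \<Omega> v)"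
  unfolding H01_def grad_def by (auto intro: someI[of "has_H01_grad \<Omega> v"])

lemma H01_L2: "v \<in> H01 \<Omega> \<Longrightarrow> v \<in> L2_space \<Omega>"
  and grad_L2: "v \<in> H01 \<Omega> \<Longrightarrow> grad \<Omega> v \<in> L2_space \<Omega>"
  using has_H01_grad_L2[OF H01_has_grad] by auto

text \<open>The representative chosen by \<open>grad\<close> does not matter for the Dirichlet form.\<close>

lemma dirichlet_eq:
  assumes \<Omega>: "open \<Omega>" and v: "has_H01_grad \<Omega> v g" and w: "w \<in> H01 \<Omega>"
  shows "dirichlet \<Omega> v w = L2_inner \<Omega> g (grad \<Omega> w)"
proof -
  have "has_H01_grad \<Omega> v (grad \<Omega> v)" using v by (intro H01_has_grad) (auto simp: H01_def)
  from has_H01_grad_lincomb[OF \<Omega> this v, of 1 "-1"]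
  have d: "has_H01_grad \<Omega> (\<lambda>x. 0) (\<lambda>x. grad \<Omega> v x - g x)" by simp
  have L: "grad \<Omega> v \<in> L2_space \<Omega>" "g \<in> L2_space \<Omega>" "grad \<Omega> w \<in> L2_space \<Omega>"
    using has_H01_grad_L2[OF v] has_H01_grad_L2[OF \<open>has_H01_grad \<Omega> v (grad \<Omega> v)\<close>] grad_L2[OF w] by auto
  have "L2_inner \<Omega> (\<lambda>x. grad \<Omega> v x - g x) (grad \<Omega> w) = 0"
    using has_H01_grad_null[OF \<Omega> d] L by (intro L2_inner_null) auto
  then show ?thesis using L by (simp add: L2_inner_diff_left)
qed

lemma H01_lincomb:
  assumes "open \<Omega>" "v \<in> H01 \<Omega>" "w \<in> H01 \<Omega>"
  shows "(\<lambda>x. a * v x + b * w x) \<in> H01 \<Omega>"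
  using has_H01_grad_lincomb[OF assms(1) H01_has_grad[OF assms(2)] H01_has_grad[OF assms(3)]]
  by (auto simp: H01_def)

lemma dirichlet_lincomb_left:
  assumes "open \<Omega>" "v \<in> H01 \<Omega>" "w \<in> H01 \<Omega>" "z \<in> H01 \<Omega>"
  shows "dirichlet \<Omega> (\<lambda>x. a * v x + b * w x) z = a * dirichlet \<Omega> v z + b * dirichlet \<Omega> w z"
  using dirichlet_eq[OF assms(1) has_H01_grad_lincomb[OF assms(1) H01_has_grad[OF assms(2)]
        H01_has_grad[OF assms(3)], of a b] assms(4)]
    L2_inner_add_left[OF L2_space_scaleR[OF grad_L2[OF assms(2)], of a]
      L2_space_scaleR[OF grad_L2[OF assms(3)], of b] grad_L2[OF assms(4)]]
  by (simp add: L2_inner_scaleR_left)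

lemma has_H01_grad_zero:
  assumes \<Omega>: "open \<Omega>" and v: "v \<in> L2_space \<Omega>" "L2_norm \<Omega> v = 0"
  shows "has_H01_grad \<Omega> v (\<lambda>x. 0)"
proof -
  have "L2_inner \<Omega> v (\<lambda>x. frechet_derivative \<phi> (at x) i) = 0"
    if "test_function \<Omega> \<phi>" "i \<in> Basis" for \<phi> i
    using v test_function_L2[OF \<Omega> test_function_partial[OF that]] by (intro L2_inner_null)
  moreover have "classical_grad (\<lambda>x::'a. 0) = (\<lambda>x. 0)"
    by (auto simp: classical_grad_def frechet_derivative_const)
  moreover have "L2_norm \<Omega> (\<lambda>x. - v x) = 0"
    using v(2) L2_norm_mult[of \<Omega> "-1" v] by simp
  ultimately show ?thesis
    using v(1) unfolding has_H01_grad_def has_weak_grad_def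
    by (intro conjI exI[of _ "\<lambda>_ _. 0"]) (auto simp: test_function_zero)
qed

text \<open>Membership in \<open>H01\<close> and the Dirichlet form are insensitive to changes on null sets. The initial value
  of the scheme agrees with that of the solution only almost everywhere.\<close>

lemma H01_null:
  assumes "open \<Omega>" "v \<in> L2_space \<Omega>" "L2_norm \<Omega> v = 0"
  shows "v \<in> H01 \<Omega>"
  using has_H01_grad_zero[OF assms] by (auto simp: H01_def)

lemma dirichlet_null:
  assumes "open \<Omega>" "v \<in> L2_space \<Omega>" "L2_norm \<Omega> v = 0" "w \<in> H01 \<Omega>"
  shows "dirichlet \<Omega> v w = 0"
  using dirichlet_eq[OF assms(1) has_H01_grad_zero[OF assms(1-3)] assms(4)] by simp

lemma H01_sum:
  assumes "open \<Omega>" "finite A" "\<And>k. k \<in> A \<Longrightarrow> v k \<in> H01 \<Omega>"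
  shows "(\<lambda>x. \<Sum>k\<in>A. a k * v k x) \<in> H01 \<Omega>"
  using assms(2,3)
proof (induction A)
  case empty
  show ?case using H01_null[OF assms(1), of "\<lambda>x. 0"] by simp
next
  case (insert k A)
  then show ?case
    using H01_lincomb[OF assms(1), of "v k" "\<lambda>x. \<Sum>k\<in>A. a k * v k x" "a k" 1] by simp
qed

lemma dirichlet_sum_left:
  assumes "open \<Omega>" "finite A" "\<And>k. k \<in> A \<Longrightarrow> v k \<in> H01 \<Omega>" "w \<in> H01 \<Omega>"
  shows "dirichlet \<Omega> (\<lambda>x. \<Sum>k\<in>A. a k * v k x) w = (\<Sum>k\<in>A. a k * dirichlet \<Omega> (v k) w)"
  using assms(2,3)
proof (induction A)
  case empty
  show ?case using dirichlet_null[OF assms(1), of "\<lambda>x. 0"] assms(4) by simp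
next
  case (insert k A)
  then show ?case
    using dirichlet_lincomb_left[OF assms(1), of "v k" "\<lambda>x. \<Sum>k\<in>A. a k * v k x" w "a k" 1]
      H01_sum[OF assms(1) insert(1)] assms(4) by simp
qed

section \<open>Stability of the scheme in L2\<close>

text \<open>The left-hand side of the scheme tested with \<open>\<phi>\<close>, for steps \<open>\<tau>\<close> and weights \<open>c\<close>. Keeping it a
  functional of \<open>\<phi>\<close> avoids the construction of a time derivative of the solution at time zero as an
  element of \<open>L2\<close>.\<close>

definition wsbdf2_residual ::
  "'a::euclidean_space set \<Rightarrow> real \<Rightarrow> (nat \<Rightarrow> real) \<Rightarrow> (nat \<Rightarrow> real) \<Rightarrow> (nat \<Rightarrow> 'a \<Rightarrow> real) \<Rightarrow>
     nat \<Rightarrow> ('a \<Rightarrow> real) \<Rightarrow> real" where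
  "wsbdf2_residual \<Omega> \<theta> \<tau> c e n \<phi> =
     (1 + c n) * ((L2_inner \<Omega> (e n) \<phi> - L2_inner \<Omega> (e (n - 1)) \<phi>) / \<tau> n)
     - c n * ((L2_inner \<Omega> (e (n - 1)) \<phi> - L2_inner \<Omega> (e (n - 2)) \<phi>) / \<tau> (n - 1))
     + (\<theta> * dirichlet \<Omega> (e n) \<phi> + (1 - \<theta>) * dirichlet \<Omega> (e (n - 1)) \<phi>)"

lemma wsbdf2_residual_sum:
  assumes "open \<Omega>" "finite A" "\<And>k. k \<in> A \<Longrightarrow> w k \<in> H01 \<Omega>" "\<And>k. k \<le> n \<Longrightarrow> e k \<in> H01 \<Omega>"
  shows "wsbdf2_residual \<Omega> \<theta> \<tau> c e n (\<lambda>x. \<Sum>k\<in>A. a k * w k x)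
       = (\<Sum>k\<in>A. a k * wsbdf2_residual \<Omega> \<theta> \<tau> c e n (w k))"
proof -
  have i: "L2_inner \<Omega> (e m) (\<lambda>x. \<Sum>k\<in>A. a k * w k x) = (\<Sum>k\<in>A. a k * L2_inner \<Omega> (e m) (w k))"
    if "m \<le> n" for m
    using L2_inner_sum_mult_left[of A w \<Omega> "e m" a] assms that
    by (simp add: H01_L2 L2_inner_commute[of \<Omega> "e m"])
  have d: "dirichlet \<Omega> (e m) (\<lambda>x. \<Sum>k\<in>A. a k * w k x) = (\<Sum>k\<in>A. a k * dirichlet \<Omega> (e m) (w k))"
    if "m \<le> n" for m
    using dirichlet_sum_left[of \<Omega> A w "e m" a] assms that
    by (simp add: L2_inner_commute[of \<Omega> "grad \<Omega> (e m)"])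
  show ?thesis
    unfolding wsbdf2_residual_def i[OF order_refl] i[OF diff_le_self] d[OF order_refl] d[OF diff_le_self]
    by (simp add: sum_distrib_left sum_subtractf sum_divide_distrib sum.distrib
        add_divide_distrib diff_divide_distrib algebra_simps)
qed

text \<open>Bessel's inequality for a functional that is linear and bounded on the span: it is tested with the
  combination whose coefficients are its own values.\<close>

lemma bounded_functional_Bessel:
  fixes w :: "'i \<Rightarrow> 'a::euclidean_space \<Rightarrow> real"
  assumes fin: "finite I"
    and w: "\<And>i. i \<in> I \<Longrightarrow> w i \<in> L2_space \<Omega>"
    and orth: "\<And>i j. i \<in> I \<Longrightarrow> j \<in> I \<Longrightarrow> L2_inner \<Omega> (w i) (w j) = of_bool (i = j)"
    and lin: "\<And>a. F (\<lambda>x. \<Sum>i\<in>I. a i * w i x) = (\<Sum>i\<in>I. a i * F (w i))"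
    and bound: "\<And>a. \<bar>F (\<lambda>x. \<Sum>i\<in>I. a i * w i x)\<bar> \<le> \<rho> * L2_norm \<Omega> (\<lambda>x. \<Sum>i\<in>I. a i * w i x)"
    and \<rho>: "\<rho> \<ge> 0"
  shows "L2_set (\<lambda>i. F (w i)) I \<le> \<rho>"
proof -
  let ?s = "L2_set (\<lambda>i. F (w i)) I" and ?\<phi> = "\<lambda>x. \<Sum>i\<in>I. F (w i) * w i x"
  have s2: "(\<Sum>i\<in>I. F (w i) * F (w i)) = ?s\<^sup>2"
    by (simp add: L2_set_def sum_nonneg power2_eq_square)
  have \<phi>: "?\<phi> \<in> L2_space \<Omega>" by (intro L2_space_sum L2_space_mult w)
  have "L2_inner \<Omega> ?\<phi> ?\<phi> = (\<Sum>i\<in>I. F (w i) * L2_inner \<Omega> (w i) ?\<phi>)"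
    using w \<phi> by (rule L2_inner_sum_mult_left)
  also have "\<dots> = (\<Sum>i\<in>I. F (w i) * F (w i))"
  proof (intro sum.cong refl arg_cong2[where f = "(*)"])
    fix i assume i: "i \<in> I"
    have "L2_inner \<Omega> (w i) ?\<phi> = (\<Sum>j\<in>I. F (w j) * L2_inner \<Omega> (w j) (w i))"
      unfolding L2_inner_commute[of \<Omega> "w i"] using w i by (intro L2_inner_sum_mult_left)
    also have "\<dots> = (\<Sum>j\<in>I. of_bool (i = j) * F (w j))"
      using i by (intro sum.cong refl) (auto simp: orth)
    finally show "L2_inner \<Omega> (w i) ?\<phi> = F (w i)" using fin i by (simp add: sum_of_bool_mult_left)
  qed
  finally have "(L2_norm \<Omega> ?\<phi>)\<^sup>2 = ?s\<^sup>2" by (simp add: L2_norm_power2 s2)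
  then have "L2_norm \<Omega> ?\<phi> = ?s" by (simp add: power2_eq_iff_nonneg)
  then have "?s\<^sup>2 \<le> \<rho> * ?s"
    using bound[of "\<lambda>i. F (w i)"] lin[of "\<lambda>i. F (w i)"] s2 by simp
  then show ?thesis using \<rho> L2_set_nonneg[of "\<lambda>i. F (w i)" I]
    by (cases "?s = 0") (auto simp: power2_eq_square)
qed

text \<open>Testing with the modes, which are combinations of \<open>e 1, \<dots>, e N\<close>, decouples the scheme into scalar
  ones. Parseval's identity is needed for \<open>e n\<close> only, and it holds because \<open>e n\<close> lies in the span.\<close>

theorem wsbdf2_L2_stability:
  fixes \<theta> :: real and \<tau> c :: "nat \<Rightarrow> real"
  assumes \<Omega>: "open \<Omega>" and \<theta>: "\<theta> \<ge> 0" "\<theta> \<le> 1"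
    and \<tau>: "\<And>n. n \<in> {1..N} \<Longrightarrow> \<tau> n > 0"
    and c: "\<And>n. n \<in> {1..N} \<Longrightarrow> 0 \<le> c n \<and> c n \<le> 2 * \<theta> - 1" and c1: "c 1 = 0"
    and e: "\<And>n. n \<in> {1..N} \<Longrightarrow> e n \<in> H01 \<Omega>"
    and e0: "e 0 \<in> L2_space \<Omega>" "L2_norm \<Omega> (e 0) = 0"
    and \<rho>: "\<rho>1 \<ge> 0" "\<rho> \<ge> 0"
    and res1: "\<And>\<phi>. \<phi> \<in> H01 \<Omega> \<Longrightarrow> \<bar>wsbdf2_residual \<Omega> \<theta> \<tau> c e 1 \<phi>\<bar> \<le> \<rho>1 * L2_norm \<Omega> \<phi>"
    and res: "\<And>n \<phi>. n \<in> {2..N} \<Longrightarrow> \<phi> \<in> H01 \<Omega> \<Longrightarrow>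
       \<bar>wsbdf2_residual \<Omega> \<theta> \<tau> c e n \<phi>\<bar> \<le> \<rho> * L2_norm \<Omega> \<phi>"
    and n: "n \<in> {1..N}"
  shows "L2_norm \<Omega> (e n) \<le> (\<Sum>k=1..n. \<tau> k * ((1/2) ^ (k - 1) * \<rho>1 + 2 * \<rho>))"
proof -
  let ?S = "{1..N}"
  let ?G = "\<lambda>k l. L2_inner \<Omega> (e k) (e l)" and ?K = "\<lambda>k l. dirichlet \<Omega> (e k) (e l)"
  have e0H: "e 0 \<in> H01 \<Omega>" using H01_null[OF \<Omega> e0] .
  have eH: "e k \<in> H01 \<Omega>" if "k \<le> N" for k
    using that e[of k] e0H by (cases "k = 0") auto
  have comb_inner: "L2_inner \<Omega> (e k) (\<lambda>x. \<Sum>l\<in>?S. a l * e l x) = (\<Sum>l\<in>?S. ?G k l * a l)"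
    if "k \<le> N" for k a
    using L2_inner_sum_mult_left[of ?S e \<Omega> "e k" a] e eH[OF that]
    by (simp add: H01_L2 L2_inner_commute[of \<Omega> "e k"] mult.commute)
  have comb_dirichlet: "dirichlet \<Omega> (e k) (\<lambda>x. \<Sum>l\<in>?S. a l * e l x) = (\<Sum>l\<in>?S. ?K k l * a l)"
    if "k \<le> N" for k a
    using dirichlet_sum_left[OF \<Omega>, of ?S e "e k" a] e eH[OF that]
    by (simp add: L2_inner_commute[of \<Omega> "grad \<Omega> (e k)"] mult.commute)
  have comb_L2: "(\<lambda>x. \<Sum>l\<in>?S. a l * e l x) \<in> L2_space \<Omega>" for a
    by (intro L2_space_sum L2_space_mult H01_L2 e)
  have form: "L2_inner \<Omega> (\<lambda>x. \<Sum>l\<in>?S. a l * e l x) (\<lambda>x. \<Sum>l\<in>?S. b l * e l x)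
      = (\<Sum>k\<in>?S. a k * (\<Sum>l\<in>?S. ?G k l * b l))" for a b
  proof (rule trans[OF L2_inner_sum_mult_left])
    show "e k \<in> L2_space \<Omega>" if "k \<in> ?S" for k using that by (intro H01_L2 e)
    show "(\<lambda>x. \<Sum>l\<in>?S. b l * e l x) \<in> L2_space \<Omega>" by (rule comb_L2)
  qed (intro sum.cong refl arg_cong2[where f = "(*)"] comb_inner, simp)
  have pos: "0 \<le> (\<Sum>k\<in>?S. x k * (\<Sum>l\<in>?S. ?G k l * x l))" for x
    unfolding form[symmetric] by (rule L2_inner_self_nonneg)
  have ker: "(\<Sum>l\<in>?S. ?K k l * x l) = 0"
    if "(\<Sum>k\<in>?S. x k * (\<Sum>l\<in>?S. ?G k l * x l)) = 0" "k \<in> ?S" for x k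
  proof -
    let ?v = "\<lambda>y. \<Sum>l\<in>?S. x l * e l y"
    have "L2_norm \<Omega> ?v = 0" using that(1) unfolding form[symmetric] by (simp add: L2_norm_def)
    from dirichlet_null[OF \<Omega> comb_L2 this e[OF that(2)]]
    have "dirichlet \<Omega> (e k) ?v = 0" by (subst L2_inner_commute)
    then show ?thesis using comb_dirichlet[of k x] that(2) by simp
  qed
  obtain I :: "nat set" and T lam where fin: "finite I"
    and orth: "\<And>i j. i \<in> I \<Longrightarrow> j \<in> I \<Longrightarrow> (\<Sum>k\<in>?S. T i k * (\<Sum>l\<in>?S. ?G k l * T j l)) = of_bool (i = j)"
    and eig: "\<And>i k. i \<in> I \<Longrightarrow> k \<in> ?S \<Longrightarrow> (\<Sum>l\<in>?S. ?K k l * T i l) = lam i * (\<Sum>l\<in>?S. ?G k l * T i l)"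
    and parseval: "\<And>k l. k \<in> ?S \<Longrightarrow> l \<in> ?S \<Longrightarrow>
       ?G k l = (\<Sum>i\<in>I. (\<Sum>m\<in>?S. ?G k m * T i m) * (\<Sum>m\<in>?S. ?G l m * T i m))"
    by (rule simultaneous_diagonalization[of ?S ?G ?K, OF _ _ _ pos ker])
      (rule finite_atLeastAtMost, rule L2_inner_commute, rule L2_inner_commute, assumption+, rule that)
  define w where "w i x = (\<Sum>l\<in>?S. T i l * e l x)" for i x
  have w_eq: "w i = (\<lambda>x. \<Sum>l\<in>?S. T i l * e l x)" for i by (simp add: w_def[abs_def])
  have inner_w: "L2_inner \<Omega> (e k) (w i) = (\<Sum>l\<in>?S. ?G k l * T i l)" if "k \<le> N" for i k
    unfolding w_eq by (rule comb_inner[OF that])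
  have wH: "w i \<in> H01 \<Omega>" for i
    unfolding w_eq using e by (intro H01_sum[OF \<Omega>]) auto
  have w_orth: "L2_inner \<Omega> (w i) (w j) = of_bool (i = j)" if "i \<in> I" "j \<in> I" for i j
    unfolding w_eq form using orth that by simp
  have w_eig: "dirichlet \<Omega> (e k) (w i) = lam i * L2_inner \<Omega> (e k) (w i)" if "i \<in> I" "k \<le> N" for i k
  proof (cases "k = 0")
    case True
    then show ?thesis
      using dirichlet_null[OF \<Omega> e0 wH] L2_inner_null[OF e0(1) H01_L2[OF wH] e0(2)] by simp
  next
    case False
    then show ?thesis
      unfolding w_eq comb_inner[OF that(2)] comb_dirichlet[OF that(2)]
      using that by (intro eig) auto
  qed
  have lam: "lam i \<ge> 0" if "i \<in> I" for i
  proof -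
    have "dirichlet \<Omega> (w i) (w i) = (\<Sum>k\<in>?S. T i k * dirichlet \<Omega> (e k) (w i))"
      unfolding w_eq[of i] using dirichlet_sum_left[OF \<Omega>, of ?S e "w i"] e wH[of i] by (simp add: w_eq)
    also have "\<dots> = lam i * (\<Sum>k\<in>?S. T i k * L2_inner \<Omega> (e k) (w i))"
      using that by (simp add: w_eig sum_distrib_left mult_ac)
    also have "(\<Sum>k\<in>?S. T i k * L2_inner \<Omega> (e k) (w i)) = 1"
      using orth[OF that that] by (simp add: inner_w)
    finally show ?thesis using L2_inner_self_nonneg[of \<Omega> "grad \<Omega> (w i)"] by simp
  qed
  let ?R = "\<lambda>k i. wsbdf2_residual \<Omega> \<theta> \<tau> c e k (w i)"
  let ?d = "\<lambda>k i. averaged_forcing c (\<lambda>k. ?R k i) k"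
  have mode: "\<bar>L2_inner \<Omega> (e n) (w i)\<bar> \<le> (\<Sum>k=1..n. \<tau> k * \<bar>?d k i\<bar>)" if i: "i \<in> I" for i
  proof (rule wsbdf2_mode_stability[where N = N and c = c and \<tau> = \<tau> and R = "\<lambda>k. ?R k i"
        and e = "\<lambda>n. L2_inner \<Omega> (e n) (w i)", OF \<theta> lam[OF i] \<tau> c c1])
    show "L2_inner \<Omega> (e 0) (w i) = 0"
      using L2_inner_null[OF e0(1) H01_L2[OF wH] e0(2)] .
    show "n \<le> N" using n by simp
    fix k assume "k \<in> {1..N}"
    then have "k \<le> N" "k - 1 \<le> N" by auto
    then show "(1 + c k) * ((L2_inner \<Omega> (e k) (w i) - L2_inner \<Omega> (e (k - 1)) (w i)) / \<tau> k)
        - c k * ((L2_inner \<Omega> (e (k - 1)) (w i) - L2_inner \<Omega> (e (k - 2)) (w i)) / \<tau> (k - 1))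
        + lam i * (\<theta> * L2_inner \<Omega> (e k) (w i) + (1 - \<theta>) * L2_inner \<Omega> (e (k - 1)) (w i)) = ?R k i"
      by (simp add: wsbdf2_residual_def w_eig[OF i] algebra_simps)
  qed auto
  have Bessel: "L2_set (?R k) I \<le> r"
    if "k \<le> N" "r \<ge> 0" "\<And>\<phi>. \<phi> \<in> H01 \<Omega> \<Longrightarrow> \<bar>wsbdf2_residual \<Omega> \<theta> \<tau> c e k \<phi>\<bar> \<le> r * L2_norm \<Omega> \<phi>" for k r
  proof (rule bounded_functional_Bessel[OF fin _ w_orth])
    show "wsbdf2_residual \<Omega> \<theta> \<tau> c e k (\<lambda>x. \<Sum>i\<in>I. a i * w i x) = (\<Sum>i\<in>I. a i * ?R k i)" for a
      using eH that(1) wH by (intro wsbdf2_residual_sum[OF \<Omega> fin]) auto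
    show "\<bar>wsbdf2_residual \<Omega> \<theta> \<tau> c e k (\<lambda>x. \<Sum>i\<in>I. a i * w i x)\<bar>
        \<le> r * L2_norm \<Omega> (\<lambda>x. \<Sum>i\<in>I. a i * w i x)" for a
      using wH by (intro that(3) H01_sum[OF \<Omega> fin])
  qed (use that H01_L2[OF wH] in auto)
  have "(L2_norm \<Omega> (e n))\<^sup>2 = (\<Sum>i\<in>I. (L2_inner \<Omega> (e n) (w i))\<^sup>2)"
  proof -
    have "n \<le> N" using n by simp
    then show ?thesis
      unfolding L2_norm_power2 inner_w[OF \<open>n \<le> N\<close>] power2_eq_square[of "sum _ _"] by (intro parseval n)
  qed
  then have "L2_norm \<Omega> (e n) = L2_set (\<lambda>i. L2_inner \<Omega> (e n) (w i)) I"
    by (simp add: L2_set_def real_sqrt_unique)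
  also have "\<dots> = L2_set (\<lambda>i. \<bar>L2_inner \<Omega> (e n) (w i)\<bar>) I" by (simp add: L2_set_def)
  also have "\<dots> \<le> L2_set (\<lambda>i. \<Sum>k=1..n. \<tau> k * \<bar>?d k i\<bar>) I"
    using mode by (intro L2_set_mono) auto
  also have "\<dots> \<le> (\<Sum>k=1..n. L2_set (\<lambda>i. \<tau> k * \<bar>?d k i\<bar>) I)" by (rule L2_set_sum_le)
  also have "\<dots> \<le> (\<Sum>k=1..n. \<tau> k * ((1/2) ^ (k - 1) * \<rho>1 + 2 * \<rho>))"
  proof (rule sum_mono)
    fix k assume "k \<in> {1..n}"
    then have k: "k \<in> {1..N}" using n by auto
    have "L2_set (\<lambda>i. \<tau> k * \<bar>?d k i\<bar>) I = \<tau> k * L2_set (\<lambda>i. \<bar>?d k i\<bar>) I"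
      using \<tau>[OF k] by (simp add: L2_set_right_distrib)
    also have "L2_set (\<lambda>i. \<bar>?d k i\<bar>) I = L2_set (?d k) I" by (simp add: L2_set_def)
    also have "\<dots> \<le> (1/2) ^ (k - 1) * \<rho>1 + 2 * \<rho>"
    proof (rule L2_set_averaged_forcing_le[where N = N and c = c and R = ?R, OF _ c1 _ _ \<rho>(2) k])
      show "0 \<le> c k \<and> c k \<le> 1" if "k \<in> {1..N}" for k
        using c[OF that] \<theta> by auto
      show "L2_set (?R 1) I \<le> \<rho>1" using n \<rho>(1) res1 by (intro Bessel) auto
      show "L2_set (?R k) I \<le> \<rho>" if "k \<in> {2..N}" for k
        using that \<rho>(2) res by (intro Bessel) auto
    qed
    finally show "L2_set (\<lambda>i. \<tau> k * \<bar>?d k i\<bar>) I \<le> \<tau> k * ((1/2) ^ (k - 1) * \<rho>1 + 2 * \<rho>)"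
      using \<tau>[OF k] by simp
  qed
  finally show ?thesis .
qed

section \<open>Time regularity and consistency\<close>

text \<open>Strong \<open>L2\<close> convergence with bounded gradients implies weak convergence of the gradients: against
  gradients of test functions the product is controlled by the \<open>L2\<close> distance, and these are dense
  among the gradients on \<open>H01\<close>.\<close>

lemma dirichlet_tendsto:
  assumes \<Omega>: "open \<Omega>" and v: "\<forall>\<^sub>F s in F. v s \<in> H01 \<Omega>" and v0: "v0 \<in> H01 \<Omega>"
    and conv: "((\<lambda>s. L2_norm \<Omega> (\<lambda>x. v s x - v0 x)) \<longlongrightarrow> 0) F"
    and B: "\<forall>\<^sub>F s in F. L2_norm \<Omega> (grad \<Omega> (v s)) \<le> B"
    and \<phi>: "\<phi> \<in> H01 \<Omega>"
  shows "((\<lambda>s. dirichlet \<Omega> (v s) \<phi>) \<longlongrightarrow> dirichlet \<Omega> v0 \<phi>) F"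
proof (rule tendstoI)
  fix \<epsilon> :: real assume \<epsilon>: "\<epsilon> > 0"
  define B' where "B' = max B 0 + L2_norm \<Omega> (grad \<Omega> v0) + 1"
  have B': "B' > 0" by (simp add: B'_def add_nonneg_pos)
  have g\<phi>: "grad \<Omega> \<phi> \<in> L2_space \<Omega>" using grad_L2[OF \<phi>] .
  obtain \<psi> where \<psi>: "test_function \<Omega> \<psi>"
    "L2_norm \<Omega> (\<lambda>x. grad \<Omega> \<phi> x - classical_grad \<psi> x) < \<epsilon> / (2 * B')"
    using has_H01_grad_approx[OF \<Omega> H01_has_grad[OF \<phi>], of "\<epsilon> / (2 * B')"] \<epsilon> B' by auto
  have c\<psi>: "classical_grad \<psi> \<in> L2_space \<Omega>" using classical_grad_L2[OF \<Omega> \<psi>(1)] .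
  define L where "L = L2_norm \<Omega> (laplacian \<psi>) + 1"
  have L: "L > 0" by (simp add: L_def add_nonneg_pos)
  have "\<forall>\<^sub>F s in F. L2_norm \<Omega> (\<lambda>x. v s x - v0 x) < \<epsilon> / (2 * L)"
    using order_tendstoD(2)[OF conv] \<epsilon> L by simp
  with v B show "\<forall>\<^sub>F s in F. dist (dirichlet \<Omega> (v s) \<phi>) (dirichlet \<Omega> v0 \<phi>) < \<epsilon>"
  proof eventually_elim
    case (elim s)
    let ?w = "\<lambda>x. v s x - v0 x" and ?h = "\<lambda>x. grad \<Omega> (v s) x - grad \<Omega> v0 x"
    have wh: "has_H01_grad \<Omega> ?w ?h"
      using has_H01_grad_lincomb[OF \<Omega> H01_has_grad[OF elim(1)] H01_has_grad[OF v0], of 1 "-1"] by simp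
    note wL = has_H01_grad_L2[OF wh]
    have "L2_norm \<Omega> ?h \<le> L2_norm \<Omega> (grad \<Omega> (v s)) + L2_norm \<Omega> (grad \<Omega> v0)"
      using L2_norm_lincomb_le[OF grad_L2[OF elim(1)] grad_L2[OF v0], of 1 "-1"] by simp
    then have hB: "L2_norm \<Omega> ?h \<le> B'" using elim(2) by (simp add: B'_def)
    have "dirichlet \<Omega> (v s) \<phi> - dirichlet \<Omega> v0 \<phi> = L2_inner \<Omega> ?h (grad \<Omega> \<phi>)"
      using L2_inner_diff_left[OF grad_L2[OF elim(1)] grad_L2[OF v0] g\<phi>] by simp
    also have "\<dots> = L2_inner \<Omega> ?h (classical_grad \<psi>)
        + L2_inner \<Omega> ?h (\<lambda>x. grad \<Omega> \<phi> x - classical_grad \<psi> x)"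
      using L2_inner_diff_right[OF g\<phi> c\<psi> wL(2)] by simp
    finally have split: "dirichlet \<Omega> (v s) \<phi> - dirichlet \<Omega> v0 \<phi> = \<dots>" .
    have "\<bar>dirichlet \<Omega> (v s) \<phi> - dirichlet \<Omega> v0 \<phi>\<bar> \<le> L2_norm \<Omega> ?w * L2_norm \<Omega> (laplacian \<psi>)
        + L2_norm \<Omega> ?h * L2_norm \<Omega> (\<lambda>x. grad \<Omega> \<phi> x - classical_grad \<psi> x)"
      using weak_grad_inner_classical_grad[OF \<Omega> wL(3) \<psi>(1)]
        L2_Cauchy_Schwarz[OF wL(1) laplacian_L2[OF \<Omega> \<psi>(1)]]
        L2_Cauchy_Schwarz[OF wL(2) L2_space_diff[OF g\<phi> c\<psi>]]
      unfolding split by linarith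
    also have "\<dots> \<le> L2_norm \<Omega> ?w * L + B' * L2_norm \<Omega> (\<lambda>x. grad \<Omega> \<phi> x - classical_grad \<psi> x)"
      by (intro add_mono mult_left_mono mult_right_mono hB L2_norm_nonneg) (simp add: L_def)
    also have "\<dots> < \<epsilon> / (2 * L) * L + B' * (\<epsilon> / (2 * B'))"
      using elim(3) \<psi>(2) L B' by (intro add_strict_mono mult_strict_right_mono mult_strict_left_mono)
    also have "\<dots> = \<epsilon>" using L B' by simp
    finally show ?case by (simp add: dist_real_def)
  qed
qed

lemma has_L2_derivative_inner:
  assumes v: "has_L2_derivative_on \<Omega> S v v'" and \<phi>: "\<phi> \<in> L2_space \<Omega>" and s: "s \<in> S"
  shows "((\<lambda>q. L2_inner \<Omega> (v q) \<phi>) has_real_derivative L2_inner \<Omega> (v' s) \<phi>) (at s within S)"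
proof -
  have L: "v q \<in> L2_space \<Omega>" "v' q \<in> L2_space \<Omega>" if "q \<in> S" for q
    using v that by (auto simp: has_L2_derivative_on_def)
  let ?r = "\<lambda>q x. (v q x - v s x) / (q - s) - v' s x"
  have "((\<lambda>q. L2_norm \<Omega> (?r q) * L2_norm \<Omega> \<phi>) \<longlongrightarrow> 0 * L2_norm \<Omega> \<phi>) (at s within S)"
    using v s by (intro tendsto_intros) (auto simp: has_L2_derivative_on_def)
  then have lim: "((\<lambda>q. L2_norm \<Omega> (?r q) * L2_norm \<Omega> \<phi>) \<longlongrightarrow> 0) (at s within S)" by simp
  have "((\<lambda>q. (L2_inner \<Omega> (v q) \<phi> - L2_inner \<Omega> (v s) \<phi>) / (q - s) - L2_inner \<Omega> (v' s) \<phi>) \<longlongrightarrow> 0)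
      (at s within S)"
  proof (rule Lim_null_comparison[OF _ lim])
    show "\<forall>\<^sub>F q in at s within S.
        norm ((L2_inner \<Omega> (v q) \<phi> - L2_inner \<Omega> (v s) \<phi>) / (q - s) - L2_inner \<Omega> (v' s) \<phi>)
        \<le> L2_norm \<Omega> (?r q) * L2_norm \<Omega> \<phi>"
      unfolding eventually_at_filter
    proof (intro always_eventually allI impI)
      fix q assume q: "q \<noteq> s" "q \<in> S"
      have d: "(\<lambda>x. inverse (q - s) * (v q x - v s x)) \<in> L2_space \<Omega>"
        by (intro L2_space_mult L2_space_diff L q s)
      have r: "?r q = (\<lambda>x. inverse (q - s) * (v q x - v s x) - v' s x)"
        by (auto simp: divide_inverse mult.commute)
      have "L2_inner \<Omega> (?r q) \<phi> = (L2_inner \<Omega> (v q) \<phi> - L2_inner \<Omega> (v s) \<phi>) / (q - s) - L2_inner \<Omega> (v' s) \<phi>"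
        unfolding r L2_inner_diff_left[OF d L(2)[OF s] \<phi>] L2_inner_mult_left
          L2_inner_diff_left[OF L(1)[OF q(2)] L(1)[OF s] \<phi>]
        by (simp add: divide_inverse mult.commute)
      moreover have "?r q \<in> L2_space \<Omega>" unfolding r using d L(2)[OF s] by (rule L2_space_diff)
      ultimately show "norm ((L2_inner \<Omega> (v q) \<phi> - L2_inner \<Omega> (v s) \<phi>) / (q - s) - L2_inner \<Omega> (v' s) \<phi>)
          \<le> L2_norm \<Omega> (?r q) * L2_norm \<Omega> \<phi>"
        using L2_Cauchy_Schwarz[OF _ \<phi>, of "?r q"] by simp
    qed
  qed
  then show ?thesis unfolding has_field_derivative_iff by (subst Lim_null)
qed

lemma tendsto_L2_inner:
  assumes conv: "((\<lambda>q. L2_norm \<Omega> (\<lambda>x. v q x - v0 x)) \<longlongrightarrow> 0) F"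
    and v: "\<forall>\<^sub>F q in F. v q \<in> L2_space \<Omega>" and L: "v0 \<in> L2_space \<Omega>" "\<phi> \<in> L2_space \<Omega>"
  shows "((\<lambda>q. L2_inner \<Omega> (v q) \<phi>) \<longlongrightarrow> L2_inner \<Omega> v0 \<phi>) F"
proof -
  have "((\<lambda>q. L2_norm \<Omega> (\<lambda>x. v q x - v0 x) * L2_norm \<Omega> \<phi>) \<longlongrightarrow> 0 * L2_norm \<Omega> \<phi>) F"
    by (intro tendsto_intros conv)
  then have lim: "((\<lambda>q. L2_norm \<Omega> (\<lambda>x. v q x - v0 x) * L2_norm \<Omega> \<phi>) \<longlongrightarrow> 0) F" by simp
  have "((\<lambda>q. L2_inner \<Omega> (v q) \<phi> - L2_inner \<Omega> v0 \<phi>) \<longlongrightarrow> 0) F"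
  proof (rule Lim_null_comparison[OF _ lim])
    show "\<forall>\<^sub>F q in F. norm (L2_inner \<Omega> (v q) \<phi> - L2_inner \<Omega> v0 \<phi>)
        \<le> L2_norm \<Omega> (\<lambda>x. v q x - v0 x) * L2_norm \<Omega> \<phi>"
      using v
    proof eventually_elim
      case (elim q)
      show ?case
        using L2_Cauchy_Schwarz[OF L2_space_diff[OF elim L(1)] L(2)] L2_inner_diff_left[OF elim L] by simp
    qed
  qed
  then show ?thesis by (subst Lim_null)
qed

lemma eventually_L2_norm_bounded:
  assumes conv: "((\<lambda>q. L2_norm \<Omega> (\<lambda>x. v q x - v0 x)) \<longlongrightarrow> 0) F"
    and v: "\<forall>\<^sub>F q in F. v q \<in> L2_space \<Omega>" and v0: "v0 \<in> L2_space \<Omega>"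
  shows "\<forall>\<^sub>F q in F. L2_norm \<Omega> (v q) \<le> L2_norm \<Omega> v0 + 1"
  using v order_tendstoD(2)[OF conv zero_less_one]
proof eventually_elim
  case (elim q)
  show ?case using L2_norm_triangle[OF L2_space_diff[OF elim(1) v0] v0] elim(2) by simp
qed

lemma has_L2_derivative_imp_continuous:
  assumes v: "has_L2_derivative_on \<Omega> S v v'" and s: "s \<in> S"
  shows "((\<lambda>q. L2_norm \<Omega> (\<lambda>x. v q x - v s x)) \<longlongrightarrow> 0) (at s within S)"
proof -
  have L: "v q \<in> L2_space \<Omega>" "v' q \<in> L2_space \<Omega>" if "q \<in> S" for q
    using v that by (auto simp: has_L2_derivative_on_def)
  let ?r = "\<lambda>q x. (v q x - v s x) / (q - s) - v' s x"
  have "((\<lambda>q. \<bar>q - s\<bar> * (L2_norm \<Omega> (?r q) + L2_norm \<Omega> (v' s))) \<longlongrightarrow> \<bar>s - s\<bar> * (0 + L2_norm \<Omega> (v' s)))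
      (at s within S)"
    using v s by (intro tendsto_intros) (auto simp: has_L2_derivative_on_def)
  then have lim: "((\<lambda>q. \<bar>q - s\<bar> * (L2_norm \<Omega> (?r q) + L2_norm \<Omega> (v' s))) \<longlongrightarrow> 0) (at s within S)" by simp
  show ?thesis
  proof (rule Lim_null_comparison[OF _ lim])
    show "\<forall>\<^sub>F q in at s within S. norm (L2_norm \<Omega> (\<lambda>x. v q x - v s x))
        \<le> \<bar>q - s\<bar> * (L2_norm \<Omega> (?r q) + L2_norm \<Omega> (v' s))"
      unfolding eventually_at_filter
    proof (intro always_eventually allI impI)
      fix q assume q: "q \<noteq> s" "q \<in> S"
      have "(\<lambda>x. inverse (q - s) * (v q x - v s x) - v' s x) \<in> L2_space \<Omega>"
        by (intro L2_space_mult L2_space_diff L q s)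
      then have r: "?r q \<in> L2_space \<Omega>" by (simp add: divide_inverse mult.commute)
      have "(\<lambda>x. v q x - v s x) = (\<lambda>x. (q - s) * (?r q x + v' s x))" using q by auto
      then have "L2_norm \<Omega> (\<lambda>x. v q x - v s x) = \<bar>q - s\<bar> * L2_norm \<Omega> (\<lambda>x. ?r q x + v' s x)"
        by (simp only: L2_norm_mult)
      also have "\<dots> \<le> \<bar>q - s\<bar> * (L2_norm \<Omega> (?r q) + L2_norm \<Omega> (v' s))"
        by (intro mult_left_mono L2_norm_triangle r L s) simp
      finally show "norm (L2_norm \<Omega> (\<lambda>x. v q x - v s x)) \<le> \<bar>q - s\<bar> * (L2_norm \<Omega> (?r q) + L2_norm \<Omega> (v' s))"
        by simp
    qed
  qed
qed

lemma real_derivative_bound: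
  fixes g g' :: "real \<Rightarrow> real"
  assumes ab: "a \<le> b" and cont: "continuous_on {a..b} g"
    and g: "\<And>s. a < s \<Longrightarrow> s < b \<Longrightarrow> (g has_real_derivative g' s) (at s)"
    and K: "\<And>s. a < s \<Longrightarrow> s < b \<Longrightarrow> \<bar>g' s\<bar> \<le> K"
  shows "\<bar>g b - g a\<bar> \<le> K * (b - a)"
proof (cases "a = b")
  case False
  then have "a < b" using ab by simp
  then obtain z where z: "a < z" "z < b" "g b - g a = (b - a) * g' z"
    using mvt[OF \<open>a < b\<close> cont, of "\<lambda>s. (*) (g' s)"] g
    by (auto simp: has_field_derivative_def mult.commute)
  then show ?thesis
    using K[OF z(1,2)] \<open>a < b\<close> by (simp add: abs_mult mult.commute mult_left_mono)
qed simp

lemma derivative_within_at: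
  assumes "(g has_real_derivative d) (at s within {0<..T})" "0 < s" "s < T"
  shows "(g has_real_derivative d) (at s)"
proof -
  have "(g has_real_derivative d) (at s within {0<..<T})"
    using assms(1) by (rule DERIV_subset) auto
  then show ?thesis using assms(2,3) by (subst (asm) at_within_open) auto
qed

text \<open>The derivatives in time are taken within the half-open interval, so the mean value theorem is used
  between two of its points.\<close>

lemma derivative_bound_half_open:
  fixes g g' :: "real \<Rightarrow> real"
  assumes g: "\<And>s. s \<in> {0<..T} \<Longrightarrow> (g has_real_derivative g' s) (at s within {0<..T})"
    and ab: "0 < a" "a \<le> b" "b \<le> T"
    and K: "\<And>s. a < s \<Longrightarrow> s < b \<Longrightarrow> \<bar>g' s\<bar> \<le> K"
  shows "\<bar>g b - g a\<bar> \<le> K * (b - a)"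
proof (rule real_derivative_bound[OF ab(2) _ _ K])
  have "continuous_on {0<..T} g" using g by (rule DERIV_continuous_on)
  then show "continuous_on {a..b} g" by (rule continuous_on_subset) (use ab in auto)
  show "(g has_real_derivative g' s) (at s)" if "a < s" "s < b" for s
    by (rule derivative_within_at[OF g]) (use that ab in auto)
qed

lemma L2_Lipschitz:
  assumes v: "has_L2_derivative_on \<Omega> {0<..T} v v'"
    and K: "\<And>s. s \<in> {0<..b} \<Longrightarrow> L2_norm \<Omega> (v' s) \<le> K"
    and pq: "0 < p" "p \<le> q" "q \<le> b" "b \<le> T" and \<phi>: "\<phi> \<in> L2_space \<Omega>"
  shows "\<bar>L2_inner \<Omega> (v q) \<phi> - L2_inner \<Omega> (v p) \<phi>\<bar> \<le> K * L2_norm \<Omega> \<phi> * (q - p)"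
proof (rule derivative_bound_half_open[where T = T])
  show "((\<lambda>s. L2_inner \<Omega> (v s) \<phi>) has_real_derivative L2_inner \<Omega> (v' s) \<phi>) (at s within {0<..T})"
    if "s \<in> {0<..T}" for s
    using has_L2_derivative_inner[OF v \<phi> that] .
  fix s assume s: "p < s" "s < q"
  have "v' s \<in> L2_space \<Omega>" using v s pq by (auto simp: has_L2_derivative_on_def)
  then have "\<bar>L2_inner \<Omega> (v' s) \<phi>\<bar> \<le> L2_norm \<Omega> (v' s) * L2_norm \<Omega> \<phi>"
    using \<phi> by (rule L2_Cauchy_Schwarz)
  also have "\<dots> \<le> K * L2_norm \<Omega> \<phi>" using s pq by (intro mult_right_mono K) auto
  finally show "\<bar>L2_inner \<Omega> (v' s) \<phi>\<bar> \<le> K * L2_norm \<Omega> \<phi>" .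
qed (use pq in auto)

text \<open>The difference formula is the derivative at \<open>q + \<theta> (r - q)\<close> of the parabola through the values at
  \<open>p\<close>, \<open>q\<close> and \<open>r\<close>, hence exact for quadratic polynomials. After subtraction of the Taylor polynomial at \<open>r\<close>
  the remainder \<open>g\<close> has vanishing derivatives up to order two at \<open>r\<close>, and each term is bounded separately.
  Expanding at \<open>r\<close> rather than at \<open>p\<close> allows \<open>p = 0\<close>, where \<open>h\<close> is only continuous.\<close>

lemma wsbdf2_consistency:
  fixes h h1 h2 h3 :: "real \<Rightarrow> real"
  assumes pqr: "0 \<le> p" "p < q" "q < r" "r \<le> T"
    and cont: "continuous_on {0..T} h"
    and h: "\<And>s. s \<in> {0<..T} \<Longrightarrow> (h has_real_derivative h1 s) (at s within {0<..T})"
    and h1: "\<And>s. s \<in> {0<..T} \<Longrightarrow> (h1 has_real_derivative h2 s) (at s within {0<..T})"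
    and h2: "\<And>s. s \<in> {0<..T} \<Longrightarrow> (h2 has_real_derivative h3 s) (at s within {0<..T})"
    and K: "\<And>s. s \<in> {0<..T} \<Longrightarrow> \<bar>h3 s\<bar> \<le> K"
    and m: "r - q \<le> m" "q - p \<le> m" and \<theta>: "1/2 \<le> \<theta>" "\<theta> \<le> 1"
    and c: "c = (2 * \<theta> - 1) * (r - q) / ((r - q) + (q - p))"
  shows "\<bar>(1 + c) * ((h r - h q) / (r - q)) - c * ((h q - h p) / (q - p))
      - (\<theta> * h1 r + (1 - \<theta>) * h1 q)\<bar> \<le> 7 * K * m\<^sup>2"
proof -
  define g where "g s = h s - h r - h1 r * (s - r) - h2 r / 2 * (s - r)\<^sup>2" for s
  define g1 where "g1 s = h1 s - h1 r - h2 r * (s - r)" for s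
  have "r \<in> {0<..T}" using pqr by simp
  then have K0: "K \<ge> 0" using K order_trans[OF abs_ge_zero] by metis
  have g_der: "(g has_real_derivative g1 s) (at s within {0<..T})" if "s \<in> {0<..T}" for s
    unfolding g_def[abs_def] g1_def
    by (auto intro!: derivative_eq_intros h that)
  have g1_der: "(g1 has_real_derivative (h2 s - h2 r)) (at s within {0<..T})" if "s \<in> {0<..T}" for s
    unfolding g1_def[abs_def]
    by (auto intro!: derivative_eq_intros h1 that)
  have g2_le: "\<bar>h2 s - h2 r\<bar> \<le> K * (r - s)" if "0 < s" "s \<le> r" for s
  proof -
    have "\<bar>h2 r - h2 s\<bar> \<le> K * (r - s)"
      by (rule derivative_bound_half_open[OF h2]) (use that pqr in \<open>auto intro: K\<close>)
    then show ?thesis by (simp add: abs_minus_commute)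
  qed
  have g1_le: "\<bar>g1 s\<bar> \<le> K * (r - s)\<^sup>2" if s: "0 < s" "s \<le> r" for s
  proof -
    have "\<bar>g1 r - g1 s\<bar> \<le> K * (r - s) * (r - s)"
    proof (rule derivative_bound_half_open[OF g1_der])
      fix x assume x: "s < x" "x < r"
      have "\<bar>h2 x - h2 r\<bar> \<le> K * (r - x)" using x s by (intro g2_le) auto
      also have "\<dots> \<le> K * (r - s)" using x K0 by (intro mult_left_mono) auto
      finally show "\<bar>h2 x - h2 r\<bar> \<le> K * (r - s)" .
    qed (use s pqr in auto)
    then show ?thesis by (simp add: g1_def power2_eq_square mult.assoc)
  qed
  have quot: "\<bar>(g b - g a) / (b - a)\<bar> \<le> K * (r - a)\<^sup>2" if ab: "0 \<le> a" "a < b" "b \<le> r" for a b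
  proof -
    have "\<bar>g b - g a\<bar> \<le> K * (r - a)\<^sup>2 * (b - a)"
    proof (rule real_derivative_bound)
      show "continuous_on {a..b} g"
        unfolding g_def[abs_def] using ab pqr
        by (intro continuous_intros continuous_on_subset[OF cont]) auto
      fix s assume s: "a < s" "s < b"
      show "(g has_real_derivative g1 s) (at s)"
        by (rule derivative_within_at[OF g_der]) (use s ab pqr in auto)
      have "\<bar>g1 s\<bar> \<le> K * (r - s)\<^sup>2" using s ab by (intro g1_le) auto
      also have "\<dots> \<le> K * (r - a)\<^sup>2" using s ab K0 by (intro mult_left_mono power_mono) auto
      finally show "\<bar>g1 s\<bar> \<le> K * (r - a)\<^sup>2" .
    qed (use ab in simp)
    then show ?thesis using ab by (simp add: pos_divide_le_eq)
  qed
  have c01: "0 \<le> c" "c \<le> 1"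
  proof -
    show "0 \<le> c" unfolding c using pqr \<theta> by auto
    have "(2 * \<theta> - 1) * (r - q) \<le> 1 * ((r - q) + (q - p))"
      using pqr \<theta> by (intro mult_mono) auto
    then show "c \<le> 1" unfolding c using pqr by (simp add: divide_le_eq)
  qed
  have m0: "0 \<le> m" using m pqr by linarith
  have error: "(1 + c) * ((h r - h q) / (r - q)) - c * ((h q - h p) / (q - p)) - (\<theta> * h1 r + (1 - \<theta>) * h1 q)
      = (1 + c) * ((g r - g q) / (r - q)) - c * ((g q - g p) / (q - p)) - (1 - \<theta>) * g1 q"
  proof -
    have e1: "(h r - h q) / (r - q) = (g r - g q) / (r - q) + h1 r - h2 r / 2 * (r - q)"
      using pqr by (simp add: g_def field_simps power2_eq_square)
    have e2: "(h q - h p) / (q - p) = (g q - g p) / (q - p) + h1 r - h2 r / 2 * (2 * (r - q) + (q - p))"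
      using pqr by (simp add: g_def field_simps power2_eq_square)
    have e3: "h1 q = g1 q + h1 r - h2 r * (r - q)" by (simp add: g1_def algebra_simps)
    \<comment> \<open>This choice of \<open>c\<close> is what cancels the contribution of the second derivative.\<close>
    have cs: "c * (r - p) = (2 * \<theta> - 1) * (r - q)" using pqr by (simp add: c)
    have "(1 + c) * ((h r - h q) / (r - q)) - c * ((h q - h p) / (q - p)) - (\<theta> * h1 r + (1 - \<theta>) * h1 q)
      = (1 + c) * ((g r - g q) / (r - q)) - c * ((g q - g p) / (q - p)) - (1 - \<theta>) * g1 q
        + h2 r / 2 * (c * (r - p) - (2 * \<theta> - 1) * (r - q))"
      unfolding e1 e2 e3 by (simp add: field_simps)
    then show ?thesis by (simp add: cs)
  qed
  have "\<bar>(1 + c) * ((h r - h q) / (r - q)) - c * ((h q - h p) / (q - p)) - (\<theta> * h1 r + (1 - \<theta>) * h1 q)\<bar>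
      \<le> (1 + c) * \<bar>(g r - g q) / (r - q)\<bar> + c * \<bar>(g q - g p) / (q - p)\<bar> + (1 - \<theta>) * \<bar>g1 q\<bar>"
  proof -
    have "\<bar>(1 + c) * x\<bar> = (1 + c) * \<bar>x\<bar>" "\<bar>c * x\<bar> = c * \<bar>x\<bar>" "\<bar>(1 - \<theta>) * x\<bar> = (1 - \<theta>) * \<bar>x\<bar>" for x :: real
      using c01 \<theta> by (simp_all add: abs_mult)
    then show ?thesis
      using abs_triangle_ineq4[of "(1 + c) * ((g r - g q) / (r - q)) - c * ((g q - g p) / (q - p))" "(1 - \<theta>) * g1 q"]
        abs_triangle_ineq4[of "(1 + c) * ((g r - g q) / (r - q))" "c * ((g q - g p) / (q - p))"]
      unfolding error by simp
  qed
  also have "\<dots> \<le> 2 * (K * m\<^sup>2) + 1 * (K * (2 * m)\<^sup>2) + 1 * (K * m\<^sup>2)"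
  proof (intro add_mono mult_mono)
    have mono: "K * (r - q)\<^sup>2 \<le> K * m\<^sup>2" "K * (r - p)\<^sup>2 \<le> K * (2 * m)\<^sup>2"
      using m pqr by (intro mult_left_mono[OF power_mono K0]; simp)+
    show "\<bar>(g r - g q) / (r - q)\<bar> \<le> K * m\<^sup>2" using quot[of q r] pqr mono(1) by simp
    show "\<bar>(g q - g p) / (q - p)\<bar> \<le> K * (2 * m)\<^sup>2" using quot[of p q] pqr mono(2) by simp
    show "\<bar>g1 q\<bar> \<le> K * m\<^sup>2" using g1_le[of q] pqr mono(1) by simp
  qed (use c01 \<theta> K0 in auto)
  also have "\<dots> = 7 * K * m\<^sup>2" by (simp add: power2_eq_square)
  finally show ?thesis .
qed

text \<open>The weight \<open>c\<close> of the previous difference quotient.\<close>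

definition history_weight :: "real \<Rightarrow> (nat \<Rightarrow> real) \<Rightarrow> nat \<Rightarrow> real" where
  "history_weight \<theta> t n =
     (if n \<le> 1 then 0 else (2 * \<theta> - 1) * step t n / (step t n + step t (n - 1)))"

lemma wsbdf2_kernel_eq:
  assumes n: "n \<ge> 2" and \<tau>: "step t n > 0" "step t (n - 1) > 0"
  shows "wsbdf2_kernel \<theta> t n 0 = (1 + history_weight \<theta> t n) / step t n"
    and "wsbdf2_kernel \<theta> t n 1 = - history_weight \<theta> t n / step t (n - 1)"
proof -
  define a b where "a = step t n" and "b = step t (n - 1)"
  have ab: "a > 0" "b > 0" using \<tau> by (auto simp: a_def b_def)
  have "a + b > 0" using ab by simp
  have r: "1 + a / b = (a + b) / b" using ab by (simp add: field_simps)
  have "(1 + 2 * \<theta> * (a / b)) / (a * (1 + a / b)) = (1 + (2 * \<theta> - 1) * a / (a + b)) / a"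
    unfolding r using ab \<open>a + b > 0\<close> by (simp add: divide_simps) (simp add: algebra_simps)
  then show "wsbdf2_kernel \<theta> t n 0 = (1 + history_weight \<theta> t n) / step t n"
    using n by (simp add: wsbdf2_kernel_def history_weight_def step_ratio_def a_def b_def)
  have "(1 - 2 * \<theta>) * (a / b)\<^sup>2 / (a * (1 + a / b)) = - ((2 * \<theta> - 1) * a / (a + b)) / b"
    unfolding r using ab \<open>a + b > 0\<close> by (simp add: divide_simps power2_eq_square) (simp add: algebra_simps)
  then show "wsbdf2_kernel \<theta> t n 1 = - history_weight \<theta> t n / step t (n - 1)"
    using n by (simp add: wsbdf2_kernel_def history_weight_def step_ratio_def a_def b_def)
qed

lemma wsbdf2_op_inner:
  assumes n: "n \<ge> 1" and \<tau>: "\<And>k. k \<in> {1..n} \<Longrightarrow> step t k > 0"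
    and V: "\<And>k. k \<le> n \<Longrightarrow> V k \<in> L2_space \<Omega>" and \<phi>: "\<phi> \<in> L2_space \<Omega>"
  shows "L2_inner \<Omega> (wsbdf2_op \<theta> t V n) \<phi>
    = (1 + history_weight \<theta> t n) * ((L2_inner \<Omega> (V n) \<phi> - L2_inner \<Omega> (V (n - 1)) \<phi>) / step t n)
      - history_weight \<theta> t n
        * ((L2_inner \<Omega> (V (n - 1)) \<phi> - L2_inner \<Omega> (V (n - 2)) \<phi>) / step t (n - 1))"
proof -
  let ?D = "\<lambda>k. L2_inner \<Omega> (V k) \<phi> - L2_inner \<Omega> (V (k - 1)) \<phi>"
  have "L2_inner \<Omega> (wsbdf2_op \<theta> t V n) \<phi>
      = (\<Sum>k=1..n. wsbdf2_kernel \<theta> t n (n - k) * L2_inner \<Omega> (\<lambda>x. V k x - V (k - 1) x) \<phi>)"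
    unfolding wsbdf2_op_def[abs_def]
    by (rule L2_inner_sum_mult_left[OF _ \<phi>]) (auto intro!: L2_space_diff V)
  also have "\<dots> = (\<Sum>k=1..n. wsbdf2_kernel \<theta> t n (n - k) * ?D k)"
  proof (intro sum.cong refl arg_cong2[where f = "(*)"])
    fix k assume "k \<in> {1..n}"
    then have "k \<le> n" "k - 1 \<le> n" by auto
    then show "L2_inner \<Omega> (\<lambda>x. V k x - V (k - 1) x) \<phi> = ?D k"
      by (intro L2_inner_diff_left V \<phi>)
  qed
  also have "\<dots> = (1 + history_weight \<theta> t n) * (?D n / step t n)
      - history_weight \<theta> t n * (?D (n - 1) / step t (n - 1))"
  proof (cases "n = 1")
    case True
    then show ?thesis by (simp add: wsbdf2_kernel_def history_weight_def)
  next
    case False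
    then have n2: "n \<ge> 2" using n by simp
    have "(\<Sum>k=1..n. wsbdf2_kernel \<theta> t n (n - k) * ?D k)
        = (\<Sum>k\<in>{n - 1, n}. wsbdf2_kernel \<theta> t n (n - k) * ?D k)"
      using n2 by (intro sum.mono_neutral_right) (auto simp: wsbdf2_kernel_def)
    also have "\<dots> = wsbdf2_kernel \<theta> t n 1 * ?D (n - 1) + wsbdf2_kernel \<theta> t n 0 * ?D n"
      using n2 by (simp add: Suc_diff_Suc numeral_2_eq_2)
    also have "\<dots> = (1 + history_weight \<theta> t n) * (?D n / step t n)
      - history_weight \<theta> t n * (?D (n - 1) / step t (n - 1))"
    proof -
      have "step t n > 0" "step t (n - 1) > 0" using n2 \<tau> by auto
      then show ?thesis using wsbdf2_kernel_eq[OF n2] by simp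
    qed
    finally show ?thesis .
  qed
  finally show ?thesis by (simp add: numeral_2_eq_2)
qed

lemma has_L2_derivative_on_L2:
  assumes "has_L2_derivative_on \<Omega> S v v'" "s \<in> S"
  shows "v s \<in> L2_space \<Omega>" "v' s \<in> L2_space \<Omega>"
  using assms by (auto simp: has_L2_derivative_on_def)

text \<open>The equation tested with \<open>u s\<close> bounds the gradients near \<open>s0\<close>, so every term but the time derivative
  converges to its value at \<open>s0\<close>; the time derivative must then converge weakly as well.\<close>

lemma parabolic_endpoint_limit:
  assumes \<Omega>: "open \<Omega>" and sol: "parabolic_solution \<Omega> T f u0 u u1"
    and s0: "s0 \<in> {0..T}"
    and B: "\<forall>\<^sub>F s in at s0 within {0<..<T}. L2_norm \<Omega> (u1 s) \<le> B"
    and \<phi>: "\<phi> \<in> H01 \<Omega>"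
  shows "((\<lambda>s. L2_inner \<Omega> (u1 s) \<phi>) \<longlongrightarrow> L2_inner \<Omega> (f s0) \<phi> - dirichlet \<Omega> (u s0) \<phi>)
           (at s0 within {0<..<T})"
proof -
  let ?F = "at s0 within {0<..<T}"
  have fc: "L2_continuous_on \<Omega> {0..T} f" and uc: "L2_continuous_on \<Omega> {0..T} u"
    and ud: "has_L2_derivative_on \<Omega> {0<..T} u u1" and uH: "\<And>s. s \<in> {0..T} \<Longrightarrow> u s \<in> H01 \<Omega>"
    and pde: "\<And>s \<phi>. s \<in> {0<..<T} \<Longrightarrow> \<phi> \<in> H01 \<Omega> \<Longrightarrow>
       L2_inner \<Omega> (u1 s) \<phi> + dirichlet \<Omega> (u s) \<phi> = L2_inner \<Omega> (f s) \<phi>"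
    using sol by (auto simp: parabolic_solution_def)
  have inF: "\<forall>\<^sub>F s in ?F. s \<in> {0<..<T}" by (simp add: eventually_at_filter)
  have le: "?F \<le> at s0 within {0..T}" by (rule at_le) auto
  have fL: "f s \<in> L2_space \<Omega>" if "s \<in> {0..T}" for s using fc that by (auto simp: L2_continuous_on_def)
  have uL: "u s \<in> L2_space \<Omega>" if "s \<in> {0..T}" for s using uH[OF that] by (rule H01_L2)
  have fconv: "((\<lambda>q. L2_norm \<Omega> (\<lambda>x. f q x - f s0 x)) \<longlongrightarrow> 0) ?F"
    using fc s0 le by (auto simp: L2_continuous_on_def intro: tendsto_mono)
  have uconv: "((\<lambda>q. L2_norm \<Omega> (\<lambda>x. u q x - u s0 x)) \<longlongrightarrow> 0) ?F"
    using uc s0 le by (auto simp: L2_continuous_on_def intro: tendsto_mono)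
  have fLF: "\<forall>\<^sub>F q in ?F. f q \<in> L2_space \<Omega>" and uLF: "\<forall>\<^sub>F q in ?F. u q \<in> L2_space \<Omega>"
    and uHF: "\<forall>\<^sub>F q in ?F. u q \<in> H01 \<Omega>"
    using inF by (auto elim!: eventually_mono intro: fL uL uH)
  define b where "b = L2_norm \<Omega> (f s0) + 1 + max B 0"
  define b' where "b' = L2_norm \<Omega> (u s0) + 1"
  have "\<forall>\<^sub>F s in ?F. L2_norm \<Omega> (grad \<Omega> (u s)) \<le> sqrt (b * b')"
    using inF B eventually_L2_norm_bounded[OF fconv fLF fL[OF s0]]
      eventually_L2_norm_bounded[OF uconv uLF uL[OF s0]]
  proof eventually_elim
    case (elim s)
    then have s: "s \<in> {0..T}" "s \<in> {0<..T}" by auto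
    have "(L2_norm \<Omega> (grad \<Omega> (u s)))\<^sup>2 = L2_inner \<Omega> (f s) (u s) - L2_inner \<Omega> (u1 s) (u s)"
      using pde[OF elim(1) uH[OF s(1)]] by (simp add: L2_norm_power2)
    also have "\<dots> \<le> L2_norm \<Omega> (f s) * L2_norm \<Omega> (u s) + L2_norm \<Omega> (u1 s) * L2_norm \<Omega> (u s)"
      using L2_Cauchy_Schwarz[OF fL[OF s(1)] uL[OF s(1)]]
        L2_Cauchy_Schwarz[OF has_L2_derivative_on_L2(2)[OF ud s(2)] uL[OF s(1)]]
      by linarith
    also have "\<dots> = (L2_norm \<Omega> (f s) + L2_norm \<Omega> (u1 s)) * L2_norm \<Omega> (u s)" by (simp add: distrib_right)
    also have "\<dots> \<le> b * b'"
      using elim by (intro mult_mono) (auto simp: b_def b'_def)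
    finally show ?case by (rule real_le_rsqrt)
  qed
  then have "((\<lambda>s. dirichlet \<Omega> (u s) \<phi>) \<longlongrightarrow> dirichlet \<Omega> (u s0) \<phi>) ?F"
    by (rule dirichlet_tendsto[OF \<Omega> uHF uH[OF s0] uconv _ \<phi>])
  moreover have "((\<lambda>s. L2_inner \<Omega> (f s) \<phi>) \<longlongrightarrow> L2_inner \<Omega> (f s0) \<phi>) ?F"
    by (rule tendsto_L2_inner[OF fconv fLF fL[OF s0] H01_L2[OF \<phi>]])
  ultimately have lim: "((\<lambda>s. L2_inner \<Omega> (f s) \<phi> - dirichlet \<Omega> (u s) \<phi>)
      \<longlongrightarrow> L2_inner \<Omega> (f s0) \<phi> - dirichlet \<Omega> (u s0) \<phi>) ?F"
    by (intro tendsto_diff)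
  have "\<forall>\<^sub>F s in ?F. L2_inner \<Omega> (f s) \<phi> - dirichlet \<Omega> (u s) \<phi> = L2_inner \<Omega> (u1 s) \<phi>"
    using inF
  proof eventually_elim
    case (elim s)
    show ?case using pde[OF elim \<phi>] by simp
  qed
  then show ?thesis using lim by (rule Lim_transform_eventually[rotated])
qed

text \<open>At \<open>s = T\<close> the weak limit of \<open>u1\<close> is \<open>u1 T\<close>, since \<open>u1\<close> is differentiable there.\<close>

lemma parabolic_equation_closed:
  assumes \<Omega>: "open \<Omega>" and sol: "parabolic_solution \<Omega> T f u0 u u1"
    and u2: "has_L2_derivative_on \<Omega> {0<..T} u1 u2"
    and s: "s \<in> {0<..T}" and \<phi>: "\<phi> \<in> H01 \<Omega>"
  shows "dirichlet \<Omega> (u s) \<phi> = L2_inner \<Omega> (f s) \<phi> - L2_inner \<Omega> (u1 s) \<phi>"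
proof (cases "s < T")
  case True
  then have "L2_inner \<Omega> (u1 s) \<phi> + dirichlet \<Omega> (u s) \<phi> = L2_inner \<Omega> (f s) \<phi>"
    using sol s \<phi> by (simp add: parabolic_solution_def)
  then show ?thesis by linarith
next
  case False
  then have sT: "s = T" "T > 0" using s by auto
  let ?F = "at T within {0<..<T}"
  have T: "T \<in> {0<..T}" using sT by simp
  have inF: "\<forall>\<^sub>F s in ?F. s \<in> {0<..<T}" by (simp add: eventually_at_filter)
  have conv: "((\<lambda>q. L2_norm \<Omega> (\<lambda>x. u1 q x - u1 T x)) \<longlongrightarrow> 0) ?F"
    using has_L2_derivative_imp_continuous[OF u2 T] by (rule tendsto_mono[rotated]) (auto intro: at_le)
  have L: "\<forall>\<^sub>F q in ?F. u1 q \<in> L2_space \<Omega>"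
    using inF by eventually_elim (auto intro: has_L2_derivative_on_L2(1)[OF u2])
  have u1T: "u1 T \<in> L2_space \<Omega>" using has_L2_derivative_on_L2(1)[OF u2 T] .
  have lim1: "((\<lambda>q. L2_inner \<Omega> (u1 q) \<phi>) \<longlongrightarrow> L2_inner \<Omega> (u1 T) \<phi>) ?F"
    by (rule tendsto_L2_inner[OF conv L u1T H01_L2[OF \<phi>]])
  have lim2: "((\<lambda>q. L2_inner \<Omega> (u1 q) \<phi>) \<longlongrightarrow> L2_inner \<Omega> (f T) \<phi> - dirichlet \<Omega> (u T) \<phi>) ?F"
    by (rule parabolic_endpoint_limit[OF \<Omega> sol _ eventually_L2_norm_bounded[OF conv L u1T] \<phi>])
      (use sT in auto)
  have "?F \<noteq> bot"
    using islimpt_greaterThanLessThan2[OF sT(2)] by (simp add: trivial_limit_within)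
  from tendsto_unique[OF this lim1 lim2] show ?thesis using sT by simp
qed

text \<open>At time zero no time derivative is given; its role is played by the functional that the equation
  would assign to it. It is within \<open>M b\<close> of the values of \<open>u1\<close> on \<open>{0<..b}\<close>, as \<open>u1\<close> is
  Lipschitz continuous with constant \<open>M\<close> there.\<close>

lemma parabolic_initial_slope:
  assumes \<Omega>: "open \<Omega>" and sol: "parabolic_solution \<Omega> T f u0 u u1"
    and u2: "has_L2_derivative_on \<Omega> {0<..T} u1 u2"
    and b: "0 < b" "b \<le> T" and M: "\<And>s. s \<in> {0<..b} \<Longrightarrow> L2_norm \<Omega> (u2 s) \<le> M"
    and s: "s \<in> {0<..b}" and \<phi>: "\<phi> \<in> H01 \<Omega>"
  shows "\<bar>L2_inner \<Omega> (u1 s) \<phi> - (L2_inner \<Omega> (f 0) \<phi> - dirichlet \<Omega> (u 0) \<phi>)\<bar> \<le> M * L2_norm \<Omega> \<phi> * b"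
proof -
  let ?F = "at 0 within {0<..<T}"
  have M0: "M \<ge> 0" using M[of b] b order_trans[OF L2_norm_nonneg] by auto
  have u1L: "u1 q \<in> L2_space \<Omega>" if "q \<in> {0<..T}" for q
    using has_L2_derivative_on_L2(1)[OF u2 that] .
  have Lip: "\<bar>L2_inner \<Omega> (u1 p) \<psi> - L2_inner \<Omega> (u1 q) \<psi>\<bar> \<le> M * L2_norm \<Omega> \<psi> * b"
    if pq: "p \<in> {0<..b}" "q \<in> {0<..b}" and \<psi>: "\<psi> \<in> L2_space \<Omega>" for p q \<psi>
  proof -
    have *: "\<bar>L2_inner \<Omega> (u1 q) \<psi> - L2_inner \<Omega> (u1 p) \<psi>\<bar> \<le> M * L2_norm \<Omega> \<psi> * b"
      if pq: "p \<in> {0<..b}" "q \<in> {0<..b}" "p \<le> q" for p q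
    proof -
      have "\<bar>L2_inner \<Omega> (u1 q) \<psi> - L2_inner \<Omega> (u1 p) \<psi>\<bar> \<le> M * L2_norm \<Omega> \<psi> * (q - p)"
        by (rule L2_Lipschitz[OF u2 M _ _ _ _ \<psi>]) (use pq b in auto)
      also have "\<dots> \<le> M * L2_norm \<Omega> \<psi> * b"
        using pq M0 by (intro mult_left_mono) auto
      finally show ?thesis .
    qed
    show ?thesis using *[of p q] *[of q p] pq by (cases "p \<le> q") (auto simp: abs_minus_commute)
  qed
  have near: "\<forall>\<^sub>F q in ?F. q \<in> {0<..b}"
  proof -
    have "\<forall>\<^sub>F q in at 0 within {0<..<T}. q \<in> {..<b}"
      using b by (intro eventually_at_topological[THEN iffD2] exI[of _ "{..<b}"]) auto
    moreover have "\<forall>\<^sub>F q in ?F. q \<in> {0<..<T}" by (simp add: eventually_at_filter)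
    ultimately show ?thesis by eventually_elim auto
  qed
  \<comment> \<open>Lipschitz continuity in norm follows by testing with the increment itself.\<close>
  have bound: "L2_norm \<Omega> (u1 q) \<le> L2_norm \<Omega> (u1 b) + M * b" if q: "q \<in> {0<..b}" for q
  proof -
    let ?w = "\<lambda>x. u1 q x - u1 b x"
    have L: "u1 q \<in> L2_space \<Omega>" "u1 b \<in> L2_space \<Omega>" using q b by (auto intro: u1L)
    have w: "?w \<in> L2_space \<Omega>" using L by (rule L2_space_diff)
    have "L2_norm \<Omega> ?w * L2_norm \<Omega> ?w \<le> M * b * L2_norm \<Omega> ?w"
      using Lip[OF q _ w, of b] b L2_inner_diff_left[OF L w]
      by (simp add: L2_norm_power2[unfolded power2_eq_square] mult_ac)
    then have "L2_norm \<Omega> ?w \<le> M * b"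
      using M0 b L2_norm_nonneg[of \<Omega> ?w] by (cases "L2_norm \<Omega> ?w = 0") auto
    then show ?thesis using L2_norm_triangle[OF w L(2)] by simp
  qed
  have ev: "\<forall>\<^sub>F q in ?F. L2_norm \<Omega> (u1 q) \<le> L2_norm \<Omega> (u1 b) + M * b"
    using near by (rule eventually_mono) (rule bound)
  let ?p = "L2_inner \<Omega> (f 0) \<phi> - dirichlet \<Omega> (u 0) \<phi>"
  have "((\<lambda>q. L2_inner \<Omega> (u1 q) \<phi>) \<longlongrightarrow> ?p) ?F"
    by (rule parabolic_endpoint_limit[OF \<Omega> sol _ ev \<phi>]) (use b in auto)
  then have lim: "((\<lambda>q. \<bar>L2_inner \<Omega> (u1 s) \<phi> - L2_inner \<Omega> (u1 q) \<phi>\<bar>) \<longlongrightarrow> \<bar>L2_inner \<Omega> (u1 s) \<phi> - ?p\<bar>) ?F"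
    by (intro tendsto_intros)
  have "\<forall>\<^sub>F q in ?F. \<bar>L2_inner \<Omega> (u1 s) \<phi> - L2_inner \<Omega> (u1 q) \<phi>\<bar> \<le> M * L2_norm \<Omega> \<phi> * b"
    using near by (rule eventually_mono) (rule Lip[OF s _ H01_L2[OF \<phi>]])
  moreover have "?F \<noteq> bot"
    using islimpt_greaterThanLessThan1[of 0 T] b by (simp add: trivial_limit_within)
  ultimately show ?thesis using lim tendsto_upperbound by blast
qed

section \<open>Convergence\<close>

lemma wsbdf2_residual_diff:
  assumes \<Omega>: "open \<Omega>" and v: "\<And>k. k \<le> n \<Longrightarrow> v k \<in> H01 \<Omega>" and w: "\<And>k. k \<le> n \<Longrightarrow> w k \<in> H01 \<Omega>"
    and \<phi>: "\<phi> \<in> H01 \<Omega>"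
  shows "wsbdf2_residual \<Omega> \<theta> \<tau> c (\<lambda>k x. v k x - w k x) n \<phi>
       = wsbdf2_residual \<Omega> \<theta> \<tau> c v n \<phi> - wsbdf2_residual \<Omega> \<theta> \<tau> c w n \<phi>"
proof -
  have i: "L2_inner \<Omega> (\<lambda>x. v k x - w k x) \<phi> = L2_inner \<Omega> (v k) \<phi> - L2_inner \<Omega> (w k) \<phi>"
    if "k \<le> n" for k
    using that by (intro L2_inner_diff_left H01_L2 v w \<phi>)
  have d: "dirichlet \<Omega> (\<lambda>x. v k x - w k x) \<phi> = dirichlet \<Omega> (v k) \<phi> - dirichlet \<Omega> (w k) \<phi>"
    if "k \<le> n" for k
    using dirichlet_lincomb_left[OF \<Omega> v[OF that] w[OF that] \<phi>, of 1 "-1"] by simp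
  show ?thesis
    unfolding wsbdf2_residual_def i[OF order_refl] i[OF diff_le_self] d[OF order_refl] d[OF diff_le_self]
    by (simp add: diff_divide_distrib add_divide_distrib algebra_simps)
qed

text \<open>The scheme inserted into the exact solution. In the first step the quotient is compared with the
  initial slope, which costs only the second derivative but yields only first order.\<close>

lemma wsbdf2_truncation_error:
  assumes \<theta>: "1/2 \<le> \<theta>" "\<theta> \<le> 1" and \<Omega>: "open \<Omega>"
    and sol: "parabolic_solution \<Omega> T f u0 u u1"
    and u2: "has_L2_derivative_on \<Omega> {0<..T} u1 u2" and u3: "has_L2_derivative_on \<Omega> {0<..T} u2 u3"
    and M2: "\<And>s. s \<in> {0<..t 1} \<Longrightarrow> L2_norm \<Omega> (u2 s) \<le> M2"
    and M3: "\<And>s. s \<in> {0<..T} \<Longrightarrow> L2_norm \<Omega> (u3 s) \<le> M3"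
    and t0: "t 0 = 0" and tT: "t n \<le> T" and n: "n \<ge> 1"
    and \<tau>: "\<And>k. k \<in> {1..n} \<Longrightarrow> 0 < step t k \<and> step t k \<le> \<tau>m"
    and \<phi>: "\<phi> \<in> H01 \<Omega>"
  shows "\<bar>wsbdf2_residual \<Omega> \<theta> (step t) (history_weight \<theta> t) (\<lambda>k. u (t k)) n \<phi>
      - (\<theta> * L2_inner \<Omega> (f (t n)) \<phi> + (1 - \<theta>) * L2_inner \<Omega> (f (t (n - 1))) \<phi>)\<bar>
      \<le> (if n = 1 then 2 * M2 * \<tau>m else 7 * M3 * \<tau>m\<^sup>2) * L2_norm \<Omega> \<phi>"
proof -
  have \<phi>L: "\<phi> \<in> L2_space \<Omega>" using H01_L2[OF \<phi>] .
  define h h1 h2 h3 where "h s = L2_inner \<Omega> (u s) \<phi>" and "h1 s = L2_inner \<Omega> (u1 s) \<phi>"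
    and "h2 s = L2_inner \<Omega> (u2 s) \<phi>" and "h3 s = L2_inner \<Omega> (u3 s) \<phi>" for s
  have ud: "has_L2_derivative_on \<Omega> {0<..T} u u1" and uc: "L2_continuous_on \<Omega> {0..T} u"
    using sol by (auto simp: parabolic_solution_def)
  have d: "(h has_real_derivative h1 s) (at s within {0<..T})"
    "(h1 has_real_derivative h2 s) (at s within {0<..T})"
    "(h2 has_real_derivative h3 s) (at s within {0<..T})" if "s \<in> {0<..T}" for s
    unfolding h_def[abs_def] h1_def[abs_def] h2_def[abs_def] h3_def[abs_def]
    using that by (auto intro: has_L2_derivative_inner[OF ud \<phi>L] has_L2_derivative_inner[OF u2 \<phi>L]
        has_L2_derivative_inner[OF u3 \<phi>L])
  have cont: "continuous_on {0..T} h"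
    unfolding continuous_on_def h_def[abs_def]
  proof
    fix s assume s: "s \<in> {0..T}"
    have "\<forall>\<^sub>F q in at s within {0..T}. u q \<in> L2_space \<Omega>"
      unfolding eventually_at_filter
      by (rule always_eventually) (use uc in \<open>auto simp: L2_continuous_on_def\<close>)
    then show "((\<lambda>q. L2_inner \<Omega> (u q) \<phi>) \<longlongrightarrow> L2_inner \<Omega> (u s) \<phi>) (at s within {0..T})"
      using uc s \<phi>L by (intro tendsto_L2_inner) (auto simp: L2_continuous_on_def)
  qed
  have pde: "dirichlet \<Omega> (u s) \<phi> = L2_inner \<Omega> (f s) \<phi> - h1 s" if "s \<in> {0<..T}" for s
    unfolding h1_def using parabolic_equation_closed[OF \<Omega> sol u2 that \<phi>] .
  have f_eq: "L2_inner \<Omega> (f s) \<phi> = dirichlet \<Omega> (u s) \<phi> + h1 s" if "s \<in> {0<..T}" for s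
    using pde[OF that] by simp
  have t_mono: "t j < t k" if "j < k" "k \<le> n" for j k
    using that
  proof (induction k)
    case (Suc k)
    have "t k < t (Suc k)" using \<tau>[of "Suc k"] Suc.prems by (simp add: step_def)
    then show ?case using Suc by (cases "j = k") auto
  qed simp
  have tn: "0 < t n" using t_mono[of 0 n] n t0 by simp
  show ?thesis
  proof (cases "n = 1")
    case True
    define p where "p = L2_inner \<Omega> (f 0) \<phi> - dirichlet \<Omega> (u 0) \<phi>"
    let ?b = "M2 * L2_norm \<Omega> \<phi> * t 1"
    have t1: "0 < t 1" "t 1 \<le> T" using tn tT True by auto
    have st: "step t 1 = t 1" using t0 by (simp add: step_def)
    have M2_nonneg: "M2 \<ge> 0" using M2[of "t 1"] t1 order_trans[OF L2_norm_nonneg] by auto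
    have slope: "\<bar>h1 s - p\<bar> \<le> ?b" if "s \<in> {0<..t 1}" for s
      unfolding h1_def p_def using parabolic_initial_slope[OF \<Omega> sol u2 t1 M2 that \<phi>] by simp
    have "\<bar>(h (t 1) - p * t 1) - (h 0 - p * 0)\<bar> \<le> ?b * (t 1 - 0)"
    proof (rule real_derivative_bound)
      show "continuous_on {0..t 1} (\<lambda>s. h s - p * s)"
        using t1 by (intro continuous_intros continuous_on_subset[OF cont]) auto
      fix s assume s: "0 < s" "s < t 1"
      have "(h has_real_derivative h1 s) (at s)"
        by (rule derivative_within_at[OF d(1)]) (use s t1 in auto)
      then show "((\<lambda>s. h s - p * s) has_real_derivative (h1 s - p)) (at s)"
        by (auto intro!: derivative_eq_intros)
      show "\<bar>h1 s - p\<bar> \<le> ?b" using s by (intro slope) auto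
    qed (use t1 in simp)
    moreover have "(h (t 1) - p * t 1) - (h 0 - p * 0) = ((h (t 1) - h 0) / t 1 - p) * t 1"
      using t1 by (simp add: field_simps)
    ultimately have "\<bar>((h (t 1) - h 0) / t 1 - p) * t 1\<bar> \<le> ?b * t 1" by simp
    then have quot: "\<bar>(h (t 1) - h 0) / t 1 - p\<bar> \<le> ?b"
      using t1 by (simp only: abs_mult abs_of_pos mult_le_cancel_right_pos)
    have "\<bar>\<theta> * (h1 (t 1) - p)\<bar> \<le> 1 * ?b"
      unfolding abs_mult using slope[of "t 1"] t1 \<theta> by (intro mult_mono) auto
    with quot have "\<bar>((h (t 1) - h 0) / t 1 - p) - \<theta> * (h1 (t 1) - p)\<bar> \<le> 2 * ?b" by linarith
    also have "2 * ?b \<le> 2 * M2 * \<tau>m * L2_norm \<Omega> \<phi>"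
    proof -
      have "t 1 \<le> \<tau>m" using \<tau>[of 1] True st by simp
      then have "(2 * M2 * L2_norm \<Omega> \<phi>) * t 1 \<le> (2 * M2 * L2_norm \<Omega> \<phi>) * \<tau>m"
        using M2_nonneg by (intro mult_left_mono) auto
      then show ?thesis by (simp add: mult_ac)
    qed
    finally have bound: "\<bar>((h (t 1) - h 0) / t 1 - p) - \<theta> * (h1 (t 1) - p)\<bar> \<le> 2 * M2 * \<tau>m * L2_norm \<Omega> \<phi>" .
    have "wsbdf2_residual \<Omega> \<theta> (step t) (history_weight \<theta> t) (\<lambda>k. u (t k)) 1 \<phi>
        - (\<theta> * L2_inner \<Omega> (f (t 1)) \<phi> + (1 - \<theta>) * L2_inner \<Omega> (f (t (1 - 1))) \<phi>)
        = ((h (t 1) - h 0) / t 1 - p) - \<theta> * (h1 (t 1) - p)"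
      using t1 t0 st by (simp add: wsbdf2_residual_def history_weight_def h_def p_def f_eq algebra_simps)
    with bound True show ?thesis by simp
  next
    case False
    then have n2: "n \<ge> 2" using n by simp
    have grid: "0 \<le> t (n - 2)" "t (n - 2) < t (n - 1)" "t (n - 1) < t n"
    proof -
      show "0 \<le> t (n - 2)" using t_mono[of 0 "n - 2"] t0 by (cases "n - 2 = 0") auto
      show "t (n - 2) < t (n - 1)" "t (n - 1) < t n" using n2 by (auto intro!: t_mono)
    qed
    have steps: "step t n = t n - t (n - 1)" "step t (n - 1) = t (n - 1) - t (n - 2)"
      using n2 by (auto simp: step_def numeral_2_eq_2)
    have h3_le: "\<bar>h3 s\<bar> \<le> M3 * L2_norm \<Omega> \<phi>" if "s \<in> {0<..T}" for s
    proof -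
      have "\<bar>h3 s\<bar> \<le> L2_norm \<Omega> (u3 s) * L2_norm \<Omega> \<phi>"
        unfolding h3_def by (rule L2_Cauchy_Schwarz[OF has_L2_derivative_on_L2(2)[OF u3 that] \<phi>L])
      also have "\<dots> \<le> M3 * L2_norm \<Omega> \<phi>" by (intro mult_right_mono M3 that) simp
      finally show ?thesis .
    qed
    have "wsbdf2_residual \<Omega> \<theta> (step t) (history_weight \<theta> t) (\<lambda>k. u (t k)) n \<phi>
        - (\<theta> * L2_inner \<Omega> (f (t n)) \<phi> + (1 - \<theta>) * L2_inner \<Omega> (f (t (n - 1))) \<phi>)
      = (1 + history_weight \<theta> t n) * ((h (t n) - h (t (n - 1))) / (t n - t (n - 1)))
        - history_weight \<theta> t n * ((h (t (n - 1)) - h (t (n - 2))) / (t (n - 1) - t (n - 2)))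
        - (\<theta> * h1 (t n) + (1 - \<theta>) * h1 (t (n - 1)))"
    proof -
      have "t n \<in> {0<..T}" "t (n - 1) \<in> {0<..T}" using grid tT by auto
      then show ?thesis
        unfolding wsbdf2_residual_def steps h_def
        by (simp only: f_eq) (simp add: algebra_simps)
    qed
    moreover have "\<bar>\<dots>\<bar> \<le> 7 * (M3 * L2_norm \<Omega> \<phi>) * \<tau>m\<^sup>2"
    proof (rule wsbdf2_consistency[OF grid tT cont d h3_le _ _ \<theta>])
      show "t n - t (n - 1) \<le> \<tau>m" "t (n - 1) - t (n - 2) \<le> \<tau>m"
      proof -
        have "n - 1 \<in> {1..n}" "n \<in> {1..n}" using n2 by auto
        then show "t n - t (n - 1) \<le> \<tau>m" "t (n - 1) - t (n - 2) \<le> \<tau>m"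
          unfolding steps[symmetric] by (blast dest: \<tau>)+
      qed
      show "history_weight \<theta> t n
          = (2 * \<theta> - 1) * (t n - t (n - 1)) / ((t n - t (n - 1)) + (t (n - 1) - t (n - 2)))"
        unfolding history_weight_def steps using n2 by simp
    qed
    ultimately show ?thesis using False by (simp add: mult_ac)
  qed
qed

lemma sum_half_powers_le: "(\<Sum>k=1..n. (1/2::real) ^ (k - 1)) \<le> 2"
proof -
  have "(\<Sum>k=1..n. (1/2::real) ^ (k - 1)) = 2 - 2 * (1/2) ^ n" for n
    by (induction n) auto
  then show ?thesis by simp
qed

lemma sum_steps: "(\<Sum>k=1..n. step t k) = t n - t 0"
  by (induction n) (auto simp: step_def)

theorem theorem4p1:
  fixes \<Omega> :: "'a::euclidean_space set" and \<theta> C\<^sub>\<Omega> :: real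
  assumes "1/2 \<le> \<theta>" and "\<theta> \<le> 1"
    and "open \<Omega>" and "connected \<Omega>" and "\<Omega> \<noteq> {}"
    and "C\<^sub>\<Omega> > 0"
    and "\<forall>\<phi>\<in>H01 \<Omega>. L2_norm \<Omega> \<phi> \<le> C\<^sub>\<Omega> * L2_norm \<Omega> (grad \<Omega> \<phi>)"
  shows "\<exists>C>0. \<forall>(N::nat) (T::real) (t :: nat \<Rightarrow> real)
      (f :: real \<Rightarrow> 'a \<Rightarrow> real) (u0 :: 'a \<Rightarrow> real)
      (u :: real \<Rightarrow> 'a \<Rightarrow> real) (u1 :: real \<Rightarrow> 'a \<Rightarrow> real)
      (u2 :: real \<Rightarrow> 'a \<Rightarrow> real) (u3 :: real \<Rightarrow> 'a \<Rightarrow> real) (U :: nat \<Rightarrow> 'a \<Rightarrow> real).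
      time_grid N T t \<longrightarrow>
      parabolic_solution \<Omega> T f u0 u u1 \<longrightarrow>
      has_L2_derivative_on \<Omega> {0<..T} u1 u2 \<longrightarrow>
      has_L2_derivative_on \<Omega> {0<..T} u2 u3 \<longrightarrow>
      bdd_above ((\<lambda>s. L2_norm \<Omega> (u2 s)) ` {0<..t 1}) \<longrightarrow>
      bdd_above ((\<lambda>s. L2_norm \<Omega> (u3 s)) ` {0<..T}) \<longrightarrow>
      wsbdf2_solution \<Omega> \<theta> N t f u0 U \<longrightarrow>
      (\<forall>n\<in>{1..N}.
         L2_norm \<Omega> (\<lambda>x. u (t n) x - U n x)
           \<le> C * ((max_step N t)\<^sup>2 * (SUP s\<in>{0<..t 1}. L2_norm \<Omega> (u2 s))
                  + t n * (max_step N t)\<^sup>2 * (SUP s\<in>{0<..T}. L2_norm \<Omega> (u3 s))))"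
  \<comment> \<open>The constant 7 of the consistency bound, doubled by the memory of the averaged forcing.\<close>
proof (intro exI[of _ 14] conjI allI impI ballI)
  show "(0::real) < 14" by simp
  note \<theta> = assms(1,2) and \<Omega> = assms(3)
  fix N T and t :: "nat \<Rightarrow> real" and f u u1 u2 u3 :: "real \<Rightarrow> 'a \<Rightarrow> real"
    and u0 :: "'a \<Rightarrow> real" and U n
  assume grid: "time_grid N T t" and sol: "parabolic_solution \<Omega> T f u0 u u1"
    and u2: "has_L2_derivative_on \<Omega> {0<..T} u1 u2" and u3: "has_L2_derivative_on \<Omega> {0<..T} u2 u3"
    and bdd2: "bdd_above ((\<lambda>s. L2_norm \<Omega> (u2 s)) ` {0<..t 1})"
    and bdd3: "bdd_above ((\<lambda>s. L2_norm \<Omega> (u3 s)) ` {0<..T})"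
    and U: "wsbdf2_solution \<Omega> \<theta> N t f u0 U" and n: "n \<in> {1..N}"
  define M2 M3 \<tau>m where "M2 = (SUP s\<in>{0<..t 1}. L2_norm \<Omega> (u2 s))"
    and "M3 = (SUP s\<in>{0<..T}. L2_norm \<Omega> (u3 s))" and "\<tau>m = max_step N t"
  have N: "N \<ge> 1" and t0: "t 0 = 0" and tN: "t N = T" using grid by (auto simp: time_grid_def)
  have \<tau>: "0 < step t k \<and> step t k \<le> \<tau>m" if "k \<in> {1..N}" for k
    using grid that by (auto simp: time_grid_def step_def \<tau>m_def max_step_def intro!: Max_ge)
  have t_mono: "t j \<le> t k" if "j \<le> k" "k \<le> N" for j k
    using that
  proof (induction k)
    case (Suc k)
    have "t k < t (Suc k)" using \<tau>[of "Suc k"] Suc.prems by (simp add: step_def)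
    then show ?case using Suc by (cases "j = Suc k") auto
  qed simp
  have t_range: "t k \<in> {0..T}" if "k \<le> N" for k
    using t_mono[of 0 k] t_mono[of k N] that t0 tN by simp
  have t1: "0 < t 1" "t 1 \<le> T"
    using \<tau>[of 1] N t0 t_range[of 1] by (auto simp: step_def)
  have M2: "L2_norm \<Omega> (u2 s) \<le> M2" if "s \<in> {0<..t 1}" for s
    unfolding M2_def using bdd2 that by (rule cSUP_upper[rotated])
  have M3: "L2_norm \<Omega> (u3 s) \<le> M3" if "s \<in> {0<..T}" for s
    unfolding M3_def using bdd3 that by (rule cSUP_upper[rotated])
  have M2_nonneg: "M2 \<ge> 0" using order_trans[OF L2_norm_nonneg M2[of "t 1"]] t1 by simp
  have M3_nonneg: "M3 \<ge> 0" using order_trans[OF L2_norm_nonneg M3[of T]] t1 by simp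
  have \<tau>m: "\<tau>m > 0" using \<tau>[of 1] N by auto

  let ?c = "history_weight \<theta> t" and ?e = "\<lambda>k x. u (t k) x - U k x"
  have c: "0 \<le> ?c k \<and> ?c k \<le> 2 * \<theta> - 1" if k: "k \<in> {1..N}" for k
  proof (cases "k = 1")
    case False
    have "k \<ge> 2" using k False by auto
    then have "k - 1 \<in> {1..N}" using k by auto
    then have p: "step t k > 0" "step t (k - 1) > 0" using \<tau>[OF k] \<tau>[of "k - 1"] by auto
    have "(2 * \<theta> - 1) * step t k \<le> (2 * \<theta> - 1) * (step t k + step t (k - 1))"
      using p \<theta> by (intro mult_left_mono) auto
    then show ?thesis using False k p \<theta> by (auto simp: history_weight_def divide_le_eq)
  qed (use \<theta> in \<open>simp add: history_weight_def\<close>)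

  have uH: "u (t k) \<in> H01 \<Omega>" if "k \<le> N" for k
    using sol t_range[OF that] by (auto simp: parabolic_solution_def)
  have U0: "U 0 \<in> L2_space \<Omega>" using U by (simp add: wsbdf2_solution_def)
  have e0L: "?e 0 \<in> L2_space \<Omega>" using H01_L2[OF uH[of 0]] U0 by (intro L2_space_diff) auto
  have "AE x in lebesgue_on \<Omega>. ?e 0 x = 0"
  proof -
    have "AE x in lebesgue_on \<Omega>. u 0 x = u0 x" "AE x in lebesgue_on \<Omega>. U 0 x = u0 x"
      using sol U by (auto simp: parabolic_solution_def wsbdf2_solution_def)
    then show ?thesis by eventually_elim (simp add: t0)
  qed
  then have e0: "L2_norm \<Omega> (?e 0) = 0" by (rule L2_norm_AE_zero)
  have U0H: "U 0 \<in> H01 \<Omega>"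
    using H01_lincomb[OF \<Omega> uH[of 0] H01_null[OF \<Omega> e0L e0], of 1 "-1"] by simp
  have UH: "U k \<in> H01 \<Omega>" if "k \<le> N" for k
    using U that U0H by (cases "k = 0") (auto simp: wsbdf2_solution_def)
  have eH: "?e k \<in> H01 \<Omega>" if "k \<le> N" for k
    using H01_lincomb[OF \<Omega> uH[OF that] UH[OF that], of 1 "-1"] by simp

  \<comment> \<open>The scheme cancels the data, so the error and the exact solution have the same defect.\<close>
  have residual: "\<bar>wsbdf2_residual \<Omega> \<theta> (step t) ?c ?e k \<phi>\<bar>
      \<le> (if k = 1 then 2 * M2 * \<tau>m else 7 * M3 * \<tau>m\<^sup>2) * L2_norm \<Omega> \<phi>"
    if k: "k \<in> {1..N}" and \<phi>: "\<phi> \<in> H01 \<Omega>" for k \<phi>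
  proof -
    have le: "j \<le> N" if "j \<le> k" for j using that k by simp
    have fL: "f s \<in> L2_space \<Omega>" if "s \<in> {0..T}" for s
      using sol that by (auto simp: parabolic_solution_def L2_continuous_on_def)
    have fk: "f (t k) \<in> L2_space \<Omega>" "f (t (k - 1)) \<in> L2_space \<Omega>"
      using fL t_range le[of k] le[of "k - 1"] by auto
    have "wsbdf2_residual \<Omega> \<theta> (step t) ?c U k \<phi>
        = L2_inner \<Omega> (wsbdf2_op \<theta> t U k) \<phi> + \<theta> * dirichlet \<Omega> (U k) \<phi>
          + (1 - \<theta>) * dirichlet \<Omega> (U (k - 1)) \<phi>"
    proof -
      have "L2_inner \<Omega> (wsbdf2_op \<theta> t U k) \<phi>
        = (1 + ?c k) * ((L2_inner \<Omega> (U k) \<phi> - L2_inner \<Omega> (U (k - 1)) \<phi>) / step t k)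
          - ?c k * ((L2_inner \<Omega> (U (k - 1)) \<phi> - L2_inner \<Omega> (U (k - 2)) \<phi>) / step t (k - 1))"
        using k \<tau> by (intro wsbdf2_op_inner H01_L2[OF UH] H01_L2[OF \<phi>]) auto
      then show ?thesis by (simp add: wsbdf2_residual_def)
    qed
    also have "\<dots> = L2_inner \<Omega> (\<lambda>x. \<theta> * f (t k) x + (1 - \<theta>) * f (t (k - 1)) x) \<phi>"
      using U k \<phi> by (simp add: wsbdf2_solution_def)
    also have "\<dots> = \<theta> * L2_inner \<Omega> (f (t k)) \<phi> + (1 - \<theta>) * L2_inner \<Omega> (f (t (k - 1))) \<phi>"
      using L2_inner_add_left[OF L2_space_mult[OF fk(1), of \<theta>] L2_space_mult[OF fk(2), of "1 - \<theta>"] H01_L2[OF \<phi>]]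
      by (simp add: L2_inner_mult_left)
    finally have scheme: "wsbdf2_residual \<Omega> \<theta> (step t) ?c U k \<phi> = \<dots>" .
    have "wsbdf2_residual \<Omega> \<theta> (step t) ?c ?e k \<phi>
        = wsbdf2_residual \<Omega> \<theta> (step t) ?c (\<lambda>k. u (t k)) k \<phi> - wsbdf2_residual \<Omega> \<theta> (step t) ?c U k \<phi>"
      by (rule wsbdf2_residual_diff[OF \<Omega> _ _ \<phi>]) (use le uH UH in auto)
    also have "\<bar>\<dots>\<bar> \<le> (if k = 1 then 2 * M2 * \<tau>m else 7 * M3 * \<tau>m\<^sup>2) * L2_norm \<Omega> \<phi>"
      unfolding scheme
    proof (rule wsbdf2_truncation_error[OF \<theta> \<Omega> sol u2 u3 _ _ _ _ _ _ \<phi>])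
      show "t 0 = 0" by (rule t0)
      show "L2_norm \<Omega> (u2 s) \<le> M2" if "s \<in> {0<..t 1}" for s using that by (rule M2)
      show "L2_norm \<Omega> (u3 s) \<le> M3" if "s \<in> {0<..T}" for s using that by (rule M3)
      show "t k \<le> T" "1 \<le> k" using t_range[of k] k by auto
      show "0 < step t j \<and> step t j \<le> \<tau>m" if "j \<in> {1..k}" for j using that k by (intro \<tau>) auto
    qed
    finally show ?thesis .
  qed

  have "L2_norm \<Omega> (?e n) \<le> (\<Sum>k=1..n. step t k * ((1/2) ^ (k - 1) * (2 * M2 * \<tau>m) + 2 * (7 * M3 * \<tau>m\<^sup>2)))"
  proof (rule wsbdf2_L2_stability[where N = N and c = ?c and e = ?e and \<theta> = \<theta>])
    show "\<bar>wsbdf2_residual \<Omega> \<theta> (step t) ?c ?e 1 \<phi>\<bar> \<le> 2 * M2 * \<tau>m * L2_norm \<Omega> \<phi>"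
      if "\<phi> \<in> H01 \<Omega>" for \<phi>
      using residual[OF _ that, of 1] N by simp
    show "\<bar>wsbdf2_residual \<Omega> \<theta> (step t) ?c ?e k \<phi>\<bar> \<le> 7 * M3 * \<tau>m\<^sup>2 * L2_norm \<Omega> \<phi>"
      if "k \<in> {2..N}" "\<phi> \<in> H01 \<Omega>" for k \<phi>
      using residual[OF _ that(2), of k] that(1) by simp
  qed (use \<Omega> \<theta> \<tau> c eH e0L e0 M2_nonneg M3_nonneg \<tau>m n in \<open>auto simp: history_weight_def\<close>)
  also have "\<dots> \<le> (\<Sum>k=1..n. \<tau>m * ((1/2) ^ (k - 1) * (2 * M2 * \<tau>m)) + step t k * (14 * M3 * \<tau>m\<^sup>2))"
    unfolding distrib_left
    using \<tau> n M2_nonneg \<tau>m by (intro sum_mono add_mono mult_right_mono) auto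
  also have "\<dots> = 2 * M2 * \<tau>m\<^sup>2 * (\<Sum>k=1..n. (1/2) ^ (k - 1)) + t n * (14 * M3 * \<tau>m\<^sup>2)"
  proof -
    have "(\<Sum>k=1..n. \<tau>m * ((1/2) ^ (k - 1) * (2 * M2 * \<tau>m))) = 2 * M2 * \<tau>m\<^sup>2 * (\<Sum>k=1..n. (1/2) ^ (k - 1))"
      by (simp add: sum_distrib_left power2_eq_square mult_ac)
    moreover have "(\<Sum>k=1..n. step t k * (14 * M3 * \<tau>m\<^sup>2)) = t n * (14 * M3 * \<tau>m\<^sup>2)"
      by (simp only: sum_distrib_right[symmetric] sum_steps t0 diff_zero)
    ultimately show ?thesis by (simp only: sum.distrib)
  qed
  also have "\<dots> \<le> 2 * M2 * \<tau>m\<^sup>2 * 2 + t n * (14 * M3 * \<tau>m\<^sup>2)"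
    using M2_nonneg by (intro add_right_mono mult_left_mono sum_half_powers_le) auto
  also have "\<dots> \<le> 14 * (\<tau>m\<^sup>2 * M2 + t n * \<tau>m\<^sup>2 * M3)"
    using mult_nonneg_nonneg[OF M2_nonneg zero_le_power2[of \<tau>m]] by (simp add: algebra_simps)
  finally show "L2_norm \<Omega> (\<lambda>x. u (t n) x - U n x)
      \<le> 14 * ((max_step N t)\<^sup>2 * (SUP s\<in>{0<..t 1}. L2_norm \<Omega> (u2 s))
              + t n * (max_step N t)\<^sup>2 * (SUP s\<in>{0<..T}. L2_norm \<Omega> (u3 s)))"
    by (simp add: M2_def M3_def \<tau>m_def)
qed

end
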